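(* Let $m\ge2$, and define $p_m=\inf\{p\ge1:\mathfrak{F}_p>1\}$ and $p_m^{\mathrm{convex}}=\inf\{p\ge1:\mathfrak{F}^{\mathrm{convex}}_p>1\}$. Then $$2\le p_m\le p_m^{\mathrm{convex}}\le 8m,$$ and $\mathfrak{F}_p=1$ for all $1\le p\le p_m$.
   Context: For a non-empty open $\Omega\subset\mathbb{R}^m$ with $|\Omega|<\infty$, $\lambda_1(\Omega)=\inf_{\varphi\in H_0^1(\Omega)\setminus\{0\}}\int_\Omega|D\varphi|^2/\int_\Omega\varphi^2$, $v_\Omega$ is the unique solution of $-\Delta v=1$, $v\in H_0^1(\Omega)$, $F_p(\Omega)=\|v_\Omega\|_{L^p(\Omega)}\lambda_1(\Omega)/|\Omega|^{1/p}$ for $1\le p<\infty$. For $1\le p<\infty$: $\mathfrak{F}_p=\sup\{F_p(\Omega):\Omega\text{ open in }\mathbb{R}^m,\ 0<|\Omega|<\infty\}$ and $\mathfrak{F}^{\mathrm{convex}}_p=\sup\{F_p(\Omega):\Omega\text{ open, convex in }\mathbb{R}^m,\ 0<|\Omega|<\infty\}$. *)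

theory Defs
  imports "HOL-Analysis.Analysis"
begin

coinductive smooth_fun :: "('a::euclidean_space \<Rightarrow> real) \<Rightarrow> bool" where
  "(\<forall>x. f differentiable (at x)) \<Longrightarrow>
   (\<forall>b\<in>Basis. smooth_fun (\<lambda>x. frechet_derivative f (at x) b)) \<Longrightarrow> smooth_fun f"

definition tsupport :: "('a::euclidean_space \<Rightarrow> real) \<Rightarrow> 'a set" where
  "tsupport f = closure {x. f x \<noteq> 0}"

definition test_fun :: "'a::euclidean_space set \<Rightarrow> ('a \<Rightarrow> real) \<Rightarrow> bool" where
  "test_fun \<Omega> \<phi> \<longleftrightarrow> smooth_fun \<phi> \<and> compact (tsupport \<phi>) \<and> tsupport \<phi> \<subseteq> \<Omega>"

definition grad :: "('a::euclidean_space \<Rightarrow> real) \<Rightarrow> 'a \<Rightarrow> 'a" where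
  "grad f x = (\<Sum>b\<in>Basis. frechet_derivative f (at x) b *\<^sub>R b)"

text \<open>H_0^1(Omega): closure of C_c^infinity(Omega) in the H^1 norm. Elements are
  represented as functions on the whole space (vanishing a.e. outside Omega)
  together with their (weak) gradient G.\<close>
definition H01 :: "'a::euclidean_space set \<Rightarrow> ('a \<Rightarrow> real) \<Rightarrow> ('a \<Rightarrow> 'a) \<Rightarrow> bool" where
  "H01 \<Omega> u G \<longleftrightarrow>
     u \<in> borel_measurable lebesgue \<and> G \<in> borel_measurable lebesgue \<and>
     integrable lebesgue (\<lambda>x. (u x)\<^sup>2) \<and> integrable lebesgue (\<lambda>x. (norm (G x))\<^sup>2) \<and>
     (\<exists>\<phi>::nat \<Rightarrow> 'a \<Rightarrow> real. (\<forall>n. test_fun \<Omega> (\<phi> n)) \<and>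
        (\<lambda>n. \<integral>x. (\<phi> n x - u x)\<^sup>2 \<partial>lebesgue) \<longlonglongrightarrow> 0 \<and>
        (\<lambda>n. \<integral>x. (norm (grad (\<phi> n) x - G x))\<^sup>2 \<partial>lebesgue) \<longlonglongrightarrow> 0)"

definition lambda1 :: "'a::euclidean_space set \<Rightarrow> real" where
  "lambda1 \<Omega> = Inf {(\<integral>x. (norm (G x))\<^sup>2 \<partial>lebesgue) / (\<integral>x. (u x)\<^sup>2 \<partial>lebesgue) | u G.
                      H01 \<Omega> u G \<and> (\<integral>x. (u x)\<^sup>2 \<partial>lebesgue) \<noteq> 0}"

definition is_torsion :: "'a::euclidean_space set \<Rightarrow> ('a \<Rightarrow> real) \<Rightarrow> bool" where
  "is_torsion \<Omega> v \<longleftrightarrow> (\<exists>G. H01 \<Omega> v G \<and>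
     (\<forall>\<phi>. test_fun \<Omega> \<phi> \<longrightarrow>
        (\<integral>x. G x \<bullet> grad \<phi> x \<partial>lebesgue) = (\<integral>x. \<phi> x \<partial>lebesgue)))"

text \<open>The torsion function v_Omega (unique up to null sets).\<close>
definition torsion :: "'a::euclidean_space set \<Rightarrow> 'a \<Rightarrow> real" where
  "torsion \<Omega> = (SOME v. is_torsion \<Omega> v)"

definition Lp_norm :: "'a::euclidean_space set \<Rightarrow> real \<Rightarrow> ('a \<Rightarrow> real) \<Rightarrow> real" where
  "Lp_norm \<Omega> p f = (LINT x:\<Omega>|lebesgue. \<bar>f x\<bar> powr p) powr (1 / p)"

definition Fp :: "real \<Rightarrow> 'a::euclidean_space set \<Rightarrow> real" where
  "Fp p \<Omega> = Lp_norm \<Omega> p (torsion \<Omega>) * lambda1 \<Omega> / (measure lebesgue \<Omega>) powr (1 / p)"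

definition frakF :: "'a::euclidean_space itself \<Rightarrow> real \<Rightarrow> ereal" where
  "frakF _ p = (SUP \<Omega>\<in>{\<Omega>::'a set. open \<Omega> \<and> 0 < emeasure lebesgue \<Omega> \<and> emeasure lebesgue \<Omega> < \<infinity>}.
                  ereal (Fp p \<Omega>))"

definition frakF_convex :: "'a::euclidean_space itself \<Rightarrow> real \<Rightarrow> ereal" where
  "frakF_convex _ p = (SUP \<Omega>\<in>{\<Omega>::'a set. open \<Omega> \<and> convex \<Omega> \<and> 0 < emeasure lebesgue \<Omega> \<and>
                                         emeasure lebesgue \<Omega> < \<infinity>}.
                  ereal (Fp p \<Omega>))"

definition p_crit :: "'a::euclidean_space itself \<Rightarrow> ereal" where
  "p_crit T = Inf {ereal p | p. 1 \<le> p \<and> frakF T p > 1}"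

definition p_crit_convex :: "'a::euclidean_space itself \<Rightarrow> ereal" where
  "p_crit_convex T = Inf {ereal p | p. 1 \<le> p \<and> frakF_convex T p > 1}"

end

theory Submission
  imports Defs
begin

text \<open>
  Testing the equation of the torsion function \<open>v\<close> with itself gives
  \<open>\<lambda>\<^sub>1 \<parallel>v\<parallel>\<^sub>2\<^sup>2 \<le> \<parallel>Dv\<parallel>\<^sub>2\<^sup>2 = \<integral>v \<le> |\<Omega>|\<^sup>1\<^sup>/\<^sup>2 \<parallel>v\<parallel>\<^sub>2\<close>, so \<open>F\<^sub>p \<le> F\<^sub>2 \<le> 1\<close> for \<open>p \<le> 2\<close>. On the unit
  ball \<open>v = (1 - |x|\<^sup>2) / 2m\<close> is explicit, \<open>\<lambda>\<^sub>1 \<ge> 14m/5\<close> by a Hardy type weight, and bounding \<open>\<parallel>v\<parallel>\<^sub>p\<close>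
  from below on the ball of radius 1/4 already gives \<open>F\<^sub>8\<^sub>m > 1\<close>.

  That the supremum is at least 1 is a homogenization effect. Remove from a large box small balls of
  radius \<open>r\<close> around the integer points, and let \<open>\<mu>\<close> be the infimum of the Rayleigh quotient per cell
  among nonnegative periodic functions vanishing near the holes. A test function \<open>\<phi>\<close> of the box is
  turned into a periodic competitor by taking \<open>(\<Sum>k. \<phi>(x + k)\<^sup>2)\<^sup>1\<^sup>/\<^sup>2\<close>, so \<open>\<lambda>\<^sub>1 \<ge> \<mu>\<close>. A near minimizer \<open>u\<close>,
  cut off near the boundary of the box, bounds the mean of \<open>v\<close> from below by about
  \<open>(\<integral>u)\<^sup>2 / \<integral>|Du|\<^sup>2\<close>, hence \<open>F\<^sub>p \<ge> F\<^sub>1\<close> is at least about \<open>(\<integral>u)\<^sup>2 / \<integral>u\<^sup>2\<close>. Since points have zero capacity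
  for \<open>m \<ge> 2\<close>, \<open>\<mu> \<rightarrow> 0\<close> as \<open>r \<rightarrow> 0\<close>, and the Poincare inequality on the torus makes this quotient tend to 1.
\<close>

section \<open>Smooth functions\<close>

text \<open>No eigenfunction and no minimizer of the cell problem is ever constructed: on the ball
  an explicit weight takes the place of the ground state, in the cell a near minimizer suffices.
  There \<mu> is never computed. It bounds the first eigenvalue from below and, up to a factor 1 +
  \<epsilon>, the energy of the chosen \<open>u\<close> from above, so it cancels; what matters is 0
  < \<mu> \<le> \<epsilon>. The translates of \<phi> are combined in the l2 sense because a plain
  lattice sum can lose mass by cancellation, while the root of the sum of squares keeps the mass
  and, by Cauchy-Schwarz, gains no energy. The infimum defining the critical exponent carries no
  information at the exponent itself; equality there comes from left continuity in \<open>p\<close>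
  for each fixed domain.\<close>

lemma smooth_fun_differentiable: "smooth_fun f \<Longrightarrow> f differentiable (at x)"
  by (auto elim: smooth_fun.cases)

lemma smooth_fun_partial:
  "smooth_fun f \<Longrightarrow> b \<in> Basis \<Longrightarrow> smooth_fun (\<lambda>x. frechet_derivative f (at x) b)"
  by (auto elim: smooth_fun.cases)

lemma has_derivative_grad:
  assumes "f differentiable (at x)"
  shows "(f has_derivative (\<lambda>h. grad f x \<bullet> h)) (at x)"
proof -
  let ?F = "frechet_derivative f (at x)"
  have F: "(f has_derivative ?F) (at x)" using assms by (simp add: frechet_derivative_works)
  then have lin: "linear ?F" by (rule has_derivative_linear)
  have "?F h = grad f x \<bullet> h" for h
  proof -
    have "?F h = ?F (\<Sum>b\<in>Basis. (h \<bullet> b) *\<^sub>R b)" by (simp add: euclidean_representation)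
    also have "\<dots> = (\<Sum>b\<in>Basis. (h \<bullet> b) *\<^sub>R ?F b)"
      by (simp add: linear_sum[OF lin] linear_scale[OF lin])
    also have "\<dots> = grad f x \<bullet> h"
      by (simp add: grad_def inner_sum_left inner_commute[of h] mult.commute)
    finally show ?thesis .
  qed
  then show ?thesis using F by (metis (no_types, lifting) ext)
qed

lemma grad_eqI:
  assumes "(f has_derivative (\<lambda>h. g \<bullet> h)) (at x)"
  shows "grad f x = g"
proof -
  have "frechet_derivative f (at x) = (\<lambda>h. g \<bullet> h)"
    using frechet_derivative_at[OF assms] by simp
  then show ?thesis by (simp add: grad_def euclidean_representation)
qed

lemma frechet_derivative_eq_grad:
  "f differentiable (at x) \<Longrightarrow> frechet_derivative f (at x) h = grad f x \<bullet> h"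
  by (metis frechet_derivative_at has_derivative_grad)

lemma smooth_fun_grad: "smooth_fun f \<Longrightarrow> (f has_derivative (\<lambda>h. grad f x \<bullet> h)) (at x)"
  by (intro has_derivative_grad smooth_fun_differentiable)

text \<open>Uniqueness of derivatives allows an explicit gradient \<open>g\<close> in place of
  \<open>frechet_derivative\<close>, so an invariant only has to exhibit one.\<close>

lemma smooth_fun_coinductI:
  assumes "X f"
    and step: "\<And>f. X f \<Longrightarrow> \<exists>g. (\<forall>x. (f has_derivative (\<lambda>h. g x \<bullet> h)) (at x)) \<and>
                 (\<forall>b\<in>Basis. X (\<lambda>x. g x \<bullet> b))"
  shows "smooth_fun f"
  using \<open>X f\<close>
proof (coinduction arbitrary: f rule: smooth_fun.coinduct)
  case (smooth_fun f)
  obtain g where g: "\<And>x. (f has_derivative (\<lambda>h. g x \<bullet> h)) (at x)"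
    "\<And>b. b \<in> Basis \<Longrightarrow> X (\<lambda>x. g x \<bullet> b)"
    using step[OF smooth_fun] by blast
  have "frechet_derivative f (at x) = (\<lambda>h. g x \<bullet> h)" for x
    using frechet_derivative_at[OF g(1)] by simp
  then show ?case using g by (auto simp: differentiable_def)
qed

text \<open>Products and compositions are not directly accessible to coinduction, since their partial
  derivatives are sums of such; the inductive closure is stable under partial derivatives.\<close>
inductive smooth_alg :: "('a::euclidean_space \<Rightarrow> real) \<Rightarrow> bool" where
  base: "smooth_fun f \<Longrightarrow> smooth_alg f"
| const: "smooth_alg (\<lambda>x. c)"
| inner: "smooth_alg (\<lambda>x. x \<bullet> a)"
| add: "smooth_alg f \<Longrightarrow> smooth_alg g \<Longrightarrow> smooth_alg (\<lambda>x. f x + g x)"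
| mult: "smooth_alg f \<Longrightarrow> smooth_alg g \<Longrightarrow> smooth_alg (\<lambda>x. f x * g x)"
| inverse: "smooth_alg f \<Longrightarrow> (\<And>x. f x \<noteq> 0) \<Longrightarrow> smooth_alg (\<lambda>x. inverse (f x))"
| sqrt: "smooth_alg f \<Longrightarrow> (\<And>x. f x > 0) \<Longrightarrow> smooth_alg (\<lambda>x. sqrt (f x))"
| compose: "smooth_alg f \<Longrightarrow> smooth_fun (h :: real \<Rightarrow> real) \<Longrightarrow> smooth_alg (\<lambda>x. h (f x))"

lemma smooth_alg_step:
  "smooth_alg f \<Longrightarrow> \<exists>g. (\<forall>x. (f has_derivative (\<lambda>h. g x \<bullet> h)) (at x)) \<and>
                 (\<forall>b\<in>Basis. smooth_alg (\<lambda>x. g x \<bullet> b))"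
proof (induction rule: smooth_alg.induct)
  case (base f)
  have "smooth_alg (\<lambda>x. grad f x \<bullet> b)" if "b \<in> Basis" for b
    using smooth_fun_partial[OF base that]
    by (simp add: frechet_derivative_eq_grad[OF smooth_fun_differentiable[OF base]] smooth_alg.base)
  then show ?case using smooth_fun_grad[OF base] by (intro exI[of _ "grad f"]) auto
next
  case (const c)
  then show ?case by (intro exI[of _ "\<lambda>_. 0"]) (auto intro: smooth_alg.const)
next
  case (inner a)
  show ?case
    by (intro exI[of _ "\<lambda>_. a"])
      (simp add: smooth_alg.const inner_commute[of _ a] bounded_linear_imp_has_derivative bounded_linear_inner_right)
next
  case (add f g)
  then obtain f' g' where *: "\<And>x. (f has_derivative (\<lambda>h. f' x \<bullet> h)) (at x)"
    "\<And>x. (g has_derivative (\<lambda>h. g' x \<bullet> h)) (at x)"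
    "\<And>b. b\<in>Basis \<Longrightarrow> smooth_alg (\<lambda>x. f' x \<bullet> b)" "\<And>b. b\<in>Basis \<Longrightarrow> smooth_alg (\<lambda>x. g' x \<bullet> b)" by metis
  show ?case
    by (intro exI[of _ "\<lambda>x. f' x + g' x"])
       (simp add: inner_add_left smooth_alg.add * has_derivative_add)
next
  case (mult f g)
  then obtain f' g' where *: "\<And>x. (f has_derivative (\<lambda>h. f' x \<bullet> h)) (at x)"
    "\<And>x. (g has_derivative (\<lambda>h. g' x \<bullet> h)) (at x)"
    "\<And>b. b\<in>Basis \<Longrightarrow> smooth_alg (\<lambda>x. f' x \<bullet> b)" "\<And>b. b\<in>Basis \<Longrightarrow> smooth_alg (\<lambda>x. g' x \<bullet> b)" by metis
  show ?case
  proof (intro exI[of _ "\<lambda>x. f x *\<^sub>R g' x + g x *\<^sub>R f' x"] conjI allI ballI)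
    fix x
    show "((\<lambda>x. f x * g x) has_derivative (\<lambda>h. (f x *\<^sub>R g' x + g x *\<^sub>R f' x) \<bullet> h)) (at x)"
      by (rule has_derivative_eq_rhs[OF has_derivative_mult[OF *(1) *(2)]])
         (auto simp: inner_add_left)
  next
    fix b :: 'a assume "b \<in> Basis"
    then show "smooth_alg (\<lambda>x. (f x *\<^sub>R g' x + g x *\<^sub>R f' x) \<bullet> b)"
      using * mult.hyps by (auto simp: inner_add_left intro!: smooth_alg.add smooth_alg.mult)
  qed
next
  case (inverse f)
  then obtain f' where *: "\<And>x. (f has_derivative (\<lambda>h. f' x \<bullet> h)) (at x)"
    "\<And>b. b\<in>Basis \<Longrightarrow> smooth_alg (\<lambda>x. f' x \<bullet> b)" by metis
  show ?case
  proof (intro exI[of _ "\<lambda>x. ((-1) * (inverse (f x) * inverse (f x))) *\<^sub>R f' x"] conjI allI ballI)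
    fix x
    show "((\<lambda>x. inverse (f x)) has_derivative
        (\<lambda>h. ((-1) * (inverse (f x) * inverse (f x))) *\<^sub>R f' x \<bullet> h)) (at x)"
      by (rule has_derivative_eq_rhs[OF Deriv.has_derivative_inverse[OF inverse.hyps(2) *(1)]])
         (auto simp: fun_eq_iff)
  next
    fix b :: 'a assume "b \<in> Basis"
    then show "smooth_alg (\<lambda>x. ((-1) * (inverse (f x) * inverse (f x))) *\<^sub>R f' x \<bullet> b)"
      using * inverse.hyps unfolding inner_scaleR_left
      by (intro smooth_alg.mult smooth_alg.const smooth_alg.inverse) auto
  qed
next
  \<comment> \<open>The derivative brings in the inverse of the root, which is why the closure
    contains both operations.\<close>
  case (sqrt f)
  then obtain f' where *: "\<And>x. (f has_derivative (\<lambda>h. f' x \<bullet> h)) (at x)"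
    "\<And>b. b\<in>Basis \<Longrightarrow> smooth_alg (\<lambda>x. f' x \<bullet> b)" by metis
  show ?case
  proof (intro exI[of _ "\<lambda>x. ((1/2) * inverse (sqrt (f x))) *\<^sub>R f' x"] conjI allI ballI)
    fix x
    show "((\<lambda>x. sqrt (f x)) has_derivative
        (\<lambda>h. ((1/2) * inverse (sqrt (f x))) *\<^sub>R f' x \<bullet> h)) (at x)"
      by (rule has_derivative_eq_rhs[OF has_derivative_real_sqrt[OF sqrt.hyps(2) *(1)]])
         (auto simp: fun_eq_iff field_simps)
  next
    fix b :: 'a assume "b \<in> Basis"
    moreover have "sqrt (f x) \<noteq> 0" for x using sqrt.hyps(2)[of x] by simp
    ultimately show "smooth_alg (\<lambda>x. ((1/2) * inverse (sqrt (f x))) *\<^sub>R f' x \<bullet> b)"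
      using * sqrt.hyps unfolding inner_scaleR_left
      by (intro smooth_alg.mult smooth_alg.const smooth_alg.inverse smooth_alg.sqrt) auto
  qed
next
  case (compose f h)
  then obtain f' where *: "\<And>x. (f has_derivative (\<lambda>h. f' x \<bullet> h)) (at x)"
    "\<And>b. b\<in>Basis \<Longrightarrow> smooth_alg (\<lambda>x. f' x \<bullet> b)" by metis
  show ?case
  proof (intro exI[of _ "\<lambda>x. (frechet_derivative h (at (f x)) 1) *\<^sub>R f' x"] conjI allI ballI)
    fix x
    have "(h has_derivative (\<lambda>y. frechet_derivative h (at (f x)) 1 * y)) (at (f x))"
      using smooth_fun_grad[OF compose.hyps(2), of "f x"]
        frechet_derivative_eq_grad[OF smooth_fun_differentiable[OF compose.hyps(2)], of "f x" 1] by simp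
    from diff_chain_at[OF *(1) this]
    show "((\<lambda>x. h (f x)) has_derivative
        (\<lambda>y. (frechet_derivative h (at (f x)) 1) *\<^sub>R f' x \<bullet> y)) (at x)"
      by (simp add: o_def)
  next
    fix b :: 'a assume "b \<in> Basis"
    then show "smooth_alg (\<lambda>x. (frechet_derivative h (at (f x)) 1) *\<^sub>R f' x \<bullet> b)"
      using * smooth_fun_partial[OF compose.hyps(2), of 1] compose.hyps(1) unfolding inner_scaleR_left
      by (intro smooth_alg.mult) (auto intro: smooth_alg.compose)
  qed
qed

lemma smooth_alg_imp_smooth_fun: "smooth_alg f \<Longrightarrow> smooth_fun f"
  by (rule smooth_fun_coinductI[of smooth_alg]) (auto dest: smooth_alg_step)

named_theorems smooth_intros

lemma smooth_const [smooth_intros]: "smooth_fun (\<lambda>x. c)"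
  by (rule smooth_alg_imp_smooth_fun, rule smooth_alg.const)

lemma smooth_inner [smooth_intros]: "smooth_fun (\<lambda>x. x \<bullet> a)"
  by (rule smooth_alg_imp_smooth_fun, rule smooth_alg.inner)

lemma smooth_add [smooth_intros]: "smooth_fun f \<Longrightarrow> smooth_fun g \<Longrightarrow> smooth_fun (\<lambda>x. f x + g x)"
  by (rule smooth_alg_imp_smooth_fun, rule smooth_alg.add) (simp_all add: smooth_alg.base)

lemma smooth_mult [smooth_intros]: "smooth_fun f \<Longrightarrow> smooth_fun g \<Longrightarrow> smooth_fun (\<lambda>x. f x * g x)"
  by (rule smooth_alg_imp_smooth_fun, rule smooth_alg.mult) (simp_all add: smooth_alg.base)

lemma smooth_diff [smooth_intros]:
  assumes "smooth_fun f" "smooth_fun g"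
  shows "smooth_fun (\<lambda>x. f x - g x)"
proof -
  have "smooth_fun (\<lambda>x. f x + (-1) * g x)"
    by (intro smooth_intros assms)
  then show ?thesis by simp
qed

lemma smooth_divide_const [smooth_intros]:
  assumes "smooth_fun f"
  shows "smooth_fun (\<lambda>x. f x / c)"
  unfolding divide_inverse by (intro smooth_intros assms)

lemma smooth_inverse: "smooth_fun f \<Longrightarrow> (\<And>x. f x \<noteq> 0) \<Longrightarrow> smooth_fun (\<lambda>x. inverse (f x))"
  by (rule smooth_alg_imp_smooth_fun, rule smooth_alg.inverse) (simp_all add: smooth_alg.base)

lemma smooth_sqrt: "smooth_fun f \<Longrightarrow> (\<And>x. f x > 0) \<Longrightarrow> smooth_fun (\<lambda>x. sqrt (f x))"
  by (rule smooth_alg_imp_smooth_fun, rule smooth_alg.sqrt) (simp_all add: smooth_alg.base)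

lemma smooth_compose: "smooth_fun (h :: real \<Rightarrow> real) \<Longrightarrow> smooth_fun f \<Longrightarrow> smooth_fun (\<lambda>x. h (f x))"
  by (rule smooth_alg_imp_smooth_fun, rule smooth_alg.compose) (simp_all add: smooth_alg.base)

lemma smooth_power2 [smooth_intros]: "smooth_fun f \<Longrightarrow> smooth_fun (\<lambda>x. (f x)\<^sup>2)"
  unfolding power2_eq_square by (intro smooth_intros)

lemma smooth_sum [smooth_intros]:
  "(\<And>i. i \<in> I \<Longrightarrow> smooth_fun (f i)) \<Longrightarrow> smooth_fun (\<lambda>x. \<Sum>i\<in>I. f i x)"
  by (induction I rule: infinite_finite_induct) (auto intro!: smooth_intros)

lemma smooth_prod [smooth_intros]:
  "(\<And>i. i \<in> I \<Longrightarrow> smooth_fun (f i)) \<Longrightarrow> smooth_fun (\<lambda>x. \<Prod>i\<in>I. f i x)"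
  by (induction I rule: infinite_finite_induct) (auto intro!: smooth_intros)

lemma smooth_norm2 [smooth_intros]: "smooth_fun (\<lambda>x. (norm x)\<^sup>2)"
proof -
  have "smooth_fun (\<lambda>x::'a. \<Sum>b\<in>Basis. (x \<bullet> b)\<^sup>2)" by (intro smooth_intros)
  then show ?thesis by (simp add: norm_eq_sqrt_inner euclidean_inner[of x x for x] power2_eq_square sum_nonneg)
qed

lemma smooth_id_real [smooth_intros]: "smooth_fun (\<lambda>x::real. x)"
  using smooth_inner[of "1::real"] by simp

lemma smooth_affine:
  fixes f :: "'a::euclidean_space \<Rightarrow> real"
  assumes "smooth_fun f"
  shows "smooth_fun (\<lambda>x. f (c *\<^sub>R x + a))"
proof -
  \<comment> \<open>The factor \<open>d\<close> collects the powers of \<open>c\<close> that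
    successive derivatives pull out.\<close>
  let ?X = "\<lambda>h. \<exists>f d. smooth_fun f \<and> h = (\<lambda>x. d * f (c *\<^sub>R x + a))"
  show ?thesis
  proof (rule smooth_fun_coinductI[of ?X])
    show "?X (\<lambda>x. f (c *\<^sub>R x + a))" using assms by (intro exI[of _ f] exI[of _ 1]) auto
  next
    fix h assume "?X h"
    then obtain f d where f: "smooth_fun f" "h = (\<lambda>x. d * f (c *\<^sub>R x + a))" by blast
    have "(h has_derivative (\<lambda>y. ((d * c) *\<^sub>R grad f (c *\<^sub>R x + a)) \<bullet> y)) (at x)" for x
    proof -
      have "((\<lambda>x. c *\<^sub>R x + a) has_derivative (\<lambda>y. c *\<^sub>R y)) (at x)"
        by (auto intro!: derivative_eq_intros)
      from diff_chain_at[OF this smooth_fun_grad[OF f(1)]]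
      have "((\<lambda>x. f (c *\<^sub>R x + a)) has_derivative (\<lambda>y. c * (grad f (c *\<^sub>R x + a) \<bullet> y))) (at x)"
        by (simp add: o_def)
      from has_derivative_mult_right[OF this, of d]
      show ?thesis by (simp add: f(2) mult.assoc)
    qed
    moreover have "?X (\<lambda>x. ((d * c) *\<^sub>R grad f (c *\<^sub>R x + a)) \<bullet> b)" if "b \<in> Basis" for b
      using smooth_fun_partial[OF f(1) that]
      by (intro exI[of _ "\<lambda>x. grad f x \<bullet> b"] exI[of _ "d * c"])
        (simp add: frechet_derivative_eq_grad[OF smooth_fun_differentiable[OF f(1)]])
    ultimately show "\<exists>g. (\<forall>x. (h has_derivative (\<lambda>y. g x \<bullet> y)) (at x)) \<and>
                 (\<forall>b\<in>Basis. ?X (\<lambda>x. g x \<bullet> b))" by (intro exI[of _ "\<lambda>x. (d * c) *\<^sub>R grad f (c *\<^sub>R x + a)"] conjI allI ballI)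
  qed
qed

lemma smooth_translate: "smooth_fun f \<Longrightarrow> smooth_fun (\<lambda>x. f (x + a))"
  using smooth_affine[of f 1 a] by simp

lemma smooth_scale: "smooth_fun f \<Longrightarrow> smooth_fun (\<lambda>x. f (c *\<^sub>R x))"
  using smooth_affine[of f c 0] by simp

text \<open>Local agreement with smooth functions is itself inherited by partial derivatives. This
  serves functions glued by cases and lattice sums, which coincide with a fixed finite sum only
  locally.\<close>

lemma smooth_local:
  assumes "\<And>x. \<exists>U g. open U \<and> x \<in> U \<and> smooth_fun g \<and> (\<forall>y\<in>U. f y = g y)"
  shows "smooth_fun f"
proof -
  let ?X = "\<lambda>f. \<forall>x. \<exists>U g. open U \<and> x \<in> U \<and> smooth_fun g \<and> (\<forall>y\<in>U. f y = g y)"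
  show ?thesis
  proof (rule smooth_fun_coinductI[of ?X])
    show "?X f" using assms by blast
  next
    fix f :: "'a \<Rightarrow> real" assume X: "?X f"
    have loc: "(f has_derivative (\<lambda>h. grad g x \<bullet> h)) (at x)"
      if "open U" "x \<in> U" "smooth_fun g" "\<forall>y\<in>U. f y = g y" for x U g
      using has_derivative_transform_within_open[OF smooth_fun_grad[OF that(3)] that(1,2)] that(4) by simp
    then have der: "(f has_derivative (\<lambda>h. grad f x \<bullet> h)) (at x)" for x
      using X by (metis grad_eqI)
    have "?X (\<lambda>x. grad f x \<bullet> b)" if b: "b \<in> Basis" for b
    proof
      fix x
      obtain U g where U: "open U" "x \<in> U" "smooth_fun g" "\<forall>y\<in>U. f y = g y" using X by blast
      have "grad f y = grad g y" if "y \<in> U" for y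
        using loc[OF U(1) that U(3,4)] by (rule grad_eqI)
      moreover have "smooth_fun (\<lambda>x. grad g x \<bullet> b)"
        using smooth_fun_partial[OF U(3) b]
        by (simp add: frechet_derivative_eq_grad[OF smooth_fun_differentiable[OF U(3)]])
      ultimately show "\<exists>U g. open U \<and> x \<in> U \<and> smooth_fun g \<and> (\<forall>y\<in>U. grad f y \<bullet> b = g y)"
        using U by (intro exI[of _ U] exI[of _ "\<lambda>x. grad g x \<bullet> b"]) auto
    qed
    then show "\<exists>g. (\<forall>x. (f has_derivative (\<lambda>y. g x \<bullet> y)) (at x)) \<and>
                 (\<forall>b\<in>Basis. ?X (\<lambda>x. g x \<bullet> b))"
      using der by blast
  qed
qed

section \<open>Continuity and the calculus of gradients\<close>

lemma smooth_fun_continuous: "smooth_fun f \<Longrightarrow> continuous_on A f"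
  by (meson continuous_at_imp_continuous_on differentiable_imp_continuous_within smooth_fun_differentiable)

lemma smooth_fun_grad_inner:
  assumes "smooth_fun f" "b \<in> Basis"
  shows "smooth_fun (\<lambda>x. grad f x \<bullet> b)"
  using smooth_fun_partial[OF assms]
  by (simp add: frechet_derivative_eq_grad[OF smooth_fun_differentiable[OF assms(1)]])

lemma continuous_grad: "smooth_fun f \<Longrightarrow> continuous_on A (grad f)"
  unfolding continuous_on_componentwise[of A "grad f"]
  by (auto intro!: smooth_fun_continuous smooth_fun_grad_inner)

lemma grad_const [simp]: "grad (\<lambda>x. c) x = 0"
  by (rule grad_eqI) simp

lemma grad_add:
  "f differentiable (at x) \<Longrightarrow> g differentiable (at x) \<Longrightarrow>
    grad (\<lambda>x. f x + g x) x = grad f x + grad g x"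
  by (rule grad_eqI)
    (auto simp: inner_add_left intro!: has_derivative_add has_derivative_grad)

lemma grad_diff:
  "f differentiable (at x) \<Longrightarrow> g differentiable (at x) \<Longrightarrow>
    grad (\<lambda>x. f x - g x) x = grad f x - grad g x"
  by (rule grad_eqI)
    (auto simp: inner_diff_left intro!: has_derivative_diff has_derivative_grad)

lemma grad_cmult:
  assumes "f differentiable (at x)"
  shows "grad (\<lambda>x. c * f x) x = c *\<^sub>R grad f x"
  using has_derivative_mult_right[OF has_derivative_grad[OF assms], of c]
  by (intro grad_eqI) simp

lemma grad_mult:
  assumes "f differentiable (at x)" "g differentiable (at x)"
  shows "grad (\<lambda>x. f x * g x) x = f x *\<^sub>R grad g x + g x *\<^sub>R grad f x"
  by (rule grad_eqI, rule has_derivative_eq_rhs[OF has_derivative_mult[OF assms[THEN has_derivative_grad]]])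
    (auto simp: inner_add_left)

lemma grad_sum:
  assumes "finite I" "\<And>i. i \<in> I \<Longrightarrow> f i differentiable (at x)"
  shows "grad (\<lambda>x. \<Sum>i\<in>I. f i x) x = (\<Sum>i\<in>I. grad (f i) x)"
  by (rule grad_eqI)
    (auto simp: inner_sum_left intro!: has_derivative_sum has_derivative_grad assms)

lemma grad_compose:
  assumes "f differentiable (at x)" "(h has_field_derivative d) (at (f x))"
  shows "grad (\<lambda>x. h (f x)) x = d *\<^sub>R grad f x"
  using diff_chain_at[OF has_derivative_grad[OF assms(1)] assms(2)[unfolded has_field_derivative_def]]
  by (intro grad_eqI) (simp add: o_def)

lemma grad_affine:
  assumes "f differentiable (at (c *\<^sub>R x + a))"
  shows "grad (\<lambda>x. f (c *\<^sub>R x + a)) x = c *\<^sub>R grad f (c *\<^sub>R x + a)"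
proof -
  have "((\<lambda>x. c *\<^sub>R x + a) has_derivative (\<lambda>y. c *\<^sub>R y)) (at x)"
    by (auto intro!: derivative_eq_intros)
  from diff_chain_at[OF this has_derivative_grad[OF assms]]
  show ?thesis by (intro grad_eqI) (simp add: o_def)
qed

lemma grad_translate: "smooth_fun f \<Longrightarrow> grad (\<lambda>x. f (x + a)) x = grad f (x + a)"
  using grad_affine[of f 1 x a] by (simp add: smooth_fun_differentiable)

lemma grad_scale: "smooth_fun f \<Longrightarrow> grad (\<lambda>x. f (c *\<^sub>R x)) x = c *\<^sub>R grad f (c *\<^sub>R x)"
  using grad_affine[of f c x 0] by (simp add: smooth_fun_differentiable)

lemma grad_inner: "grad (\<lambda>x. x \<bullet> a) x = a"
  by (rule grad_eqI) (auto intro!: derivative_eq_intros simp: inner_commute)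

lemma grad_norm2: "grad (\<lambda>x. (norm x)\<^sup>2) x = 2 *\<^sub>R x"
proof (rule grad_eqI)
  have "((\<lambda>x. x \<bullet> x) has_derivative (\<lambda>h. (2 *\<^sub>R x) \<bullet> h)) (at x)"
    by (auto intro!: derivative_eq_intros simp: inner_commute)
  then show "((\<lambda>x. (norm x)\<^sup>2) has_derivative (\<lambda>h. (2 *\<^sub>R x) \<bullet> h)) (at x)"
    by (simp add: power2_norm_eq_inner)
qed

lemma grad_eq_on_open:
  assumes "open U" "x \<in> U" "\<And>y. y \<in> U \<Longrightarrow> f y = g y" "g differentiable (at x)"
  shows "grad f x = grad g x"
  by (rule grad_eqI, rule has_derivative_transform_within_open[OF has_derivative_grad[OF assms(4)] assms(1,2)])
     (simp add: assms(3))

section \<open>The flat exponential and its descendants\<close>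

text \<open>One function serves as cutoff near a boundary, as truncation, and as smooth substitute
  for the positive part: it vanishes exactly on t \<le> 0, stays below 1 and is 1-Lipschitz.\<close>

definition flat_exp :: "real \<Rightarrow> real" where
  "flat_exp t = (if t > 0 then exp (- 1 / t) else 0)"

text \<open>The family in which all derivatives of \<open>flat_exp\<close> live; it is closed under
  differentiation, which is the invariant needed for coinduction.\<close>

definition flat_exp_poly :: "real poly \<Rightarrow> real \<Rightarrow> real" where
  "flat_exp_poly p t = (if t > 0 then poly p (1 / t) * exp (- 1 / t) else 0)"

lemma poly_times_exp_neg_tendsto_0: "((\<lambda>y::real. poly p y * exp (- y)) \<longlongrightarrow> 0) at_top"
proof -
  have "((\<lambda>y::real. \<Sum>i\<le>degree p. coeff p i * (y ^ i / exp y)) \<longlongrightarrow> (\<Sum>i\<le>degree p. coeff p i * 0)) at_top"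
    by (intro tendsto_sum tendsto_mult tendsto_const tendsto_power_div_exp_0)
  then show ?thesis by (simp add: poly_altdef sum_divide_distrib sum_distrib_right exp_minus field_simps)
qed

text \<open>In y = 1/t, differentiation turns \<open>p\<close> into y^2 times
  \<open>p - pderiv p\<close>, and \<open>[:0, 0, 1:]\<close> is y^2. Only t = 0 needs a limit: the
  difference quotient is a polynomial in y times exp(-y) on the right and 0 on the left.\<close>

lemma flat_exp_poly_deriv:
  "(flat_exp_poly p has_field_derivative flat_exp_poly ([:0, 0, 1:] * (p - pderiv p)) t) (at t)"
proof -
  consider "t > 0" | "t < 0" | "t = 0" by linarith
  then show ?thesis
  proof cases
    case 1
    have "((\<lambda>t. poly p (1 / t) * exp (- 1 / t)) has_field_derivative
        flat_exp_poly ([:0, 0, 1:] * (p - pderiv p)) t) (at t)"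
      using 1 by (auto intro!: derivative_eq_intros DERIV_chain2[of "poly p"] poly_DERIV
          simp: flat_exp_poly_def field_simps power2_eq_square)
    then show ?thesis
      by (rule has_field_derivative_transform_within_open[of _ _ _ "{0<..}"]) (use 1 in \<open>auto simp: flat_exp_poly_def\<close>)
  next
    case 2
    have "((\<lambda>t. 0) has_field_derivative flat_exp_poly ([:0, 0, 1:] * (p - pderiv p)) t) (at t)"
      using 2 by (simp add: flat_exp_poly_def)
    then show ?thesis
      by (rule has_field_derivative_transform_within_open[of _ _ _ "{..<0}"]) (use 2 in \<open>auto simp: flat_exp_poly_def\<close>)
  next
    case 3
    have R: "((\<lambda>t. flat_exp_poly p t / t) \<longlongrightarrow> 0) (at_right 0)"
    proof -
      have "((\<lambda>t::real. poly ([:0,1:] * p) (1 / t) * exp (- (1 / t))) \<longlongrightarrow> 0) (at_right 0)"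
        by (rule filterlim_compose[OF poly_times_exp_neg_tendsto_0])
          (simp add: divide_inverse filterlim_inverse_at_top_right)
      then show ?thesis
      proof (rule Lim_transform_eventually)
        show "\<forall>\<^sub>F t in at_right 0. poly ([:0,1:] * p) (1 / t) * exp (- (1 / t)) = flat_exp_poly p t / t"
          unfolding eventually_at_filter by (auto simp: flat_exp_poly_def)
      qed
    qed
    have L: "((\<lambda>t. flat_exp_poly p t / t) \<longlongrightarrow> 0) (at_left 0)"
      by (rule Lim_transform_eventually[OF tendsto_const])
        (auto simp: eventually_at_filter flat_exp_poly_def)
    show ?thesis using R L filterlim_at_split[of "\<lambda>t. flat_exp_poly p t / t" "nhds 0" 0] 3
      by (simp add: has_field_derivative_iff flat_exp_poly_def)
  qed
qed

lemma smooth_flat_exp_poly: "smooth_fun (flat_exp_poly p)"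
proof (rule smooth_fun_coinductI[of "\<lambda>f. \<exists>p. f = flat_exp_poly p"])
  fix f assume "\<exists>p. f = flat_exp_poly p"
  then obtain p where f: "f = flat_exp_poly p" by blast
  show "\<exists>g. (\<forall>x. (f has_derivative (\<lambda>h. g x \<bullet> h)) (at x)) \<and>
                 (\<forall>b\<in>Basis. \<exists>p. (\<lambda>x. g x \<bullet> b) = flat_exp_poly p)"
    using flat_exp_poly_deriv[of p]
    by (intro exI[of _ "flat_exp_poly ([:0, 0, 1:] * (p - pderiv p))"])
       (auto simp: f has_field_derivative_def fun_eq_iff)
qed blast

lemma flat_exp_eq: "flat_exp = flat_exp_poly 1"
  by (auto simp: flat_exp_def flat_exp_poly_def)

lemma smooth_flat_exp: "smooth_fun flat_exp"
  by (simp add: flat_exp_eq smooth_flat_exp_poly)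

definition flat_exp' :: "real \<Rightarrow> real" where
  "flat_exp' t = (if t > 0 then exp (- 1 / t) / t\<^sup>2 else 0)"

lemma flat_exp_deriv: "(flat_exp has_field_derivative flat_exp' t) (at t)"
  using flat_exp_poly_deriv[of 1 t] unfolding flat_exp_eq
  by (simp add: flat_exp_poly_def flat_exp'_def power2_eq_square field_simps split: if_splits)

lemma flat_exp_nonneg [simp]: "0 \<le> flat_exp t" and flat_exp_le_1: "flat_exp t \<le> 1"
  and flat_exp_eq_0_iff [simp]: "flat_exp t = 0 \<longleftrightarrow> t \<le> 0"
  by (auto simp: flat_exp_def)

lemma flat_exp'_nonneg [simp]: "0 \<le> flat_exp' t"
  by (auto simp: flat_exp'_def)

lemma exp_ge_quadratic: "0 \<le> y \<Longrightarrow> 1 + y + y\<^sup>2 / 2 \<le> exp (y::real)"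
  using exp_lower_Taylor_quadratic[of y] by simp

text \<open>The bound amounts to \<open>1 / t\<^sup>2 \<le> exp (1 / t)\<close>, the square of
  \<open>2 * y \<le> exp y\<close> at \<open>y = 1 / (2 * t)\<close>. It makes
  \<open>flat_exp\<close> 1-Lipschitz and gives
  \<open>(flat_exp' t)\<^sup>2 \<le> flat_exp' t\<close>, the form used in the comparison
  principle.\<close>

lemma flat_exp'_le_1: "flat_exp' t \<le> 1"
proof (cases "t > 0")
  case True
  define y where "y = 1 / (2 * t)"
  have y: "y > 0" using True by (simp add: y_def)
  have "1 + y + y\<^sup>2 / 2 - 2 * y = ((y - 1)\<^sup>2 + 1) / 2" by (simp add: power2_eq_square field_simps)
  then have "2 * y \<le> 1 + y + y\<^sup>2 / 2" by (smt (verit) zero_le_power2 divide_nonneg_pos)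
  then have "2 * y \<le> exp y" using exp_ge_quadratic[of y] y by linarith
  then have "(2 * y)\<^sup>2 \<le> (exp y)\<^sup>2" using y by (intro power_mono) auto
  also have "(exp y)\<^sup>2 = exp (1 / t)" by (simp add: y_def flip: exp_double)
  also have "(2 * y)\<^sup>2 = 1 / t\<^sup>2" using True by (simp add: y_def power2_eq_square)
  finally show ?thesis using True by (simp add: flat_exp'_def exp_minus field_simps)
qed (simp add: flat_exp'_def)

section \<open>Square-integrable functions\<close>

definition L2 :: "'x measure \<Rightarrow> ('x \<Rightarrow> 'b::euclidean_space) \<Rightarrow> bool" where
  "L2 M f \<longleftrightarrow> f \<in> borel_measurable M \<and> integrable M (\<lambda>x. (norm (f x))\<^sup>2)"

lemma L2_measurable: "L2 M f \<Longrightarrow> f \<in> borel_measurable M"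
  and L2_integrable: "L2 M f \<Longrightarrow> integrable M (\<lambda>x. (norm (f x))\<^sup>2)"
  by (auto simp: L2_def)

lemma L2_integrable_real:
  fixes f :: "'x \<Rightarrow> real"
  shows "L2 M f \<Longrightarrow> integrable M (\<lambda>x. (f x)\<^sup>2)"
  using L2_integrable[of M f] by simp

lemma abs_inner_le_half_squares: "\<bar>a \<bullet> b\<bar> \<le> ((norm a)\<^sup>2 + (norm b)\<^sup>2) / 2"
  using Cauchy_Schwarz_ineq2[of a b] sum_squares_bound[of "norm a" "norm b"] by (simp add: field_simps)

lemma norm_add_square_le: "(norm (a + b))\<^sup>2 \<le> 2 * (norm a)\<^sup>2 + 2 * (norm b)\<^sup>2"
  using power_mono[OF norm_triangle_ineq[of a b], of 2] sum_squares_bound[of "norm a" "norm b"]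
  by (simp add: power2_sum)

lemma L2_inner:
  assumes "L2 M f" "L2 M g"
  shows "integrable M (\<lambda>x. f x \<bullet> g x)"
proof (rule Bochner_Integration.integrable_bound)
  show "integrable M (\<lambda>x. ((norm (f x))\<^sup>2 + (norm (g x))\<^sup>2) / 2)"
    using assms by (auto simp: L2_def)
  show "(\<lambda>x. f x \<bullet> g x) \<in> borel_measurable M"
    using assms by (auto simp: L2_def)
  show "AE x in M. norm (f x \<bullet> g x) \<le> norm (((norm (f x))\<^sup>2 + (norm (g x))\<^sup>2) / 2)"
    using abs_inner_le_half_squares[of "f x" "g x" for x] by auto
qed

lemma L2_scaleR: "L2 M f \<Longrightarrow> L2 M (\<lambda>x. c *\<^sub>R f x)"
  by (auto simp: L2_def power_mult_distrib)

lemma L2_add: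
  assumes "L2 M f" "L2 M g"
  shows "L2 M (\<lambda>x. f x + g x)"
  unfolding L2_def
proof
  show "(\<lambda>x. f x + g x) \<in> borel_measurable M" using assms by (auto simp: L2_def)
  show "integrable M (\<lambda>x. (norm (f x + g x))\<^sup>2)"
  proof (rule Bochner_Integration.integrable_bound)
    show "integrable M (\<lambda>x. 2 * (norm (f x))\<^sup>2 + 2 * (norm (g x))\<^sup>2)"
      using assms by (auto simp: L2_def)
    show "(\<lambda>x. (norm (f x + g x))\<^sup>2) \<in> borel_measurable M"
      using assms by (auto simp: L2_def)
    show "AE x in M. norm ((norm (f x + g x))\<^sup>2) \<le> norm (2 * (norm (f x))\<^sup>2 + 2 * (norm (g x))\<^sup>2)"
      using norm_add_square_le[of "f x" "g x" for x] by auto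
  qed
qed

lemma L2_diff: "L2 M f \<Longrightarrow> L2 M g \<Longrightarrow> L2 M (\<lambda>x. f x - g x)"
  using L2_add[of M f "\<lambda>x. (-1) *\<^sub>R g x"] L2_scaleR[of M g "-1"] by simp

lemma L2_expand:
  assumes "L2 M f" "L2 M g"
  shows "(\<integral>x. (norm (f x + t *\<^sub>R g x))\<^sup>2 \<partial>M) =
    (\<integral>x. (norm (f x))\<^sup>2 \<partial>M) + 2 * t * (\<integral>x. f x \<bullet> g x \<partial>M) + t\<^sup>2 * (\<integral>x. (norm (g x))\<^sup>2 \<partial>M)"
proof -
  have "(norm (f x + t *\<^sub>R g x))\<^sup>2 = (norm (f x))\<^sup>2 + (2 * t) * (f x \<bullet> g x) + t\<^sup>2 * (norm (g x))\<^sup>2" for x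
    unfolding power2_norm_eq_inner by (simp add: inner_simps inner_commute power2_eq_square algebra_simps)
  then show ?thesis
    using assms L2_inner[OF assms] by (simp add: L2_def)
qed

text \<open>Serves Cauchy-Schwarz, and with \<open>A = 0\<close> it yields the Euler equation of the
  torsion minimizer.\<close>

lemma quadratic_nonneg_discriminant:
  fixes A B C :: real
  assumes "\<And>t. 0 \<le> A + 2 * t * B + t\<^sup>2 * C" "0 \<le> C"
  shows "B\<^sup>2 \<le> A * C"
proof (cases "C = 0")
  case True
  have "B = 0"
  proof (rule ccontr)
    assume "B \<noteq> 0"
    then show False using assms(1)[of "- (A + 1) / (2 * B)"] True by (simp add: field_simps)
  qed
  then show ?thesis using True by simp
next
  case False
  then have "C > 0" using assms by simp
  have "A + 2 * (- B / C) * B + (- B / C)\<^sup>2 * C = A - B\<^sup>2 / C"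
    using False by (simp add: power2_eq_square field_simps)
  then have "0 \<le> A - B\<^sup>2 / C" using assms(1)[of "- B / C"] by simp
  then show ?thesis using \<open>C > 0\<close> by (simp add: field_simps)
qed

lemma L2_Cauchy_Schwarz:
  assumes "L2 M f" "L2 M g"
  shows "(\<integral>x. f x \<bullet> g x \<partial>M)\<^sup>2 \<le> (\<integral>x. (norm (f x))\<^sup>2 \<partial>M) * (\<integral>x. (norm (g x))\<^sup>2 \<partial>M)"
proof (rule quadratic_nonneg_discriminant)
  fix t
  show "0 \<le> (\<integral>x. (norm (f x))\<^sup>2 \<partial>M) + 2 * t * (\<integral>x. f x \<bullet> g x \<partial>M) + t\<^sup>2 * (\<integral>x. (norm (g x))\<^sup>2 \<partial>M)"
    unfolding L2_expand[OF assms, symmetric] by simp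
qed simp

lemma L2_Cauchy_Schwarz_abs:
  assumes "L2 M f" "L2 M g"
  shows "\<bar>\<integral>x. f x \<bullet> g x \<partial>M\<bar> \<le> sqrt (\<integral>x. (norm (f x))\<^sup>2 \<partial>M) * sqrt (\<integral>x. (norm (g x))\<^sup>2 \<partial>M)"
  using L2_Cauchy_Schwarz[OF assms] by (metis real_le_rsqrt real_sqrt_abs real_sqrt_le_iff real_sqrt_mult)

lemma L2_norm_diff:
  assumes "L2 M f" "L2 M g"
  shows "(\<integral>x. (norm (f x - g x))\<^sup>2 \<partial>M) =
    (\<integral>x. (norm (f x))\<^sup>2 \<partial>M) - 2 * (\<integral>x. f x \<bullet> g x \<partial>M) + (\<integral>x. (norm (g x))\<^sup>2 \<partial>M)"
  using L2_expand[OF assms, of "-1"] by simp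

lemma L2_dist_triangle:
  assumes "L2 M f" "L2 M g" "L2 M h"
  shows "(\<integral>x. (norm (f x - h x))\<^sup>2 \<partial>M) \<le>
    2 * (\<integral>x. (norm (f x - g x))\<^sup>2 \<partial>M) + 2 * (\<integral>x. (norm (g x - h x))\<^sup>2 \<partial>M)"
proof -
  have L: "L2 M (\<lambda>x. f x - h x)" "L2 M (\<lambda>x. f x - g x)" "L2 M (\<lambda>x. g x - h x)"
    by (intro L2_diff assms)+
  have "(\<integral>x. (norm (f x - h x))\<^sup>2 \<partial>M) \<le>
    (\<integral>x. 2 * (norm (f x - g x))\<^sup>2 + 2 * (norm (g x - h x))\<^sup>2 \<partial>M)"
    using L norm_add_square_le[of "f x - g x" "g x - h x" for x]
    by (intro integral_mono) (auto simp: L2_def)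
  then show ?thesis using L by (simp add: L2_def)
qed

lemma L2_inner_tendsto:
  assumes L: "\<And>n. L2 M (f n)" "L2 M f0" "\<And>n. L2 M (g n)" "L2 M g0"
    and f: "(\<lambda>n. \<integral>x. (norm (f n x - f0 x))\<^sup>2 \<partial>M) \<longlonglongrightarrow> 0"
    and g: "(\<lambda>n. \<integral>x. (norm (g n x - g0 x))\<^sup>2 \<partial>M) \<longlonglongrightarrow> 0"
  shows "(\<lambda>n. \<integral>x. f n x \<bullet> g n x \<partial>M) \<longlonglongrightarrow> (\<integral>x. f0 x \<bullet> g0 x \<partial>M)"
proof -
  let ?F = "\<lambda>n. sqrt (\<integral>x. (norm (f n x - f0 x))\<^sup>2 \<partial>M)"
  let ?G = "\<lambda>n. sqrt (\<integral>x. (norm (g n x - g0 x))\<^sup>2 \<partial>M)"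
  let ?f = "sqrt (\<integral>x. (norm (f0 x))\<^sup>2 \<partial>M)" and ?g = "sqrt (\<integral>x. (norm (g0 x))\<^sup>2 \<partial>M)"
  have lim: "?F \<longlonglongrightarrow> 0" "?G \<longlonglongrightarrow> 0"
    using tendsto_real_sqrt[OF f] tendsto_real_sqrt[OF g] by auto
  have D: "L2 M (\<lambda>x. f n x - f0 x)" "L2 M (\<lambda>x. g n x - g0 x)" for n by (intro L2_diff L)+
  have bound: "norm ((\<integral>x. f n x \<bullet> g n x \<partial>M) - (\<integral>x. f0 x \<bullet> g0 x \<partial>M)) \<le> ?F n * ?G n + ?F n * ?g + ?f * ?G n" for n
  proof -
    have eq: "(\<integral>x. f n x \<bullet> g n x \<partial>M) - (\<integral>x. f0 x \<bullet> g0 x \<partial>M) =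
      (\<integral>x. (f n x - f0 x) \<bullet> (g n x - g0 x) \<partial>M) + (\<integral>x. (f n x - f0 x) \<bullet> g0 x \<partial>M) + (\<integral>x. f0 x \<bullet> (g n x - g0 x) \<partial>M)"
      using L2_inner[OF L(1)[of n] L(3)[of n]] L2_inner[OF L(2) L(4)] L2_inner[OF L(2) L(3)[of n]]
       L2_inner[OF L(1)[of n] L(4)]
      by (simp add: inner_diff_left inner_diff_right)
    show ?thesis unfolding eq
      using L2_Cauchy_Schwarz_abs[OF D(1)[of n] D(2)[of n]]
        L2_Cauchy_Schwarz_abs[OF D(1)[of n] L(4)] L2_Cauchy_Schwarz_abs[OF L(2) D(2)[of n]]
      by auto
  qed
  have "(\<lambda>n. ?F n * ?G n + ?F n * ?g + ?f * ?G n) \<longlonglongrightarrow> 0 * 0 + 0 * ?g + ?f * 0"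
    by (intro tendsto_intros lim)
  then have lim0: "(\<lambda>n. ?F n * ?G n + ?F n * ?g + ?f * ?G n) \<longlonglongrightarrow> 0" by simp
  have "(\<lambda>n. (\<integral>x. f n x \<bullet> g n x \<partial>M) - (\<integral>x. f0 x \<bullet> g0 x \<partial>M)) \<longlonglongrightarrow> 0"
    by (rule Lim_null_comparison[OF _ lim0]) (intro always_eventually allI bound)
  then show ?thesis by (rule LIM_zero_cancel)
qed

lemma L2_norm_tendsto:
  assumes L: "\<And>n. L2 M (f n)" "L2 M f0"
    and f: "(\<lambda>n. \<integral>x. (norm (f n x - f0 x))\<^sup>2 \<partial>M) \<longlonglongrightarrow> 0"
  shows "(\<lambda>n. \<integral>x. (norm (f n x))\<^sup>2 \<partial>M) \<longlonglongrightarrow> (\<integral>x. (norm (f0 x))\<^sup>2 \<partial>M)"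
  using L2_inner_tendsto[OF L L f f] by (simp add: power2_norm_eq_inner)

lemma indicator_square: "(indicator A x)\<^sup>2 = (indicator A x :: real)"
  by (simp add: indicator_def)

lemma L2_indicator:
  "A \<in> sets M \<Longrightarrow> emeasure M A < \<infinity> \<Longrightarrow> L2 M (indicator A :: _ \<Rightarrow> real)"
  by (auto simp: L2_def indicator_square integrable_indicator_iff)

lemma L2_supported_integrable:
  assumes "L2 M f" "A \<in> sets M" "emeasure M A < \<infinity>" "\<And>x. x \<notin> A \<Longrightarrow> f x = 0"
  shows "integrable M f"
proof (rule Bochner_Integration.integrable_bound)
  show "integrable M (\<lambda>x. ((indicator A x)\<^sup>2 + (norm (f x))\<^sup>2) / 2 :: real)"
    using assms L2_integrable[OF L2_indicator[OF assms(2,3)]] by (auto simp: L2_def)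
  show "f \<in> borel_measurable M" using assms by (auto simp: L2_def)
  show "AE x in M. norm (f x) \<le> norm (((indicator A x)\<^sup>2 + (norm (f x))\<^sup>2) / 2 :: real)"
    using sum_squares_bound[of 1 "norm (f x)" for x] assms(4)
    by (intro AE_I2) (auto simp: indicator_def mult.commute)
qed

lemma L2_supported_norm_integral:
  assumes "L2 M f" "A \<in> sets M" "emeasure M A < \<infinity>" "\<And>x. x \<notin> A \<Longrightarrow> f x = 0"
  shows "(\<integral>x. norm (f x) \<partial>M)\<^sup>2 \<le> measure M A * (\<integral>x. (norm (f x))\<^sup>2 \<partial>M)"
proof -
  have "L2 M (\<lambda>x. norm (f x))" using assms(1) by (auto simp: L2_def)
  from L2_Cauchy_Schwarz[OF this L2_indicator[OF assms(2,3)]]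
  have "(\<integral>x. norm (f x) \<bullet> indicator A x \<partial>M)\<^sup>2 \<le> (\<integral>x. (norm (f x))\<^sup>2 \<partial>M) * (\<integral>x. (indicator A x)\<^sup>2 \<partial>M)"
    by simp
  moreover have "norm (f x) \<bullet> indicator A x = norm (f x)" for x
    using assms(4)[of x] by (auto simp: indicator_def)
  moreover have "(\<integral>x. (indicator A x)\<^sup>2 \<partial>M) = measure M A"
    using assms(2) by (simp add: indicator_square)
  ultimately show ?thesis by (simp only: mult.commute)
qed

text \<open>On a common support of finite measure an L2-Cauchy sequence is also L1-Cauchy, hence has
  an almost everywhere convergent subsequence. Fatou along that subsequence turns the Cauchy
  estimate into L2 convergence to the pointwise limit.\<close>

lemma L2_complete_supported:
  fixes f :: "nat \<Rightarrow> 'x \<Rightarrow> 'b::euclidean_space"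
  assumes L: "\<And>n. L2 M (f n)" and A: "A \<in> sets M" "emeasure M A < \<infinity>"
    and zero: "\<And>n x. x \<notin> A \<Longrightarrow> f n x = 0"
    and Cauchy: "\<And>e. e > 0 \<Longrightarrow> \<exists>N. \<forall>i\<ge>N. \<forall>j\<ge>N. (\<integral>x. (norm (f i x - f j x))\<^sup>2 \<partial>M) < e"
  obtains f0 where "L2 M f0" "(\<lambda>n. \<integral>x. (norm (f n x - f0 x))\<^sup>2 \<partial>M) \<longlonglongrightarrow> 0"
proof -
  have D: "L2 M (\<lambda>x. f i x - f j x)" for i j by (intro L2_diff L)
  have "\<exists>N. \<forall>i\<ge>N. \<forall>j\<ge>N. (\<integral>x. norm (f i x - f j x) \<partial>M) < e" if e: "e > 0" for e :: real
  proof -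
    \<comment> \<open>The added 1 covers a support of measure 0.\<close>
    let ?d = "e\<^sup>2 / (measure M A + 1)"
    have m: "measure M A + 1 > 0" by (simp add: add_nonneg_pos)
    have "?d > 0" using e m by (intro divide_pos_pos) auto
    then obtain N where N: "\<forall>i\<ge>N. \<forall>j\<ge>N. (\<integral>x. (norm (f i x - f j x))\<^sup>2 \<partial>M) < ?d"
      using Cauchy by blast
    have "(\<integral>x. norm (f i x - f j x) \<partial>M) < e" if "i \<ge> N" "j \<ge> N" for i j
    proof -
      have "(\<integral>x. norm (f i x - f j x) \<partial>M)\<^sup>2 \<le> measure M A * (\<integral>x. (norm (f i x - f j x))\<^sup>2 \<partial>M)"
        using zero by (intro L2_supported_norm_integral D A) auto
      also have "\<dots> \<le> (measure M A + 1) * (\<integral>x. (norm (f i x - f j x))\<^sup>2 \<partial>M)"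
        by (intro mult_right_mono) auto
      also have "\<dots> < (measure M A + 1) * ?d"
        using N that m by (intro mult_strict_left_mono) auto
      also have "\<dots> = e\<^sup>2" using m by simp
      finally show ?thesis using e by (simp add: power2_less_imp_less)
    qed
    then show ?thesis by blast
  qed
  note L1 = this
  have "integrable M (f n)" for n by (rule L2_supported_integrable[OF L A zero])
  from cauchy_L1_AE_cauchy_subseq[of M f, OF this L1]
  obtain r where r: "strict_mono r" "AE x in M. Cauchy (\<lambda>i. f (r i) x)" by blast
  define f0 where "f0 x = lim (\<lambda>i. f (r i) x)" for x
  have meas[measurable]: "f n \<in> borel_measurable M" for n using L by (auto simp: L2_def)
  have m0[measurable]: "f0 \<in> borel_measurable M" unfolding f0_def by measurable
  have lim: "AE x in M. (\<lambda>i. f (r i) x) \<longlonglongrightarrow> f0 x"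
    using r(2) by eventually_elim (auto simp: f0_def Cauchy_convergent_iff convergent_LIMSEQ_iff)
  have key: "\<exists>N. \<forall>n\<ge>N. integrable M (\<lambda>x. (norm (f n x - f0 x))\<^sup>2) \<and> (\<integral>x. (norm (f n x - f0 x))\<^sup>2 \<partial>M) \<le> e"
    if e: "e > 0" for e
  proof -
    obtain N where N: "\<forall>i\<ge>N. \<forall>j\<ge>N. (\<integral>x. (norm (f i x - f j x))\<^sup>2 \<partial>M) < e" using Cauchy[OF e] by blast
    have "integrable M (\<lambda>x. (norm (f n x - f0 x))\<^sup>2) \<and> (\<integral>x. (norm (f n x - f0 x))\<^sup>2 \<partial>M) \<le> e" if n: "n \<ge> N" for n
    proof -
      have "AE x in M. ennreal ((norm (f n x - f0 x))\<^sup>2) = liminf (\<lambda>k. ennreal ((norm (f n x - f (r k) x))\<^sup>2))"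
        using lim
      proof eventually_elim
        case (elim x)
        then have "(\<lambda>k. ennreal ((norm (f n x - f (r k) x))\<^sup>2)) \<longlonglongrightarrow> ennreal ((norm (f n x - f0 x))\<^sup>2)"
          by (intro tendsto_intros)
        from lim_imp_Liminf[OF sequentially_bot this] show ?case by simp
      qed
      then have "(\<integral>\<^sup>+x. ennreal ((norm (f n x - f0 x))\<^sup>2) \<partial>M) =
         (\<integral>\<^sup>+x. liminf (\<lambda>k. ennreal ((norm (f n x - f (r k) x))\<^sup>2)) \<partial>M)"
        by (rule nn_integral_cong_AE)
      also have "\<dots> \<le> liminf (\<lambda>k. \<integral>\<^sup>+x. ennreal ((norm (f n x - f (r k) x))\<^sup>2) \<partial>M)"
        by (rule nn_integral_liminf) measurable
      also have "\<dots> \<le> ennreal e"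
      proof -
        have "(\<integral>\<^sup>+x. ennreal ((norm (f n x - f (r k) x))\<^sup>2) \<partial>M) \<le> ennreal e" if "k \<ge> N" for k
        proof -
          have "r k \<ge> N" using that seq_suble[OF r(1), of k] by simp
          then have "(\<integral>x. (norm (f n x - f (r k) x))\<^sup>2 \<partial>M) \<le> e" using N n by (simp add: less_imp_le)
          then show ?thesis
            by (subst nn_integral_eq_integral) (use D in \<open>auto simp: L2_def intro: ennreal_leI\<close>)
        qed
        then have "\<forall>\<^sub>F k in sequentially. (\<integral>\<^sup>+x. ennreal ((norm (f n x - f (r k) x))\<^sup>2) \<partial>M) \<le> ennreal e"
          by (auto simp: eventually_sequentially)
        then show ?thesis
          by (intro order_trans[OF Liminf_le_Limsup[OF sequentially_bot] Limsup_bounded])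
      qed
      finally have le: "(\<integral>\<^sup>+x. ennreal ((norm (f n x - f0 x))\<^sup>2) \<partial>M) \<le> ennreal e" .
      then have int: "integrable M (\<lambda>x. (norm (f n x - f0 x))\<^sup>2)"
        by (intro integrableI_nonneg) (auto intro: le_less_trans)
      moreover have "(\<integral>x. (norm (f n x - f0 x))\<^sup>2 \<partial>M) \<le> e"
        using le e nn_integral_eq_integral[OF int] by simp
      ultimately show ?thesis by blast
    qed
    then show ?thesis by blast
  qed
  obtain N where "integrable M (\<lambda>x. (norm (f N x - f0 x))\<^sup>2)" using key[of 1] by auto
  then have "L2 M (\<lambda>x. f N x - f0 x)" by (auto simp: L2_def)
  from L2_diff[OF L this, of N] have "L2 M f0" by simp
  moreover have "(\<lambda>n. \<integral>x. (norm (f n x - f0 x))\<^sup>2 \<partial>M) \<longlonglongrightarrow> 0"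
  proof (rule LIMSEQ_I)
    fix e :: real assume "e > 0"
    then obtain N where "\<forall>n\<ge>N. (\<integral>x. (norm (f n x - f0 x))\<^sup>2 \<partial>M) \<le> e / 2"
      using key[of "e / 2"] by auto
    then show "\<exists>N. \<forall>n\<ge>N. norm ((\<integral>x. (norm (f n x - f0 x))\<^sup>2 \<partial>M) - 0) < e"
      using \<open>e > 0\<close> by (intro exI[of _ N]) force
  qed
  ultimately show thesis using that by blast
qed

section \<open>Lebesgue integrals on Euclidean space\<close>

lemma lebesgue_integral_translate:
  fixes f :: "'a::euclidean_space \<Rightarrow> 'b::euclidean_space"
  assumes [measurable]: "f \<in> borel_measurable borel"
  shows "(\<integral>x. f (x + a) \<partial>lebesgue) = (\<integral>x. f x \<partial>lebesgue)"
proof -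
  have "(\<integral>x. f x \<partial>lborel) = (\<integral>x. f x \<partial>distr lborel borel ((+) a))" by (simp add: lborel_distr_plus)
  also have "\<dots> = (\<integral>x. f (a + x) \<partial>lborel)" by (subst integral_distr) auto
  finally show ?thesis by (simp add: integral_completion add.commute)
qed

lemma lebesgue_integrable_translate:
  fixes f :: "'a::euclidean_space \<Rightarrow> 'b::euclidean_space"
  assumes [measurable]: "f \<in> borel_measurable borel" and "integrable lebesgue f"
  shows "integrable lebesgue (\<lambda>x. f (x + a))"
proof -
  have "integrable (distr lborel borel ((+) a)) f"
    using assms by (simp add: lborel_distr_plus integrable_completion)
  then have "integrable lborel (\<lambda>x. f (a + x))" by (subst (asm) integrable_distr_eq) auto
  then show ?thesis by (subst integrable_completion) (auto simp: add.commute)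
qed

lemma lebesgue_integral_scale:
  fixes f :: "'a::euclidean_space \<Rightarrow> real"
  assumes [measurable]: "f \<in> borel_measurable borel" and c: "c > 0"
  shows "(\<integral>x. f (c *\<^sub>R x) \<partial>lebesgue) = (\<integral>x. f x \<partial>lebesgue) / c ^ DIM('a)"
proof -
  have "(\<integral>x. f x \<partial>lborel) = (\<integral>x. f x \<partial>density (distr lborel borel (\<lambda>x. 0 + c *\<^sub>R x)) (\<lambda>_. ennreal (\<bar>c\<bar>^DIM('a))))"
    using lborel_affine[of c "0::'a"] c by simp
  also have "\<dots> = (\<integral>x. (\<bar>c\<bar>^DIM('a)) *\<^sub>R f x \<partial>distr lborel borel (\<lambda>x. 0 + c *\<^sub>R x))"
    by (subst integral_density) auto
  also have "\<dots> = (\<integral>x. (\<bar>c\<bar>^DIM('a)) *\<^sub>R f (0 + c *\<^sub>R x) \<partial>lborel)"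
    by (subst integral_distr) auto
  also have "\<dots> = c^DIM('a) * (\<integral>x. f (c *\<^sub>R x) \<partial>lborel)" using c by simp
  finally show ?thesis using c by (simp add: integral_completion field_simps)
qed

lemma integrable_bounded_on_lmeasurable:
  fixes f :: "'a::euclidean_space \<Rightarrow> 'b::euclidean_space"
  assumes "f \<in> borel_measurable lebesgue" "A \<in> lmeasurable" "\<And>x. x \<in> A \<Longrightarrow> norm (f x) \<le> C"
    "\<And>x. x \<notin> A \<Longrightarrow> f x = 0"
  shows "integrable lebesgue f"
proof (rule Bochner_Integration.integrable_bound)
  show "integrable lebesgue (\<lambda>x. C * indicator A x :: real)"
    using assms(2) by (intro integrable_mult_right) (auto simp: fmeasurable_def less_top)
  show "AE x in lebesgue. norm (f x) \<le> norm (C * indicator A x :: real)"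
    using assms(3,4) by (intro AE_I2) (force simp: indicator_def)
qed (rule assms)

lemma borel_imp_lebesgue_measurable:
  fixes f :: "'a::euclidean_space \<Rightarrow> 'b::euclidean_space"
  shows "f \<in> borel_measurable borel \<Longrightarrow> f \<in> borel_measurable lebesgue"
  by (rule measurable_completion) simp

lemma continuous_imp_lebesgue_measurable:
  fixes f :: "'a::euclidean_space \<Rightarrow> 'b::euclidean_space"
  shows "continuous_on UNIV f \<Longrightarrow> f \<in> borel_measurable lebesgue"
  using borel_measurable_continuous_onI measurable_completion[of f lborel borel] by fastforce

lemma integrable_continuous_compact_support:
  fixes f :: "'a::euclidean_space \<Rightarrow> 'b::euclidean_space"
  assumes "continuous_on UNIV f" "compact K" "\<And>x. x \<notin> K \<Longrightarrow> f x = 0"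
  shows "integrable lebesgue f"
proof -
  have "bounded (f ` K)"
    using assms by (meson compact_continuous_image compact_imp_bounded continuous_on_subset subset_UNIV)
  then obtain C where "\<And>x. x \<in> K \<Longrightarrow> norm (f x) \<le> C" by (auto simp: bounded_iff)
  then show ?thesis
    using assms by (intro integrable_bounded_on_lmeasurable[of f K C] continuous_imp_lebesgue_measurable)
      (auto intro: lmeasurable_compact)
qed

lemma integral_pos_of_open:
  fixes f :: "'a::euclidean_space \<Rightarrow> real"
  assumes "integrable lebesgue f" "\<And>x. 0 \<le> f x" "open U" "U \<noteq> {}" "\<And>x. x \<in> U \<Longrightarrow> f x > 0"
  shows "0 < (\<integral>x. f x \<partial>lebesgue)"
proof -
  have "(\<integral>x. f x \<partial>lebesgue) \<noteq> 0"
  proof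
    assume "(\<integral>x. f x \<partial>lebesgue) = 0"
    then have "AE x in lebesgue. f x = 0"
      using integral_nonneg_eq_0_iff_AE[OF assms(1)] assms(2) by auto
    then have "AE x in lebesgue. x \<notin> U" by eventually_elim (use assms(5) in force)
    then have "U \<in> null_sets lebesgue"
      using assms(3) by (subst AE_iff_null_sets) auto
    then show False using open_not_negligible[OF assms(3,4)] by (simp add: negligible_iff_null_sets)
  qed
  then show ?thesis using assms(2) by (simp add: less_le)
qed

section \<open>Difference quotients and translations\<close>

lemma directional_increment_bound:
  fixes f :: "'a::euclidean_space \<Rightarrow> real"
  assumes der: "\<And>x. (f has_derivative f' x) (at x)" and C: "\<And>x. \<bar>f' x h\<bar> \<le> C" and t: "t > 0"
  shows "\<bar>(f (x + t *\<^sub>R h) - f x) / t\<bar> \<le> C"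
proof -
  have D: "((\<lambda>s. f (x + s *\<^sub>R h)) has_real_derivative f' (x + s *\<^sub>R h) h) (at s)" for s
  proof -
    have "((\<lambda>s. x + s *\<^sub>R h) has_derivative (\<lambda>y. y *\<^sub>R h)) (at s)"
      by (auto intro!: derivative_eq_intros)
    from diff_chain_at[OF this der]
    have "((\<lambda>s. f (x + s *\<^sub>R h)) has_derivative (\<lambda>y. f' (x + s *\<^sub>R h) (y *\<^sub>R h))) (at s)" by (simp add: o_def)
    moreover have "f' (x + s *\<^sub>R h) (y *\<^sub>R h) = f' (x + s *\<^sub>R h) h * y" for y
      using linear_scale[OF has_derivative_linear[OF der]] by simp
    ultimately show ?thesis by (simp add: has_field_derivative_def)
  qed
  obtain z where "f (x + t *\<^sub>R h) - f (x + 0 *\<^sub>R h) = (t - 0) * f' (x + z *\<^sub>R h) h"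
    using MVT2[OF t, of "\<lambda>s. f (x + s *\<^sub>R h)" "\<lambda>s. f' (x + s *\<^sub>R h) h"] D by blast
  then have "(f (x + t *\<^sub>R h) - f x) / t = f' (x + z *\<^sub>R h) h" using t by simp
  then show ?thesis using C by simp
qed

lemma difference_quotient_tendsto:
  fixes f :: "'a::euclidean_space \<Rightarrow> real"
  assumes der: "(f has_derivative f') (at x)"
  shows "(\<lambda>n. real (Suc n) * (f (x + (1 / real (Suc n)) *\<^sub>R h) - f x)) \<longlonglongrightarrow> f' h"
proof -
  have "((\<lambda>s. x + s *\<^sub>R h) has_derivative (\<lambda>y. y *\<^sub>R h)) (at 0)"
    by (auto intro!: derivative_eq_intros)
  from diff_chain_at[OF this, of f f'] der
  have "((\<lambda>s. f (x + s *\<^sub>R h)) has_derivative (\<lambda>y. f' (y *\<^sub>R h))) (at 0)" by (simp add: o_def)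
  moreover have "f' (y *\<^sub>R h) = f' h * y" for y
    using linear_scale[OF has_derivative_linear[OF der]] by simp
  ultimately have "((\<lambda>s. f (x + s *\<^sub>R h)) has_real_derivative f' h) (at 0)"
    by (simp add: has_field_derivative_def)
  then have "((\<lambda>s. (f (x + s *\<^sub>R h) - f x) / s) \<longlongrightarrow> f' h) (at 0)"
    by (simp add: DERIV_def)
  moreover have "filterlim (\<lambda>n. 1 / real (Suc n)) (at 0) sequentially"
    using LIMSEQ_inverse_real_of_nat by (intro filterlim_atI) (auto simp: inverse_eq_divide)
  ultimately have "(\<lambda>n. (f (x + (1 / real (Suc n)) *\<^sub>R h) - f x) / (1 / real (Suc n))) \<longlonglongrightarrow> f' h"
    by (rule filterlim_compose)
  then show ?thesis by (simp add: mult.commute)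
qed

text \<open>By translation invariance every difference quotient in direction \<open>h\<close> has
  integral 0. The quotients are bounded by \<open>C\<close> and, since the steps are at most
  \<open>h\<close>, live on one fixed ball, so dominated convergence applies. This takes the role of
  integration by parts.\<close>

lemma integral_directional_derivative_eq_0:
  fixes f :: "'a::euclidean_space \<Rightarrow> real"
  assumes der: "\<And>x. (f has_derivative f' x) (at x)" and C: "\<And>x. \<bar>f' x h\<bar> \<le> C"
    and K: "compact K" "\<And>x. x \<notin> K \<Longrightarrow> f x = 0"
  shows "(\<integral>x. f' x h \<partial>lebesgue) = 0" and "integrable lebesgue (\<lambda>x. f' x h)"
proof -
  obtain R where R: "\<And>x. x \<in> K \<Longrightarrow> norm x \<le> R" using compact_imp_bounded[OF K(1)] by (auto simp: bounded_iff)
  let ?B = "cball 0 (R + norm h) :: 'a set"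
  let ?s = "\<lambda>n x. real (Suc n) * (f (x + (1 / real (Suc n)) *\<^sub>R h) - f x)"
  have cont: "continuous_on UNIV f"
    using der by (auto intro!: continuous_at_imp_continuous_on has_derivative_continuous)
  then have [measurable]: "f \<in> borel_measurable borel" by (rule borel_measurable_continuous_onI)
  have int: "integrable lebesgue f" by (rule integrable_continuous_compact_support[OF cont K])
  have zero: "(\<integral>x. ?s n x \<partial>lebesgue) = 0" for n
    using int lebesgue_integrable_translate[OF _ int, of "(1 / real (Suc n)) *\<^sub>R h"]
    by (simp add: lebesgue_integral_translate)
  have m: "?s n \<in> borel_measurable lebesgue" for n
    using int lebesgue_integrable_translate[OF _ int, of "(1 / real (Suc n)) *\<^sub>R h"] by auto
  have m': "(\<lambda>x. f' x h) \<in> borel_measurable lebesgue"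
    by (rule borel_measurable_LIMSEQ_metric[OF m difference_quotient_tendsto[OF der]])
  have dom: "integrable lebesgue (\<lambda>x. C * indicator ?B x)"
    by (intro integrable_mult_right) (auto intro!: integrable_real_indicator emeasure_bounded_finite[unfolded infinity_ennreal_def])
  have lim: "AE x in lebesgue. (\<lambda>n. ?s n x) \<longlonglongrightarrow> f' x h"
    by (intro AE_I2 difference_quotient_tendsto der)
  have bnd: "AE x in lebesgue. norm (?s n x) \<le> C * indicator ?B x" for n
  proof (intro AE_I2)
    fix x :: 'a
    let ?t = "1 / real (Suc n)"
    show "norm (?s n x) \<le> C * indicator ?B x"
    proof (cases "x \<in> ?B")
      case True
      then show ?thesis using directional_increment_bound[OF der C, of ?t x] by (simp add: mult.commute)
    next
      case False
      then have n: "norm x > R + norm h" by simp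
      have "norm (?t *\<^sub>R h) \<le> norm h" by (simp add: divide_le_eq algebra_simps)
      then have "norm (x + ?t *\<^sub>R h) > R" using n norm_diff_ineq[of x "?t *\<^sub>R h"] by linarith
      moreover have "norm x > R" using n norm_ge_zero[of h] by linarith
      ultimately have "f x = 0" "f (x + ?t *\<^sub>R h) = 0" using K(2) R not_le by blast+
      then show ?thesis using False by simp
    qed
  qed
  show "integrable lebesgue (\<lambda>x. f' x h)"
    by (rule integrable_dominated_convergence[OF m' m dom lim bnd])
  have "(\<lambda>n. \<integral>x. ?s n x \<partial>lebesgue) \<longlonglongrightarrow> (\<integral>x. f' x h \<partial>lebesgue)"
    by (rule integral_dominated_convergence[OF m' m dom lim bnd])
  then show "(\<integral>x. f' x h \<partial>lebesgue) = 0" using zero by (simp add: LIMSEQ_const_iff)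
qed

text \<open>Splitting the translation into \<open>n\<close> equal steps and using convexity of the square reduces the
  bound to difference quotients as \<open>n \<rightarrow> \<infinity>\<close>. The invariance hypothesis holds for compactly supported
  functions as well as for periodic ones on a period cell.\<close>
lemma translation_square_bound:
  fixes f :: "'a::euclidean_space \<Rightarrow> real"
  assumes f: "smooth_fun f" and C: "\<And>x. norm (grad f x) \<le> C" and A: "A \<in> lmeasurable"
    and inv: "\<And>n k. k \<le> n \<Longrightarrow> (\<integral>x. indicator A x * (f (x + (real (Suc k) / real (Suc n)) *\<^sub>R h) -
        f (x + (real k / real (Suc n)) *\<^sub>R h))\<^sup>2 \<partial>lebesgue) =
      (\<integral>x. indicator A x * (f (x + (1 / real (Suc n)) *\<^sub>R h) - f x)\<^sup>2 \<partial>lebesgue)"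
  shows "(\<integral>x. indicator A x * (f (x + h) - f x)\<^sup>2 \<partial>lebesgue) \<le> (\<integral>x. indicator A x * (grad f x \<bullet> h)\<^sup>2 \<partial>lebesgue)"
proof -
  have C': "\<bar>grad f x \<bullet> v\<bar> \<le> C * norm v" for x v
    using Cauchy_Schwarz_ineq2[of "grad f x" v] C[of x] mult_right_mono[of "norm (grad f x)" C "norm v"] by fastforce
  have inc: "\<bar>f (y + v) - f y\<bar> \<le> C * norm v" for y v
    using directional_increment_bound[OF smooth_fun_grad[OF f] C', of 1 y v] by simp
  have [measurable]: "f \<in> borel_measurable borel" "A \<in> sets lebesgue"
    using A by (auto intro: borel_measurable_continuous_onI smooth_fun_continuous[OF f])
  have mt: "(\<lambda>x. f (x + v)) \<in> borel_measurable lebesgue" for v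
    by (intro continuous_imp_lebesgue_measurable smooth_fun_continuous smooth_translate f)
  have int: "integrable lebesgue (\<lambda>x. indicator A x * (f (x + v) - f (x + w))\<^sup>2)" for v w
  proof (rule integrable_bounded_on_lmeasurable[OF _ A])
    fix x
    have "\<bar>f (x + v) - f (x + w)\<bar> \<le> C * norm (v - w)" using inc[of "x + w" "v - w"] by (simp add: algebra_simps)
    then show "norm (indicator A x * (f (x + v) - f (x + w))\<^sup>2) \<le> (C * norm (v - w))\<^sup>2"
      by (auto simp: indicator_def abs_le_square_iff[symmetric] power2_le_iff_abs_le)
  qed (use mt[of v] mt[of w] in auto)
  let ?I = "\<lambda>n. \<integral>x. indicator A x * (real (Suc n) * (f (x + (1 / real (Suc n)) *\<^sub>R h) - f x))\<^sup>2 \<partial>lebesgue"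
  have "(\<integral>x. indicator A x * (f (x + h) - f x)\<^sup>2 \<partial>lebesgue) \<le> ?I n" for n
  proof -
    let ?N = "real (Suc n)"
    let ?d = "\<lambda>k x. f (x + (real (Suc k) / ?N) *\<^sub>R h) - f (x + (real k / ?N) *\<^sub>R h)"
    have "indicator A x * (f (x + h) - f x)\<^sup>2 \<le> (\<Sum>k\<le>n. ?N * (indicator A x * (?d k x)\<^sup>2))" for x
    proof -
      have "(\<Sum>k<Suc n. ?d k x) = f (x + (?N / ?N) *\<^sub>R h) - f (x + (real 0 / ?N) *\<^sub>R h)"
        by (rule sum_lessThan_telescope)
      then have "f (x + h) - f x = (\<Sum>k\<le>n. ?d k x)" by (simp add: lessThan_Suc_atMost)
      then have "(f (x + h) - f x)\<^sup>2 \<le> (\<Sum>k\<le>n. (?d k x)\<^sup>2) * ?N"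
        using sum_squared_le_sum_of_squares[of "\<lambda>k. ?d k x" "{..n}"] by simp
      then show ?thesis by (auto simp: indicator_def sum_distrib_left mult.commute)
    qed
    then have "(\<integral>x. indicator A x * (f (x + h) - f x)\<^sup>2 \<partial>lebesgue) \<le>
      (\<integral>x. (\<Sum>k\<le>n. ?N * (indicator A x * (?d k x)\<^sup>2)) \<partial>lebesgue)"
      using int[of h 0] int by (intro integral_mono) auto
    also have "\<dots> = (\<Sum>k\<le>n. ?N * (\<integral>x. indicator A x * (?d k x)\<^sup>2 \<partial>lebesgue))"
      using int by (simp add: Bochner_Integration.integral_sum)
    also have "\<dots> = (\<Sum>k\<le>n. ?N * (\<integral>x. indicator A x * (f (x + (1 / ?N) *\<^sub>R h) - f x)\<^sup>2 \<partial>lebesgue))"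
      using inv[of _ n] by (intro sum.cong) auto
    also have "\<dots> = ?N\<^sup>2 * (\<integral>x. indicator A x * (f (x + (1 / ?N) *\<^sub>R h) - f x)\<^sup>2 \<partial>lebesgue)"
      by (simp add: power2_eq_square)
    also have "\<dots> = ?I n" 
      by (subst integral_mult_right_zero[symmetric]) (simp add: power_mult_distrib mult_ac)
    finally show ?thesis .
  qed
  moreover have "?I \<longlonglongrightarrow> (\<integral>x. indicator A x * (grad f x \<bullet> h)\<^sup>2 \<partial>lebesgue)"
  proof (rule integral_dominated_convergence)
    show "(\<lambda>x. indicator A x * (grad f x \<bullet> h)\<^sup>2) \<in> borel_measurable lebesgue"
      using continuous_imp_lebesgue_measurable[OF continuous_grad[OF f]]
      by (intro borel_measurable_times borel_measurable_power borel_measurable_inner) auto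
    show "(\<lambda>x. indicator A x * (real (Suc n) * (f (x + (1 / real (Suc n)) *\<^sub>R h) - f x))\<^sup>2) \<in> borel_measurable lebesgue" for n
      using mt[of "(1 / real (Suc n)) *\<^sub>R h"] mt[of 0]
      by (intro borel_measurable_times borel_measurable_power borel_measurable_diff) auto
    show "integrable lebesgue (\<lambda>x. (C * norm h)\<^sup>2 * indicator A x)"
      using A by (intro integrable_mult_right) (auto simp: fmeasurable_def less_top)
    show "AE x in lebesgue. (\<lambda>n. indicator A x * (real (Suc n) * (f (x + (1 / real (Suc n)) *\<^sub>R h) - f x))\<^sup>2)
       \<longlonglongrightarrow> indicator A x * (grad f x \<bullet> h)\<^sup>2"
      by (intro AE_I2 tendsto_intros difference_quotient_tendsto smooth_fun_grad f)
    show "AE x in lebesgue. norm (indicator A x * (real (Suc n) * (f (x + (1 / real (Suc n)) *\<^sub>R h) - f x))\<^sup>2)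
        \<le> (C * norm h)\<^sup>2 * indicator A x" for n
    proof (intro AE_I2)
      fix x
      have "\<bar>real (Suc n) * (f (x + (1 / real (Suc n)) *\<^sub>R h) - f x)\<bar> \<le> C * norm h"
        using directional_increment_bound[OF smooth_fun_grad[OF f] C', of "1 / real (Suc n)" x h] by (simp add: mult.commute)
      then have "(real (Suc n) * (f (x + (1 / real (Suc n)) *\<^sub>R h) - f x))\<^sup>2 \<le> (C * norm h)\<^sup>2"
        using abs_le_square_iff by fastforce
      then show "norm (indicator A x * (real (Suc n) * (f (x + (1 / real (Suc n)) *\<^sub>R h) - f x))\<^sup>2)
        \<le> (C * norm h)\<^sup>2 * indicator A x" by (auto simp: indicator_def)
    qed
  qed
  ultimately show ?thesis by (intro LIMSEQ_le_const) auto
qed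

section \<open>Test functions\<close>

lemma test_fun_smooth: "test_fun \<Omega> \<phi> \<Longrightarrow> smooth_fun \<phi>"
  by (simp add: test_fun_def)

lemma test_fun_differentiable: "test_fun \<Omega> \<phi> \<Longrightarrow> \<phi> differentiable (at x)"
  by (simp add: test_fun_smooth smooth_fun_differentiable)

lemma not_tsupport: "x \<notin> tsupport \<phi> \<Longrightarrow> \<phi> x = 0"
  using closure_subset[of "{x. \<phi> x \<noteq> 0}"] by (auto simp: tsupport_def)

lemma grad_not_tsupport:
  assumes "x \<notin> tsupport \<phi>"
  shows "grad \<phi> x = 0"
proof -
  have "grad \<phi> x = grad (\<lambda>x. 0) x"
    by (rule grad_eq_on_open[of "- tsupport \<phi>"]) (use assms not_tsupport in \<open>auto simp: tsupport_def\<close>)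
  then show ?thesis by simp
qed

lemma test_fun_zero: "test_fun \<Omega> \<phi> \<Longrightarrow> x \<notin> \<Omega> \<Longrightarrow> \<phi> x = 0"
  and test_fun_grad_zero: "test_fun \<Omega> \<phi> \<Longrightarrow> x \<notin> \<Omega> \<Longrightarrow> grad \<phi> x = 0"
  by (meson test_fun_def not_tsupport subsetD) (meson test_fun_def grad_not_tsupport subsetD)

lemma test_funI:
  assumes "smooth_fun \<psi>" "compact K" "K \<subseteq> \<Omega>" "\<And>x. x \<notin> K \<Longrightarrow> \<psi> x = 0"
  shows "test_fun \<Omega> \<psi>"
proof -
  have "tsupport \<psi> \<subseteq> K"
    unfolding tsupport_def by (rule closure_minimal) (use assms in \<open>auto intro: compact_imp_closed\<close>)
  moreover have "closed (tsupport \<psi>)" by (simp add: tsupport_def)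
  ultimately have "compact (tsupport \<psi>)" using compact_Int_closed[OF assms(2)] by (metis inf.absorb2)
  then show ?thesis using \<open>tsupport \<psi> \<subseteq> K\<close> assms by (auto simp: test_fun_def)
qed

lemma test_fun_compact: "test_fun \<Omega> \<phi> \<Longrightarrow> compact (tsupport \<phi>)"
  and test_fun_subset: "test_fun \<Omega> \<phi> \<Longrightarrow> tsupport \<phi> \<subseteq> \<Omega>"
  by (auto simp: test_fun_def)

lemma test_fun_mono: "test_fun \<Omega> \<phi> \<Longrightarrow> \<Omega> \<subseteq> \<Omega>' \<Longrightarrow> test_fun \<Omega>' \<phi>"
  by (auto simp: test_fun_def)

lemma test_fun_supported:
  assumes "test_fun \<Omega> \<phi>" "smooth_fun \<psi>" "\<And>x. \<phi> x = 0 \<Longrightarrow> \<psi> x = 0"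
  shows "test_fun \<Omega> \<psi>"
  by (rule test_funI[OF assms(2) test_fun_compact[OF assms(1)] test_fun_subset[OF assms(1)]])
    (use assms(3) not_tsupport in blast)

lemma test_fun_add:
  assumes "test_fun \<Omega> \<phi>" "test_fun \<Omega> \<psi>"
  shows "test_fun \<Omega> (\<lambda>x. \<phi> x + \<psi> x)"
  by (rule test_funI[of _ "tsupport \<phi> \<union> tsupport \<psi>"])
    (use assms in \<open>auto intro!: smooth_intros simp: test_fun_def not_tsupport\<close>)

lemma test_fun_cmult:
  assumes "test_fun \<Omega> \<phi>"
  shows "test_fun \<Omega> (\<lambda>x. c * \<phi> x)"
  by (rule test_fun_supported[OF assms]) (simp_all add: smooth_mult smooth_const test_fun_smooth[OF assms])

lemma test_fun_diff: "test_fun \<Omega> \<phi> \<Longrightarrow> test_fun \<Omega> \<psi> \<Longrightarrow> test_fun \<Omega> (\<lambda>x. \<phi> x - \<psi> x)"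
  using test_fun_add[of \<Omega> \<phi> "\<lambda>x. (-1) * \<psi> x"] test_fun_cmult[of \<Omega> \<psi> "-1"] by simp

lemma grad_test_add:
  "test_fun \<Omega> \<phi> \<Longrightarrow> test_fun \<Omega> \<psi> \<Longrightarrow> grad (\<lambda>x. \<phi> x + \<psi> x) x = grad \<phi> x + grad \<psi> x"
  and grad_test_diff:
  "test_fun \<Omega> \<phi> \<Longrightarrow> test_fun \<Omega> \<psi> \<Longrightarrow> grad (\<lambda>x. \<phi> x - \<psi> x) x = grad \<phi> x - grad \<psi> x"
  and grad_test_cmult: "test_fun \<Omega> \<phi> \<Longrightarrow> grad (\<lambda>x. c * \<phi> x) x = c *\<^sub>R grad \<phi> x"
  by (simp_all add: grad_add grad_diff grad_cmult test_fun_differentiable)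

lemma test_fun_continuous: "test_fun \<Omega> \<phi> \<Longrightarrow> continuous_on A \<phi>"
  by (simp add: test_fun_smooth smooth_fun_continuous)

lemma test_fun_grad_continuous: "test_fun \<Omega> \<phi> \<Longrightarrow> continuous_on A (grad \<phi>)"
  by (simp add: test_fun_smooth continuous_grad)

lemma test_fun_borel: "test_fun \<Omega> \<phi> \<Longrightarrow> \<phi> \<in> borel_measurable borel"
  by (simp add: borel_measurable_continuous_onI test_fun_continuous)

lemma test_fun_integrable_comp:
  fixes F :: "real \<Rightarrow> 'a::euclidean_space \<Rightarrow> 'a \<Rightarrow> real"
  assumes \<phi>: "test_fun \<Omega> \<phi>"
    and "continuous_on UNIV (\<lambda>x. F (\<phi> x) (grad \<phi> x) x)" "\<And>x. F 0 0 x = 0"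
  shows "integrable lebesgue (\<lambda>x. F (\<phi> x) (grad \<phi> x) x)"
  by (rule integrable_continuous_compact_support[OF assms(2) test_fun_compact[OF \<phi>]])
    (simp add: not_tsupport grad_not_tsupport assms(3))

lemma test_fun_integrable: "test_fun \<Omega> \<phi> \<Longrightarrow> integrable lebesgue \<phi>"
  using test_fun_integrable_comp[of \<Omega> \<phi> "\<lambda>a b c. a"] by (simp add: test_fun_continuous)

lemma test_fun_L2: "test_fun \<Omega> \<phi> \<Longrightarrow> L2 lebesgue \<phi>"
  using test_fun_integrable_comp[of \<Omega> \<phi> "\<lambda>a b c. a\<^sup>2"]
  by (auto simp: L2_def continuous_imp_lebesgue_measurable test_fun_continuous continuous_on_power)

lemma test_fun_grad_L2: "test_fun \<Omega> \<phi> \<Longrightarrow> L2 lebesgue (grad \<phi>)"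
  using test_fun_integrable_comp[of \<Omega> \<phi> "\<lambda>a b c. (norm b)\<^sup>2"]
  by (auto simp: L2_def continuous_imp_lebesgue_measurable test_fun_grad_continuous continuous_on_power continuous_on_norm)

lemma test_fun_grad_bounded:
  assumes "test_fun \<Omega> \<phi>"
  obtains C where "\<And>x. norm (grad \<phi> x) \<le> C"
proof -
  have "bounded (grad \<phi> ` tsupport \<phi>)"
    by (intro compact_imp_bounded compact_continuous_image test_fun_grad_continuous[OF assms] test_fun_compact[OF assms])
  then obtain C where C: "\<And>x. x \<in> tsupport \<phi> \<Longrightarrow> norm (grad \<phi> x) \<le> C" by (auto simp: bounded_iff)
  have "norm (grad \<phi> x) \<le> max C 0" for x
    using C[of x] grad_not_tsupport[of x \<phi>] by (cases "x \<in> tsupport \<phi>") auto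
  then show thesis using that by blast
qed

section \<open>Poincare inequality on sets of finite measure\<close>

text \<open>\<open>translation_square_bound\<close> works on a set of finite measure, so the whole
  space is replaced by a ball outside which all the translates in question vanish; there the
  invariance hypothesis is translation invariance of the integral.\<close>

lemma translation_test_fun_bound:
  fixes \<phi> :: "'a::euclidean_space \<Rightarrow> real"
  assumes \<phi>: "test_fun \<Omega> \<phi>"
  shows "(\<integral>x. (\<phi> (x + h) - \<phi> x)\<^sup>2 \<partial>lebesgue) \<le> (norm h)\<^sup>2 * (\<integral>x. (norm (grad \<phi> x))\<^sup>2 \<partial>lebesgue)"
proof -
  obtain R where R: "\<And>x. x \<in> tsupport \<phi> \<Longrightarrow> norm x \<le> R"
    using compact_imp_bounded[OF test_fun_compact[OF \<phi>]] by (auto simp: bounded_iff)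
  obtain C where C: "\<And>x. norm (grad \<phi> x) \<le> C" using test_fun_grad_bounded[OF \<phi>] by blast
  let ?A = "cball 0 (R + norm h) :: 'a set"
  have [measurable]: "\<phi> \<in> borel_measurable borel" by (rule test_fun_borel[OF \<phi>])
  have out: "\<phi> (x + t *\<^sub>R h) = 0" if "x \<notin> ?A" "0 \<le> t" "t \<le> 1" for x t
  proof -
    have "norm (t *\<^sub>R h) \<le> norm h" using that by (simp add: mult_left_le_one_le)
    then have "norm (x + t *\<^sub>R h) > R" using that(1) norm_diff_ineq[of x "t *\<^sub>R h"] by (simp add: not_le)
    then show ?thesis using R not_tsupport[of "x + t *\<^sub>R h" \<phi>] by force
  qed
  have ind: "indicator ?A x * (\<phi> (x + s *\<^sub>R h) - \<phi> (x + t *\<^sub>R h))\<^sup>2 = (\<phi> (x + s *\<^sub>R h) - \<phi> (x + t *\<^sub>R h))\<^sup>2"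
    if "0 \<le> s" "s \<le> 1" "0 \<le> t" "t \<le> 1" for x s t
    using out[of x s] out[of x t] that by (auto simp: indicator_def)
  have "(\<integral>x. indicator ?A x * (\<phi> (x + h) - \<phi> x)\<^sup>2 \<partial>lebesgue) \<le> (\<integral>x. indicator ?A x * (grad \<phi> x \<bullet> h)\<^sup>2 \<partial>lebesgue)"
  proof (rule translation_square_bound[OF test_fun_smooth[OF \<phi>] C])
    fix n k :: nat assume k: "k \<le> n"
    let ?t = "real k / real (Suc n)"
    have "(\<integral>x. (\<phi> (x + (real (Suc k) / real (Suc n)) *\<^sub>R h) - \<phi> (x + ?t *\<^sub>R h))\<^sup>2 \<partial>lebesgue) =
      (\<integral>x. (\<lambda>y. (\<phi> (y + (1 / real (Suc n)) *\<^sub>R h) - \<phi> y)\<^sup>2) (x + ?t *\<^sub>R h) \<partial>lebesgue)"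
      by (intro Bochner_Integration.integral_cong) (auto simp: add_divide_distrib algebra_simps)
    also have "\<dots> = (\<integral>x. (\<phi> (x + (1 / real (Suc n)) *\<^sub>R h) - \<phi> x)\<^sup>2 \<partial>lebesgue)"
      by (rule lebesgue_integral_translate) measurable
    finally have eq: "(\<integral>x. (\<phi> (x + (real (Suc k) / real (Suc n)) *\<^sub>R h) - \<phi> (x + ?t *\<^sub>R h))\<^sup>2 \<partial>lebesgue) =
      (\<integral>x. (\<phi> (x + (1 / real (Suc n)) *\<^sub>R h) - \<phi> x)\<^sup>2 \<partial>lebesgue)" .
    have i1: "indicator ?A x * (\<phi> (x + (real (Suc k) / real (Suc n)) *\<^sub>R h) - \<phi> (x + ?t *\<^sub>R h))\<^sup>2 =
      (\<phi> (x + (real (Suc k) / real (Suc n)) *\<^sub>R h) - \<phi> (x + ?t *\<^sub>R h))\<^sup>2" for x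
      using k by (intro ind) auto
    have i2: "indicator ?A x * (\<phi> (x + (1 / real (Suc n)) *\<^sub>R h) - \<phi> x)\<^sup>2 =
      (\<phi> (x + (1 / real (Suc n)) *\<^sub>R h) - \<phi> x)\<^sup>2" for x
      using ind[of "1 / real (Suc n)" 0 x] by simp
    show "(\<integral>x. indicator ?A x * (\<phi> (x + (real (Suc k) / real (Suc n)) *\<^sub>R h) - \<phi> (x + ?t *\<^sub>R h))\<^sup>2 \<partial>lebesgue) =
      (\<integral>x. indicator ?A x * (\<phi> (x + (1 / real (Suc n)) *\<^sub>R h) - \<phi> x)\<^sup>2 \<partial>lebesgue)"
      unfolding i1 i2 by (rule eq)
  qed auto
  also have "(\<integral>x. indicator ?A x * (\<phi> (x + h) - \<phi> x)\<^sup>2 \<partial>lebesgue) = (\<integral>x. (\<phi> (x + h) - \<phi> x)\<^sup>2 \<partial>lebesgue)"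
    using ind[of 1 0] by (intro Bochner_Integration.integral_cong) auto
  also have "(\<integral>x. indicator ?A x * (grad \<phi> x \<bullet> h)\<^sup>2 \<partial>lebesgue) \<le> (\<integral>x. (norm h)\<^sup>2 * (norm (grad \<phi> x))\<^sup>2 \<partial>lebesgue)"
  proof (rule integral_mono')
    show "integrable lebesgue (\<lambda>x. (norm h)\<^sup>2 * (norm (grad \<phi> x))\<^sup>2)"
      using L2_integrable[OF test_fun_grad_L2[OF \<phi>]] by auto
    fix x
    have "(grad \<phi> x \<bullet> h)\<^sup>2 \<le> (norm h)\<^sup>2 * (norm (grad \<phi> x))\<^sup>2"
      using Cauchy_Schwarz_ineq[of "grad \<phi> x" h] by (simp add: power2_norm_eq_inner mult.commute)
    then show "indicator ?A x * (grad \<phi> x \<bullet> h)\<^sup>2 \<le> (norm h)\<^sup>2 * (norm (grad \<phi> x))\<^sup>2"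
      by (auto simp: indicator_def)
  qed auto
  finally show ?thesis by simp
qed

lemma nn_integral_autocorrelation:
  fixes f :: "'a::euclidean_space \<Rightarrow> ennreal"
  assumes [measurable]: "f \<in> borel_measurable borel"
  shows "(\<integral>\<^sup>+h. \<integral>\<^sup>+x. f x * f (x + h) \<partial>lborel \<partial>lborel) = (\<integral>\<^sup>+x. f x \<partial>lborel)\<^sup>2"
proof -
  have shift: "(\<integral>\<^sup>+h. f (x + h) \<partial>lborel) = (\<integral>\<^sup>+h. f h \<partial>lborel)" for x
  proof -
    have "(\<integral>\<^sup>+h. f h \<partial>lborel) = (\<integral>\<^sup>+h. f h \<partial>distr lborel borel ((+) x))" by (simp add: lborel_distr_plus)
    also have "\<dots> = (\<integral>\<^sup>+h. f (x + h) \<partial>lborel)" by (rule nn_integral_distr) measurable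
    finally show ?thesis by simp
  qed
  have "(\<integral>\<^sup>+h. \<integral>\<^sup>+x. f x * f (x + h) \<partial>lborel \<partial>lborel) = (\<integral>\<^sup>+x. \<integral>\<^sup>+h. f x * f (x + h) \<partial>lborel \<partial>lborel)"
    by (rule lborel_pair.Fubini') measurable
  also have "\<dots> = (\<integral>\<^sup>+x. f x * (\<integral>\<^sup>+h. f (x + h) \<partial>lborel) \<partial>lborel)"
    by (intro nn_integral_cong nn_integral_cmult) measurable
  also have "\<dots> = (\<integral>\<^sup>+x. f x * (\<integral>\<^sup>+h. f h \<partial>lborel) \<partial>lborel)"
    by (simp only: shift)
  also have "\<dots> = (\<integral>\<^sup>+x. f x \<partial>lborel)\<^sup>2"
    by (subst nn_integral_multc) (auto simp: power2_eq_square)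
  finally show ?thesis .
qed

text \<open>Average \<open>\<integral>(\<phi>(x + h) - \<phi>(x))\<^sup>2 = 2 \<parallel>\<phi>\<parallel>\<^sup>2 - 2 \<integral>\<phi>(x) \<phi>(x + h)\<close> over \<open>h\<close> in the ball: by Fubini the
  correlation term contributes at most \<open>(\<integral>|\<phi>|)\<^sup>2 \<le> |\<Omega>| \<parallel>\<phi>\<parallel>\<^sup>2\<close>.\<close>
lemma poincare_test_fun:
  fixes \<Omega> :: "'a::euclidean_space set"
  assumes \<Omega>: "\<Omega> \<in> lmeasurable" and r: "0 < r" "2 * measure lebesgue \<Omega> \<le> measure lebesgue (ball (0::'a) r)"
    and \<phi>: "test_fun \<Omega> \<phi>"
  shows "(\<integral>x. (\<phi> x)\<^sup>2 \<partial>lebesgue) \<le> r\<^sup>2 * (\<integral>x. (norm (grad \<phi> x))\<^sup>2 \<partial>lebesgue)"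
proof -
  define N where "N = (\<integral>x. (\<phi> x)\<^sup>2 \<partial>lebesgue)"
  define D where "D = (\<integral>x. (norm (grad \<phi> x))\<^sup>2 \<partial>lebesgue)"
  define b where "b = measure lebesgue (ball (0::'a) r)"
  \<comment> \<open>Cut off at 0 because the averaging over \<open>h\<close> takes place in
    \<open>ennreal\<close>.\<close>
  define k where "k = max 0 (N - r\<^sup>2 * D / 2)"
  have b: "b > 0" using r by (simp add: b_def)
  have D0: "D \<ge> 0" by (simp add: D_def)
  have [measurable]: "\<phi> \<in> borel_measurable borel" by (rule test_fun_borel[OF \<phi>])
  have L: "L2 lebesgue \<phi>" by (rule test_fun_L2[OF \<phi>])
  have Lt: "L2 lebesgue (\<lambda>x. \<phi> (x + h))" for h
    using L lebesgue_integrable_translate[of "\<lambda>x. (\<phi> x)\<^sup>2" h]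
    by (auto simp: L2_def intro!: continuous_imp_lebesgue_measurable smooth_fun_continuous smooth_translate test_fun_smooth[OF \<phi>])
  have corr: "ennreal k \<le> (\<integral>\<^sup>+x. ennreal \<bar>\<phi> x\<bar> * ennreal \<bar>\<phi> (x + h)\<bar> \<partial>lborel)" if h: "h \<in> ball 0 r" for h
  proof -
    have i: "integrable lebesgue (\<lambda>x. \<phi> x * \<phi> (x + h))" using L2_inner[OF L Lt[of h]] by simp
    have "(\<integral>x. (\<phi> (x + h) - \<phi> x)\<^sup>2 \<partial>lebesgue) =
       (\<integral>x. (\<phi> (x + h))\<^sup>2 \<partial>lebesgue) - 2 * (\<integral>x. \<phi> x * \<phi> (x + h) \<partial>lebesgue) + N"
      using L2_norm_diff[OF Lt[of h] L] by (simp add: N_def mult.commute)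
    also have "(\<integral>x. (\<phi> (x + h))\<^sup>2 \<partial>lebesgue) = N"
      unfolding N_def by (rule lebesgue_integral_translate) measurable
    finally have "2 * N - 2 * (\<integral>x. \<phi> x * \<phi> (x + h) \<partial>lebesgue) \<le> (norm h)\<^sup>2 * D"
      using translation_test_fun_bound[OF \<phi>, of h] by (simp add: D_def)
    also have "\<dots> \<le> r\<^sup>2 * D" using h D0 by (intro mult_right_mono power_mono) auto
    finally have "N - r\<^sup>2 * D / 2 \<le> (\<integral>x. \<phi> x * \<phi> (x + h) \<partial>lebesgue)" by simp
    also have "\<dots> \<le> (\<integral>x. \<bar>\<phi> x\<bar> * \<bar>\<phi> (x + h)\<bar> \<partial>lebesgue)"
      using i by (intro integral_mono) (auto simp: abs_mult[symmetric])
    finally have k: "k \<le> (\<integral>x. \<bar>\<phi> x\<bar> * \<bar>\<phi> (x + h)\<bar> \<partial>lebesgue)" by (simp add: k_def)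
    have "(\<integral>\<^sup>+x. ennreal \<bar>\<phi> x\<bar> * ennreal \<bar>\<phi> (x + h)\<bar> \<partial>lborel) = (\<integral>\<^sup>+x. ennreal (\<bar>\<phi> x\<bar> * \<bar>\<phi> (x + h)\<bar>) \<partial>lebesgue)"
      by (simp add: nn_integral_completion ennreal_mult)
    also have "\<dots> = ennreal (\<integral>x. \<bar>\<phi> x\<bar> * \<bar>\<phi> (x + h)\<bar> \<partial>lebesgue)"
      using i by (intro nn_integral_eq_integral) (auto simp: abs_mult[symmetric])
    finally show ?thesis using k by (simp add: ennreal_leI)
  qed
  have "ennreal (k * b) = (\<integral>\<^sup>+h. ennreal k * indicator (ball (0::'a) r) h \<partial>lborel)"
  proof -
    have "emeasure lborel (ball (0::'a) r) = ennreal b"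
      using emeasure_bounded_finite[of "ball (0::'a) r"] unfolding b_def
      by (subst emeasure_eq_ennreal_measure) auto
    then show ?thesis using b by (simp add: nn_integral_cmult_indicator ennreal_mult k_def)
  qed
  also have "\<dots> \<le> (\<integral>\<^sup>+h. \<integral>\<^sup>+x. ennreal \<bar>\<phi> x\<bar> * ennreal \<bar>\<phi> (x + h)\<bar> \<partial>lborel \<partial>lborel)"
    using corr by (intro nn_integral_mono) (auto simp: indicator_def)
  also have "\<dots> = (\<integral>\<^sup>+x. ennreal \<bar>\<phi> x\<bar> \<partial>lborel)\<^sup>2"
    by (rule nn_integral_autocorrelation) measurable
  also have "(\<integral>\<^sup>+x. ennreal \<bar>\<phi> x\<bar> \<partial>lborel) = ennreal (\<integral>x. \<bar>\<phi> x\<bar> \<partial>lebesgue)"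
    unfolding nn_integral_completion[of lborel, symmetric]
    using test_fun_integrable[OF \<phi>] by (intro nn_integral_eq_integral) auto
  finally have "k * b \<le> (\<integral>x. \<bar>\<phi> x\<bar> \<partial>lebesgue)\<^sup>2"
    by (simp add: ennreal_power)
  also have "\<dots> \<le> measure lebesgue \<Omega> * N"
  proof -
    have "\<Omega> \<in> sets lebesgue" "emeasure lebesgue \<Omega> < \<infinity>" using \<Omega> by (auto simp: fmeasurable_def)
    from L2_supported_norm_integral[OF L this test_fun_zero[OF \<phi>]] show ?thesis by (simp add: N_def)
  qed
  \<comment> \<open>The size of the ball is chosen so that the correlation term eats at most half of
    \<open>N\<close>; the other half is then controlled by \<open>D\<close>.\<close>
  also have "\<dots> \<le> (b / 2) * N" using r(2) by (intro mult_right_mono) (auto simp: b_def N_def)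
  finally have "k \<le> N / 2" using b by (simp add: field_simps)
  moreover have "N - r\<^sup>2 * D / 2 \<le> k" by (simp add: k_def)
  ultimately have "N \<le> r\<^sup>2 * D" by linarith
  then show ?thesis by (simp add: N_def D_def)
qed

lemma poincare_constant_exists:
  fixes \<Omega> :: "'a::euclidean_space set"
  assumes "\<Omega> \<in> lmeasurable"
  obtains r where "0 < r" "\<And>\<phi>. test_fun \<Omega> \<phi> \<Longrightarrow>
     (\<integral>x. (\<phi> x)\<^sup>2 \<partial>lebesgue) \<le> r\<^sup>2 * (\<integral>x. (norm (grad \<phi> x))\<^sup>2 \<partial>lebesgue)"
proof -
  let ?v = "unit_ball_vol (real DIM('a))"
  have v: "?v > 0" by (rule unit_ball_vol_pos) simp
  \<comment> \<open>As \<open>r \<ge> 1\<close>, its power \<open>r ^ DIM('a)\<close> is at least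
    \<open>r\<close>, so a choice linear in the measure already makes the ball large enough.\<close>
  define r where "r = 1 + 2 * measure lebesgue \<Omega> / ?v"
  have r: "r \<ge> 1" using v by (simp add: r_def)
  have "2 * measure lebesgue \<Omega> \<le> ?v * r" using v less_imp_neq[OF v] by (simp add: r_def distrib_left)
  also have "\<dots> \<le> ?v * r ^ DIM('a)" using v r by (intro mult_left_mono self_le_power) auto
  also have "\<dots> = measure lebesgue (ball (0::'a) r)" using r by (simp add: content_ball)
  finally show thesis using that[of r] poincare_test_fun[OF assms, of r] r by auto
qed

section \<open>The space H01 and the torsion function\<close>

lemma H01_L2: "H01 \<Omega> u G \<Longrightarrow> L2 lebesgue u" and H01_grad_L2: "H01 \<Omega> u G \<Longrightarrow> L2 lebesgue G"
  by (auto simp: H01_def L2_def)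

lemma H01_seq:
  assumes "H01 \<Omega> u G"
  obtains \<phi> where "\<And>n. test_fun \<Omega> (\<phi> n)"
    "(\<lambda>n. \<integral>x. (norm (\<phi> n x - u x))\<^sup>2 \<partial>lebesgue) \<longlonglongrightarrow> 0"
    "(\<lambda>n. \<integral>x. (norm (grad (\<phi> n) x - G x))\<^sup>2 \<partial>lebesgue) \<longlonglongrightarrow> 0"
  using assms unfolding H01_def by auto

lemma H01I:
  assumes "L2 lebesgue u" "L2 lebesgue G" "\<And>n. test_fun \<Omega> (\<phi> n)"
    "(\<lambda>n. \<integral>x. (norm (\<phi> n x - u x))\<^sup>2 \<partial>lebesgue) \<longlonglongrightarrow> 0"
    "(\<lambda>n. \<integral>x. (norm (grad (\<phi> n) x - G x))\<^sup>2 \<partial>lebesgue) \<longlonglongrightarrow> 0"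
  shows "H01 \<Omega> u G"
  using assms unfolding H01_def L2_def by auto

lemma H01_test_fun: "test_fun \<Omega> \<phi> \<Longrightarrow> H01 \<Omega> \<phi> (grad \<phi>)"
  by (rule H01I[of _ _ _ "\<lambda>_. \<phi>"]) (auto intro: test_fun_L2 test_fun_grad_L2)

lemma H01_diff:
  assumes "H01 \<Omega> u G" "H01 \<Omega> w H"
  shows "H01 \<Omega> (\<lambda>x. u x - w x) (\<lambda>x. G x - H x)"
proof -
  obtain \<phi> where \<phi>: "\<And>n. test_fun \<Omega> (\<phi> n)"
    "(\<lambda>n. \<integral>x. (norm (\<phi> n x - u x))\<^sup>2 \<partial>lebesgue) \<longlonglongrightarrow> 0"
    "(\<lambda>n. \<integral>x. (norm (grad (\<phi> n) x - G x))\<^sup>2 \<partial>lebesgue) \<longlonglongrightarrow> 0" using H01_seq[OF assms(1)] by blast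
  obtain \<psi> where \<psi>: "\<And>n. test_fun \<Omega> (\<psi> n)"
    "(\<lambda>n. \<integral>x. (norm (\<psi> n x - w x))\<^sup>2 \<partial>lebesgue) \<longlonglongrightarrow> 0"
    "(\<lambda>n. \<integral>x. (norm (grad (\<psi> n) x - H x))\<^sup>2 \<partial>lebesgue) \<longlonglongrightarrow> 0" using H01_seq[OF assms(2)] by blast
  have *: "(\<lambda>n. \<integral>x. (norm ((f n x - g n x) - (f0 x - g0 x)))\<^sup>2 \<partial>lebesgue) \<longlonglongrightarrow> 0"
    if L: "\<And>n. L2 lebesgue (f n)" "L2 lebesgue f0" "\<And>n. L2 lebesgue (g n)" "L2 lebesgue g0"
    and lim: "(\<lambda>n. \<integral>x. (norm (f n x - f0 x))\<^sup>2 \<partial>lebesgue) \<longlonglongrightarrow> 0"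
     "(\<lambda>n. \<integral>x. (norm (g n x - g0 x))\<^sup>2 \<partial>lebesgue) \<longlonglongrightarrow> 0"
    for f g :: "nat \<Rightarrow> 'a \<Rightarrow> 'b::euclidean_space" and f0 g0
  proof (rule tendsto_sandwich[OF _ _ tendsto_const])
    have b: "(\<integral>x. (norm ((f n x - g n x) - (f0 x - g0 x)))\<^sup>2 \<partial>lebesgue)
       \<le> 2 * (\<integral>x. (norm (f n x - f0 x))\<^sup>2 \<partial>lebesgue) + 2 * (\<integral>x. (norm (g n x - g0 x))\<^sup>2 \<partial>lebesgue)" for n
      using L2_dist_triangle[OF L2_diff[OF L(1)[of n] L(2)] L2_scaleR[OF L(2), of 0] L2_diff[OF L(3)[of n] L(4)]]
      by (simp add: algebra_simps norm_minus_commute)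
    show "\<forall>\<^sub>F n in sequentially. (\<integral>x. (norm ((f n x - g n x) - (f0 x - g0 x)))\<^sup>2 \<partial>lebesgue)
       \<le> 2 * (\<integral>x. (norm (f n x - f0 x))\<^sup>2 \<partial>lebesgue) + 2 * (\<integral>x. (norm (g n x - g0 x))\<^sup>2 \<partial>lebesgue)"
      using b by simp
    show "(\<lambda>n. 2 * (\<integral>x. (norm (f n x - f0 x))\<^sup>2 \<partial>lebesgue) + 2 * (\<integral>x. (norm (g n x - g0 x))\<^sup>2 \<partial>lebesgue)) \<longlonglongrightarrow> 0"
      using tendsto_add[OF tendsto_mult_right_zero[OF lim(1), of 2] tendsto_mult_right_zero[OF lim(2), of 2]] by simp
  qed auto
  show ?thesis
  proof (rule H01I[of _ _ _ "\<lambda>n x. \<phi> n x - \<psi> n x"])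
    show "(\<lambda>n. \<integral>x. (norm (grad (\<lambda>x. \<phi> n x - \<psi> n x) x - (G x - H x)))\<^sup>2 \<partial>lebesgue) \<longlonglongrightarrow> 0"
      unfolding grad_test_diff[OF \<phi>(1) \<psi>(1)]
      by (rule *[OF _ H01_grad_L2[OF assms(1)] _ H01_grad_L2[OF assms(2)] \<phi>(3) \<psi>(3)])
        (auto intro: test_fun_grad_L2[OF \<phi>(1)] test_fun_grad_L2[OF \<psi>(1)])
    show "(\<lambda>n. \<integral>x. (norm ((\<phi> n x - \<psi> n x) - (u x - w x)))\<^sup>2 \<partial>lebesgue) \<longlonglongrightarrow> 0"
      by (rule *[OF _ H01_L2[OF assms(1)] _ H01_L2[OF assms(2)] \<phi>(2) \<psi>(2)])
        (auto intro: test_fun_L2[OF \<phi>(1)] test_fun_L2[OF \<psi>(1)])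
  qed (auto intro!: L2_diff test_fun_diff \<phi>(1) \<psi>(1) H01_L2[OF assms(1)] H01_L2[OF assms(2)]
       H01_grad_L2[OF assms(1)] H01_grad_L2[OF assms(2)])
qed

text \<open>Both integrals are continuous along the approximating sequence, so Rayleigh bounds need
  to be checked on test functions alone.\<close>

lemma H01_rayleigh:
  assumes H: "H01 \<Omega> u G"
    and c: "\<And>\<phi>. test_fun \<Omega> \<phi> \<Longrightarrow> c * (\<integral>x. (\<phi> x)\<^sup>2 \<partial>lebesgue) \<le> (\<integral>x. (norm (grad \<phi> x))\<^sup>2 \<partial>lebesgue)"
  shows "c * (\<integral>x. (u x)\<^sup>2 \<partial>lebesgue) \<le> (\<integral>x. (norm (G x))\<^sup>2 \<partial>lebesgue)"
proof -
  obtain \<phi> where \<phi>: "\<And>n. test_fun \<Omega> (\<phi> n)"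
    "(\<lambda>n. \<integral>x. (norm (\<phi> n x - u x))\<^sup>2 \<partial>lebesgue) \<longlonglongrightarrow> 0"
    "(\<lambda>n. \<integral>x. (norm (grad (\<phi> n) x - G x))\<^sup>2 \<partial>lebesgue) \<longlonglongrightarrow> 0" using H01_seq[OF H] by blast
  have "(\<lambda>n. \<integral>x. (norm (\<phi> n x))\<^sup>2 \<partial>lebesgue) \<longlonglongrightarrow> (\<integral>x. (norm (u x))\<^sup>2 \<partial>lebesgue)"
    by (rule L2_norm_tendsto[OF test_fun_L2[OF \<phi>(1)] H01_L2[OF H] \<phi>(2)])
  then have 1: "(\<lambda>n. c * (\<integral>x. (\<phi> n x)\<^sup>2 \<partial>lebesgue)) \<longlonglongrightarrow> c * (\<integral>x. (u x)\<^sup>2 \<partial>lebesgue)"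
    by (intro tendsto_mult_left) simp
  have 2: "(\<lambda>n. \<integral>x. (norm (grad (\<phi> n) x))\<^sup>2 \<partial>lebesgue) \<longlonglongrightarrow> (\<integral>x. (norm (G x))\<^sup>2 \<partial>lebesgue)"
    by (rule L2_norm_tendsto[OF test_fun_grad_L2[OF \<phi>(1)] H01_grad_L2[OF H] \<phi>(3)])
  show ?thesis by (rule LIMSEQ_le[OF 1 2]) (use c \<phi>(1) in auto)
qed

lemma H01_zero_grad:
  assumes H: "H01 \<Omega> u G" and \<Omega>: "\<Omega> \<in> lmeasurable" and G: "(\<integral>x. (norm (G x))\<^sup>2 \<partial>lebesgue) = 0"
  shows "AE x in lebesgue. u x = 0"
proof -
  obtain r where r: "0 < r" "\<And>\<phi>. test_fun \<Omega> \<phi> \<Longrightarrow>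
     (\<integral>x. (\<phi> x)\<^sup>2 \<partial>lebesgue) \<le> r\<^sup>2 * (\<integral>x. (norm (grad \<phi> x))\<^sup>2 \<partial>lebesgue)"
    using poincare_constant_exists[OF \<Omega>] by blast
  have "(1 / r\<^sup>2) * (\<integral>x. (u x)\<^sup>2 \<partial>lebesgue) \<le> (\<integral>x. (norm (G x))\<^sup>2 \<partial>lebesgue)"
    using H01_rayleigh[OF H, of "1 / r\<^sup>2"] r by (simp add: field_simps)
  then have "(\<integral>x. (u x)\<^sup>2 \<partial>lebesgue) \<le> 0" using G r(1) by (simp add: divide_le_0_iff)
  then have "(\<integral>x. (u x)\<^sup>2 \<partial>lebesgue) = 0" by (simp add: antisym)
  then have "AE x in lebesgue. (u x)\<^sup>2 = 0"
    using integral_nonneg_eq_0_iff_AE[OF L2_integrable_real[OF H01_L2[OF H]]] by auto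
  then show ?thesis by simp
qed

text \<open>The integral of a test function is its L2 pairing with
  \<open>indicator \<Omega>\<close>, which is in L2 by finite measure; both sides of the weak
  equation therefore extend to the closure, and the indicator remains visible. \<open>c = 1\<close>
  gives the energy identity, \<open>c = 0\<close> uniqueness.\<close>

lemma H01_weak_pairing:
  assumes H: "H01 \<Omega> u G" and \<Omega>: "\<Omega> \<in> lmeasurable" and F: "L2 lebesgue F"
    and weak: "\<And>\<phi>. test_fun \<Omega> \<phi> \<Longrightarrow> (\<integral>x. F x \<bullet> grad \<phi> x \<partial>lebesgue) = c * (\<integral>x. \<phi> x \<partial>lebesgue)"
  shows "(\<integral>x. F x \<bullet> G x \<partial>lebesgue) = c * (\<integral>x. indicator \<Omega> x * u x \<partial>lebesgue)"
proof -
  obtain \<phi> where \<phi>: "\<And>n. test_fun \<Omega> (\<phi> n)"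
    "(\<lambda>n. \<integral>x. (norm (\<phi> n x - u x))\<^sup>2 \<partial>lebesgue) \<longlonglongrightarrow> 0"
    "(\<lambda>n. \<integral>x. (norm (grad (\<phi> n) x - G x))\<^sup>2 \<partial>lebesgue) \<longlonglongrightarrow> 0" using H01_seq[OF H] by blast
  have 1: "(\<lambda>n. \<integral>x. F x \<bullet> grad (\<phi> n) x \<partial>lebesgue) \<longlonglongrightarrow> (\<integral>x. F x \<bullet> G x \<partial>lebesgue)"
    by (rule L2_inner_tendsto[OF F F test_fun_grad_L2[OF \<phi>(1)] H01_grad_L2[OF H] _ \<phi>(3)]) simp
  have I: "L2 lebesgue (indicator \<Omega> :: 'a \<Rightarrow> real)" using \<Omega> by (intro L2_indicator) (auto simp: fmeasurable_def)
  have "(\<lambda>n. \<integral>x. indicator \<Omega> x \<bullet> \<phi> n x \<partial>lebesgue) \<longlonglongrightarrow> (\<integral>x. indicator \<Omega> x \<bullet> u x \<partial>lebesgue)"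
    by (rule L2_inner_tendsto[OF I I test_fun_L2[OF \<phi>(1)] H01_L2[OF H] _ \<phi>(2)]) simp
  moreover have "indicator \<Omega> x \<bullet> \<phi> n x = \<phi> n x" for n x
    using test_fun_zero[OF \<phi>(1)] by (auto simp: indicator_def)
  ultimately have "(\<lambda>n. \<integral>x. \<phi> n x \<partial>lebesgue) \<longlonglongrightarrow> (\<integral>x. indicator \<Omega> x * u x \<partial>lebesgue)"
    by (simp only: inner_real_def)
  then have "(\<lambda>n. c * (\<integral>x. \<phi> n x \<partial>lebesgue)) \<longlonglongrightarrow> c * (\<integral>x. indicator \<Omega> x * u x \<partial>lebesgue)"
    by (rule tendsto_mult_left)
  then show ?thesis using 1 weak[OF \<phi>(1)] LIMSEQ_unique by auto
qed

section \<open>Uniqueness and existence of the torsion function\<close>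

text \<open>The gradient of the difference is orthogonal to all test gradients, hence to itself, and
  Poincare finishes. As \<open>torsion\<close> picks an arbitrary solution, this is what identifies
  it with the explicit one on the ball.\<close>

lemma is_torsion_AE_unique:
  assumes \<Omega>: "\<Omega> \<in> lmeasurable" and "is_torsion \<Omega> v" "is_torsion \<Omega> w"
  shows "AE x in lebesgue. v x = w x"
proof -
  obtain G where G: "H01 \<Omega> v G" "\<And>\<phi>. test_fun \<Omega> \<phi> \<Longrightarrow> (\<integral>x. G x \<bullet> grad \<phi> x \<partial>lebesgue) = (\<integral>x. \<phi> x \<partial>lebesgue)"
    using assms(2) by (auto simp: is_torsion_def)
  obtain H where H: "H01 \<Omega> w H" "\<And>\<phi>. test_fun \<Omega> \<phi> \<Longrightarrow> (\<integral>x. H x \<bullet> grad \<phi> x \<partial>lebesgue) = (\<integral>x. \<phi> x \<partial>lebesgue)"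
    using assms(3) by (auto simp: is_torsion_def)
  have d: "H01 \<Omega> (\<lambda>x. v x - w x) (\<lambda>x. G x - H x)" by (rule H01_diff[OF G(1) H(1)])
  have "(\<integral>x. (G x - H x) \<bullet> (G x - H x) \<partial>lebesgue) = 0 * (\<integral>x. indicator \<Omega> x * (v x - w x) \<partial>lebesgue)"
  proof (rule H01_weak_pairing[OF d \<Omega> H01_grad_L2[OF d]])
    fix \<phi> assume t: "test_fun \<Omega> \<phi>"
    show "(\<integral>x. (G x - H x) \<bullet> grad \<phi> x \<partial>lebesgue) = 0 * (\<integral>x. \<phi> x \<partial>lebesgue)"
      using L2_inner[OF H01_grad_L2[OF G(1)] test_fun_grad_L2[OF t]] L2_inner[OF H01_grad_L2[OF H(1)] test_fun_grad_L2[OF t]]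
        G(2)[OF t] H(2)[OF t] by (simp add: inner_diff_left)
  qed
  then have "AE x in lebesgue. v x - w x = 0"
    by (intro H01_zero_grad[OF d \<Omega>]) (simp add: power2_norm_eq_inner)
  then show ?thesis by simp
qed

text \<open>Direct method for \<open>J \<phi> = D \<phi> - 2 * \<integral>\<phi>\<close> on test
  functions. \<open>J\<close> is bounded below by Poincare; the parallelogram identity makes any
  minimizing sequence Cauchy in energy, and Poincare again makes it Cauchy in L2. Completeness gives
  the limit without weak compactness.\<close>

lemma torsion_exists:
  fixes \<Omega> :: "'a::euclidean_space set"
  assumes \<Omega>: "\<Omega> \<in> lmeasurable"
  shows "\<exists>v. is_torsion \<Omega> v"
proof -
  obtain r where r: "0 < r" "\<And>\<phi>. test_fun \<Omega> \<phi> \<Longrightarrow>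
     (\<integral>x. (\<phi> x)\<^sup>2 \<partial>lebesgue) \<le> r\<^sup>2 * (\<integral>x. (norm (grad \<phi> x))\<^sup>2 \<partial>lebesgue)"
    using poincare_constant_exists[OF \<Omega>] by blast
  have sm: "\<Omega> \<in> sets lebesgue" "emeasure lebesgue \<Omega> < \<infinity>" using \<Omega> by (auto simp: fmeasurable_def)
  define D where "D \<phi> = (\<integral>x. (norm (grad \<phi> x))\<^sup>2 \<partial>lebesgue)" for \<phi> :: "'a \<Rightarrow> real"
  define J where "J \<phi> = D \<phi> - 2 * (\<integral>x. \<phi> x \<partial>lebesgue)" for \<phi> :: "'a \<Rightarrow> real"
  have D0: "D \<phi> \<ge> 0" for \<phi> by (simp add: D_def)
  have lower: "J \<phi> \<ge> - measure lebesgue \<Omega> * r\<^sup>2" if t: "test_fun \<Omega> \<phi>" for \<phi>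
  proof -
    let ?i = "\<integral>x. \<phi> x \<partial>lebesgue" and ?M = "measure lebesgue \<Omega> * r\<^sup>2"
    have "\<bar>?i\<bar> \<le> (\<integral>x. norm (\<phi> x) \<partial>lebesgue)" using integral_norm_bound[of lebesgue \<phi>] by simp
    then have "?i\<^sup>2 \<le> (\<integral>x. norm (\<phi> x) \<partial>lebesgue)\<^sup>2" by (simp add: abs_le_square_iff[symmetric])
    also have "\<dots> \<le> measure lebesgue \<Omega> * (\<integral>x. (norm (\<phi> x))\<^sup>2 \<partial>lebesgue)"
      by (rule L2_supported_norm_integral[OF test_fun_L2[OF t] sm]) (rule test_fun_zero[OF t])
    also have "\<dots> \<le> measure lebesgue \<Omega> * (r\<^sup>2 * D \<phi>)"
      using r(2)[OF t] by (intro mult_left_mono) (auto simp: D_def)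
    finally have i: "?i\<^sup>2 \<le> ?M * D \<phi>" by (simp add: mult.assoc)
    \<comment> \<open>Arithmetic-geometric mean: the square of \<open>?i\<close> is at most
      \<open>?M * D \<phi>\<close>, and the contrary would make
      \<open>(D \<phi> - ?M)\<^sup>2\<close> negative.\<close>
    have "2 * ?i \<le> D \<phi> + ?M"
    proof (rule ccontr)
      assume "\<not> ?thesis"
      moreover have "0 \<le> D \<phi> + ?M" using D0 by simp
      ultimately have "(D \<phi> + ?M)\<^sup>2 < (2 * ?i)\<^sup>2" by (intro power_strict_mono) auto
      also have "\<dots> \<le> 4 * (?M * D \<phi>)" using i by (simp add: power_mult_distrib)
      finally have "(D \<phi> - ?M)\<^sup>2 < 0" by (simp add: power2_eq_square algebra_simps)
      then show False by simp
    qed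
    then show ?thesis by (simp add: J_def)
  qed
  define I where "I = Inf (J ` {\<phi>. test_fun \<Omega> \<phi>})"
  have bdd: "bdd_below (J ` {\<phi>. test_fun \<Omega> \<phi>})"
    using lower by (intro bdd_belowI2[of _ "- measure lebesgue \<Omega> * r\<^sup>2"]) auto
  have t0: "test_fun \<Omega> (\<lambda>x. 0)" by (rule test_funI[of _ "{}"]) (auto intro: smooth_intros)
  have Ile: "I \<le> J \<phi>" if "test_fun \<Omega> \<phi>" for \<phi>
    unfolding I_def using that bdd by (intro cInf_lower) auto
  have "\<exists>\<phi>. test_fun \<Omega> \<phi> \<and> J \<phi> < I + 1 / real (Suc n)" for n
    using cInf_lessD[of "J ` {\<phi>. test_fun \<Omega> \<phi>}" "I + 1 / real (Suc n)"] t0 unfolding I_def by fastforce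
  then obtain \<phi> where \<phi>: "\<And>n. test_fun \<Omega> (\<phi> n)" and J\<phi>: "\<And>n. J (\<phi> n) < I + 1 / real (Suc n)" by metis
  have JI: "(\<lambda>n. J (\<phi> n)) \<longlonglongrightarrow> I"
  proof (rule tendsto_sandwich[OF _ _ tendsto_const])
    show "(\<lambda>n. I + 1 / real (Suc n)) \<longlonglongrightarrow> I"
      using tendsto_add[OF tendsto_const LIMSEQ_inverse_real_of_nat, of I] by (simp add: inverse_eq_divide)
  qed (use J\<phi> Ile \<phi> in \<open>auto intro!: always_eventually less_imp_le simp del: of_nat_Suc\<close>)
  \<comment> \<open>The midpoint of two almost minimizers costs at least \<open>I\<close>, so the
    parallelogram identity bounds the energy of their difference by the two excesses; the linear
    part of \<open>J\<close> drops out.\<close>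
  have para: "D (\<lambda>x. \<phi> i x - \<phi> j x) \<le> 2 * (J (\<phi> i) - I) + 2 * (J (\<phi> j) - I)" for i j
  proof -
    let ?m = "\<lambda>x. (1/2) * (\<phi> i x + \<phi> j x)"
    have tm: "test_fun \<Omega> ?m" by (intro test_fun_cmult test_fun_add \<phi>)
    note L = test_fun_grad_L2[OF \<phi>]
    have gm: "grad ?m x = (1/2) *\<^sub>R (grad (\<phi> i) x + grad (\<phi> j) x)" for x
      using grad_test_cmult[OF test_fun_add[OF \<phi>[of i] \<phi>[of j]], of "1/2"] grad_test_add[OF \<phi>[of i] \<phi>[of j]] by simp
    have 1: "4 * D ?m = D (\<phi> i) + 2 * (\<integral>x. grad (\<phi> i) x \<bullet> grad (\<phi> j) x \<partial>lebesgue) + D (\<phi> j)"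
      using L2_expand[OF L[of i] L[of j], of 1] unfolding D_def gm by (simp add: power_divide)
    have 2: "D (\<lambda>x. \<phi> i x - \<phi> j x) = D (\<phi> i) - 2 * (\<integral>x. grad (\<phi> i) x \<bullet> grad (\<phi> j) x \<partial>lebesgue) + D (\<phi> j)"
      using L2_norm_diff[OF L[of i] L[of j]] unfolding D_def grad_test_diff[OF \<phi>[of i] \<phi>[of j]] by simp
    have "(\<integral>x. ?m x \<partial>lebesgue) = (1/2) * ((\<integral>x. \<phi> i x \<partial>lebesgue) + (\<integral>x. \<phi> j x \<partial>lebesgue))"
      using test_fun_integrable[OF \<phi>] by (simp add: integral_add add_divide_distrib)
    moreover have "4 * (Dm - 2 * m) + Dd = 2 * (Di - 2 * a) + 2 * (Dj - 2 * b)"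
      if "m = (1/2) * (a + b)" "4 * Dm = Di + 2 * c + Dj" "Dd = Di - 2 * c + Dj"
      for m a b c Dm Di Dj Dd :: real using that by simp
    ultimately have "4 * J ?m + D (\<lambda>x. \<phi> i x - \<phi> j x) = 2 * J (\<phi> i) + 2 * J (\<phi> j)"
      unfolding J_def using 1 2 by blast
    then show ?thesis using Ile[OF tm] by simp
  qed
  have DC: "\<exists>N. \<forall>i\<ge>N. \<forall>j\<ge>N. D (\<lambda>x. \<phi> i x - \<phi> j x) < e" if e: "e > 0" for e
  proof -
    have "\<forall>\<^sub>F n in sequentially. J (\<phi> n) < I + e / 4" using JI e by (intro order_tendstoD(2)[OF JI]) simp
    then obtain N where N: "\<And>n. n \<ge> N \<Longrightarrow> J (\<phi> n) < I + e / 4" by (auto simp: eventually_sequentially)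
    have "D (\<lambda>x. \<phi> i x - \<phi> j x) < e" if "i \<ge> N" "j \<ge> N" for i j
      using para[of i j] N[OF that(1)] N[OF that(2)] by argo
    then show ?thesis by blast
  qed
  have LC: "\<exists>N. \<forall>i\<ge>N. \<forall>j\<ge>N. (\<integral>x. (norm (\<phi> i x - \<phi> j x))\<^sup>2 \<partial>lebesgue) < e" if e: "e > 0" for e
  proof -
    obtain N where N: "\<forall>i\<ge>N. \<forall>j\<ge>N. D (\<lambda>x. \<phi> i x - \<phi> j x) < e / r\<^sup>2" using DC[of "e / r\<^sup>2"] e r(1) by auto
    have "(\<integral>x. (norm (\<phi> i x - \<phi> j x))\<^sup>2 \<partial>lebesgue) < e" if "i \<ge> N" "j \<ge> N" for i j
    proof -
      have "(\<integral>x. (\<phi> i x - \<phi> j x)\<^sup>2 \<partial>lebesgue) \<le> r\<^sup>2 * D (\<lambda>x. \<phi> i x - \<phi> j x)"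
        unfolding D_def by (rule r(2)[OF test_fun_diff[OF \<phi> \<phi>]])
      also have "\<dots> < r\<^sup>2 * (e / r\<^sup>2)" using N that r(1) by (intro mult_strict_left_mono) auto
      finally show ?thesis using r(1) by simp
    qed
    then show ?thesis by blast
  qed
  obtain u where u: "L2 lebesgue u" "(\<lambda>n. \<integral>x. (norm (\<phi> n x - u x))\<^sup>2 \<partial>lebesgue) \<longlonglongrightarrow> 0"
    using L2_complete_supported[of lebesgue \<phi>, OF test_fun_L2[OF \<phi>] sm test_fun_zero[OF \<phi>] LC] by blast
  obtain G where G: "L2 lebesgue G" "(\<lambda>n. \<integral>x. (norm (grad (\<phi> n) x - G x))\<^sup>2 \<partial>lebesgue) \<longlonglongrightarrow> 0"
    using L2_complete_supported[of lebesgue "\<lambda>n. grad (\<phi> n)", OF test_fun_grad_L2[OF \<phi>] sm test_fun_grad_zero[OF \<phi>]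
      DC[unfolded D_def grad_test_diff[OF \<phi> \<phi>]]] by blast
  have H: "H01 \<Omega> u G" by (rule H01I[OF u(1) G(1) \<phi> u(2) G(2)])
  have "(\<integral>x. G x \<bullet> grad \<psi> x \<partial>lebesgue) = (\<integral>x. \<psi> x \<partial>lebesgue)" if \<psi>: "test_fun \<Omega> \<psi>" for \<psi>
  proof -
    let ?a = "(\<integral>x. G x \<bullet> grad \<psi> x \<partial>lebesgue) - (\<integral>x. \<psi> x \<partial>lebesgue)"
    have lim: "(\<lambda>n. \<integral>x. grad (\<phi> n) x \<bullet> grad \<psi> x \<partial>lebesgue) \<longlonglongrightarrow> (\<integral>x. G x \<bullet> grad \<psi> x \<partial>lebesgue)"
      by (rule L2_inner_tendsto[OF test_fun_grad_L2[OF \<phi>] G(1) test_fun_grad_L2[OF \<psi>] test_fun_grad_L2[OF \<psi>] G(2)]) simp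
    \<comment> \<open>Minimality along the line through \<open>\<phi> n\<close> in direction \<psi>,
      in the limit. A quadratic without constant term that is nonnegative for all \<open>t\<close>
      has no linear term.\<close>
    have pos: "0 \<le> 0 + 2 * t * ?a + t\<^sup>2 * D \<psi>" for t
    proof -
      have 1: "I \<le> J (\<phi> n) + 2 * t * ((\<integral>x. grad (\<phi> n) x \<bullet> grad \<psi> x \<partial>lebesgue) - (\<integral>x. \<psi> x \<partial>lebesgue)) + t\<^sup>2 * D \<psi>" for n
      proof -
        let ?p = "\<lambda>x. \<phi> n x + t * \<psi> x"
        have tp: "test_fun \<Omega> ?p" by (intro test_fun_cmult test_fun_add \<phi> \<psi>)
        have gp: "grad ?p x = grad (\<phi> n) x + t *\<^sub>R grad \<psi> x" for x
          using grad_test_add[OF \<phi>[of n] test_fun_cmult[OF \<psi>, of t]] grad_test_cmult[OF \<psi>, of t] by simp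
        have "J ?p = J (\<phi> n) + 2 * t * ((\<integral>x. grad (\<phi> n) x \<bullet> grad \<psi> x \<partial>lebesgue) - (\<integral>x. \<psi> x \<partial>lebesgue)) + t\<^sup>2 * D \<psi>"
          using L2_expand[OF test_fun_grad_L2[OF \<phi>[of n]] test_fun_grad_L2[OF \<psi>], of t]
            test_fun_integrable[OF \<phi>[of n]] test_fun_integrable[OF \<psi>]
          unfolding J_def D_def gp by (simp add: algebra_simps)
        then show ?thesis using Ile[OF tp] by simp
      qed
      have "(\<lambda>n. J (\<phi> n) + 2 * t * ((\<integral>x. grad (\<phi> n) x \<bullet> grad \<psi> x \<partial>lebesgue) - (\<integral>x. \<psi> x \<partial>lebesgue)) + t\<^sup>2 * D \<psi>)
        \<longlonglongrightarrow> I + 2 * t * ?a + t\<^sup>2 * D \<psi>"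
        by (intro tendsto_intros JI lim)
      from LIMSEQ_le_const[OF this, of I] 1 show ?thesis by simp
    qed
    have "?a\<^sup>2 \<le> 0 * D \<psi>" by (rule quadratic_nonneg_discriminant[OF pos D0])
    then show ?thesis by simp
  qed
  with H show ?thesis by (auto simp: is_torsion_def)
qed

lemma is_torsion_torsion: "\<Omega> \<in> lmeasurable \<Longrightarrow> is_torsion \<Omega> (torsion \<Omega>)"
  unfolding torsion_def by (rule someI_ex[OF torsion_exists])

lemma torsion_energy:
  assumes \<Omega>: "\<Omega> \<in> lmeasurable" and H: "H01 \<Omega> v G"
    and weak: "\<And>\<phi>. test_fun \<Omega> \<phi> \<Longrightarrow> (\<integral>x. G x \<bullet> grad \<phi> x \<partial>lebesgue) = (\<integral>x. \<phi> x \<partial>lebesgue)"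
  shows "(\<integral>x. (norm (G x))\<^sup>2 \<partial>lebesgue) = (\<integral>x. indicator \<Omega> x * v x \<partial>lebesgue)"
  using H01_weak_pairing[OF H \<Omega> H01_grad_L2[OF H], of 1] weak by (simp add: power2_norm_eq_inner)

text \<open>Variational lower bound for the torsional rigidity: test the equation with
  \<open>U\<close>, apply Cauchy-Schwarz, and replace the energy of \<open>v\<close> by its
  integral.\<close>

lemma torsion_integral_ge:
  assumes \<Omega>: "\<Omega> \<in> lmeasurable" and v: "is_torsion \<Omega> v" and U: "test_fun \<Omega> U"
  shows "(\<integral>x. U x \<partial>lebesgue)\<^sup>2 \<le> (\<integral>x. indicator \<Omega> x * v x \<partial>lebesgue) * (\<integral>x. (norm (grad U x))\<^sup>2 \<partial>lebesgue)"
proof -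
  obtain G where G: "H01 \<Omega> v G" "\<And>\<phi>. test_fun \<Omega> \<phi> \<Longrightarrow> (\<integral>x. G x \<bullet> grad \<phi> x \<partial>lebesgue) = (\<integral>x. \<phi> x \<partial>lebesgue)"
    using v by (auto simp: is_torsion_def)
  show ?thesis
    using L2_Cauchy_Schwarz[OF H01_grad_L2[OF G(1)] test_fun_grad_L2[OF U]] G(2)[OF U] torsion_energy[OF \<Omega> G] by simp
qed

section \<open>The first eigenvalue\<close>

lemma lambda1_le:
  assumes "H01 \<Omega> u G"
  shows "lambda1 \<Omega> * (\<integral>x. (u x)\<^sup>2 \<partial>lebesgue) \<le> (\<integral>x. (norm (G x))\<^sup>2 \<partial>lebesgue)"
proof (cases "(\<integral>x. (u x)\<^sup>2 \<partial>lebesgue) = 0")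
  case False
  then have pos: "(\<integral>x. (u x)\<^sup>2 \<partial>lebesgue) > 0" by (simp add: less_le)
  have "lambda1 \<Omega> \<le> (\<integral>x. (norm (G x))\<^sup>2 \<partial>lebesgue) / (\<integral>x. (u x)\<^sup>2 \<partial>lebesgue)"
    unfolding lambda1_def
    by (rule cInf_lower) (use assms False in \<open>auto intro!: bdd_belowI[of _ 0] divide_nonneg_nonneg\<close>)
  then show ?thesis using pos by (simp add: field_simps)
qed simp

text \<open>The function \<open>\<phi>0\<close> keeps the set of Rayleigh quotients non-empty, so
  that its infimum as a real number is meaningful.\<close>

lemma lambda1_ge:
  assumes "test_fun \<Omega> \<phi>0" "(\<integral>x. (\<phi>0 x)\<^sup>2 \<partial>lebesgue) \<noteq> 0"
    and c: "\<And>\<phi>. test_fun \<Omega> \<phi> \<Longrightarrow> c * (\<integral>x. (\<phi> x)\<^sup>2 \<partial>lebesgue) \<le> (\<integral>x. (norm (grad \<phi> x))\<^sup>2 \<partial>lebesgue)"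
  shows "c \<le> lambda1 \<Omega>"
  unfolding lambda1_def
proof (rule cInf_greatest)
  show "{(\<integral>x. (norm (G x))\<^sup>2 \<partial>lebesgue) / (\<integral>x. (u x)\<^sup>2 \<partial>lebesgue) | u G.
                      H01 \<Omega> u G \<and> (\<integral>x. (u x)\<^sup>2 \<partial>lebesgue) \<noteq> 0} \<noteq> {}"
    using H01_test_fun[OF assms(1)] assms(2) by auto
  fix q assume "q \<in> {(\<integral>x. (norm (G x))\<^sup>2 \<partial>lebesgue) / (\<integral>x. (u x)\<^sup>2 \<partial>lebesgue) | u G.
                      H01 \<Omega> u G \<and> (\<integral>x. (u x)\<^sup>2 \<partial>lebesgue) \<noteq> 0}"
  then obtain u G where q: "q = (\<integral>x. (norm (G x))\<^sup>2 \<partial>lebesgue) / (\<integral>x. (u x)\<^sup>2 \<partial>lebesgue)"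
    "H01 \<Omega> u G" "(\<integral>x. (u x)\<^sup>2 \<partial>lebesgue) \<noteq> 0" by blast
  then have "(\<integral>x. (u x)\<^sup>2 \<partial>lebesgue) > 0" by (simp add: less_le)
  then show "c \<le> q" using H01_rayleigh[OF q(2) c] q(1) by (simp add: le_divide_eq)
qed

section \<open>Pointwise bounds for the torsion function\<close>

lemma test_fun_integral_partial:
  assumes "test_fun \<Omega> f"
  shows "(\<integral>x. grad f x \<bullet> h \<partial>lebesgue) = 0"
proof -
  obtain C where C: "\<And>x. norm (grad f x) \<le> C" using test_fun_grad_bounded[OF assms] by blast
  have "\<bar>grad f x \<bullet> h\<bar> \<le> C * norm h" for x
    using Cauchy_Schwarz_ineq2[of "grad f x" h] C[of x] mult_right_mono[of "norm (grad f x)" C "norm h"] by fastforce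
  then show ?thesis
    using integral_directional_derivative_eq_0[of f "\<lambda>x h. grad f x \<bullet> h" h "C * norm h" "tsupport f"]
      smooth_fun_grad[OF test_fun_smooth[OF assms]] test_fun_compact[OF assms] not_tsupport[of _ f] by blast
qed

text \<open>Partial derivatives of \<open>(x \<bullet> b) * \<phi> x\<close> integrate to 0; sum
  over the basis. In weak form this says that -|x|^2 / 2m has Laplacian -1, the fact behind both the
  comparison paraboloid and the solution on the ball.\<close>

lemma test_fun_euler_identity:
  fixes \<phi> :: "'a::euclidean_space \<Rightarrow> real"
  assumes \<phi>: "test_fun \<Omega> \<phi>"
  shows "(\<integral>x. x \<bullet> grad \<phi> x \<partial>lebesgue) = - real DIM('a) * (\<integral>x. \<phi> x \<partial>lebesgue)"
    and "integrable lebesgue (\<lambda>x. x \<bullet> grad \<phi> x)"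
proof -
  have ib: "integrable lebesgue (\<lambda>x. (x \<bullet> b) * (grad \<phi> x \<bullet> b))" for b
    by (rule test_fun_integrable_comp[OF \<phi>, of "\<lambda>u g x. (x \<bullet> b) * (g \<bullet> b)"])
      (auto intro!: continuous_intros test_fun_grad_continuous[OF \<phi>])
  have eq: "x \<bullet> grad \<phi> x = (\<Sum>b\<in>Basis. (x \<bullet> b) * (grad \<phi> x \<bullet> b))" for x
    by (rule euclidean_inner)
  show "integrable lebesgue (\<lambda>x. x \<bullet> grad \<phi> x)"
    unfolding eq by (intro Bochner_Integration.integrable_sum ib)
  have "(\<integral>x. (x \<bullet> b) * (grad \<phi> x \<bullet> b) \<partial>lebesgue) = - (\<integral>x. \<phi> x \<partial>lebesgue)" if b: "b \<in> Basis" for b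
  proof -
    have t: "test_fun \<Omega> (\<lambda>x. (x \<bullet> b) * \<phi> x)"
      by (rule test_fun_supported[OF \<phi>]) (auto intro!: smooth_mult smooth_inner test_fun_smooth[OF \<phi>])
    have "grad (\<lambda>x. (x \<bullet> b) * \<phi> x) x = (x \<bullet> b) *\<^sub>R grad \<phi> x + \<phi> x *\<^sub>R b" for x
      by (subst grad_mult) (auto intro: test_fun_differentiable[OF \<phi>] smooth_fun_differentiable smooth_inner simp: grad_inner)
    then have "0 = (\<integral>x. (x \<bullet> b) * (grad \<phi> x \<bullet> b) + \<phi> x \<partial>lebesgue)"
      using test_fun_integral_partial[OF t, of b] b by (simp add: inner_add_left)
    also have "\<dots> = (\<integral>x. (x \<bullet> b) * (grad \<phi> x \<bullet> b) \<partial>lebesgue) + (\<integral>x. \<phi> x \<partial>lebesgue)"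
      by (rule Bochner_Integration.integral_add[OF ib test_fun_integrable[OF \<phi>]])
    finally show ?thesis by simp
  qed
  then show "(\<integral>x. x \<bullet> grad \<phi> x \<partial>lebesgue) = - real DIM('a) * (\<integral>x. \<phi> x \<partial>lebesgue)"
    unfolding eq by (subst Bochner_Integration.integral_sum) (auto intro: ib)
qed

lemma flat_exp_lipschitz: "\<bar>flat_exp a - flat_exp b\<bar> \<le> \<bar>a - b\<bar>"
proof -
  have *: "\<bar>flat_exp b - flat_exp a\<bar> \<le> \<bar>b - a\<bar>" if ab: "a < b" for a b
  proof -
    obtain z where "flat_exp b - flat_exp a = (b - a) * flat_exp' z"
      using MVT2[OF ab, of flat_exp flat_exp'] flat_exp_deriv by blast
    then show ?thesis using flat_exp'_le_1[of z] flat_exp'_nonneg[of z] ab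
      by (simp add: abs_mult mult_left_le)
  qed
  show ?thesis using *[of a b] *[of b a] by (cases a b rule: linorder_cases) auto
qed

text \<open>The equation is tested with \<open>flat_exp (\<phi>\<^sub>n - w)\<close>, where \<open>\<phi>\<^sub>n \<rightarrow> v\<close> and \<open>w = (R\<^sup>2 - |x|\<^sup>2) / 2m\<close> solves the
  same equation; it is admissible because \<open>w \<ge> 0\<close> on \<open>\<Omega>\<close>.\<close>
lemma weak_subsolution_le_paraboloid:
  fixes \<Omega> :: "'a::euclidean_space set"
  assumes \<Omega>: "\<Omega> \<in> lmeasurable" "\<Omega> \<subseteq> ball 0 R" and H: "H01 \<Omega> v G" and c: "c \<le> 1"
    and weak: "\<And>\<phi>. test_fun \<Omega> \<phi> \<Longrightarrow> (\<integral>x. G x \<bullet> grad \<phi> x \<partial>lebesgue) = c * (\<integral>x. \<phi> x \<partial>lebesgue)"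
  shows "AE x in lebesgue. x \<in> \<Omega> \<longrightarrow> v x \<le> R\<^sup>2 / (2 * real DIM('a))"
proof -
  let ?m = "real DIM('a)"
  have m: "?m > 0" by simp
  define w where "w x = (R\<^sup>2 - (norm x)\<^sup>2) / (2 * ?m)" for x :: 'a
  have w0: "w x \<ge> 0" if "x \<in> ball 0 R" for x
    using that m by (auto simp: w_def power_mono)
  have sw: "smooth_fun w" unfolding w_def by (intro smooth_intros)
  have gw: "grad w x = - (1 / ?m) *\<^sub>R x" for x
  proof -
    have "grad (\<lambda>x. (1 / (2 * ?m)) * (R\<^sup>2 - (norm x)\<^sup>2)) x = (1 / (2 * ?m)) *\<^sub>R (grad (\<lambda>x. R\<^sup>2) x - grad (\<lambda>x. (norm x)\<^sup>2) x)"
      by (subst grad_cmult, (intro smooth_fun_differentiable smooth_intros)[1])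
        (subst grad_diff, auto intro!: smooth_fun_differentiable smooth_intros)
    then show ?thesis unfolding w_def grad_norm2 by simp
  qed
  obtain \<phi> where \<phi>: "\<And>n. test_fun \<Omega> (\<phi> n)"
    "(\<lambda>n. \<integral>x. (norm (\<phi> n x - v x))\<^sup>2 \<partial>lebesgue) \<longlonglongrightarrow> 0"
    "(\<lambda>n. \<integral>x. (norm (grad (\<phi> n) x - G x))\<^sup>2 \<partial>lebesgue) \<longlonglongrightarrow> 0" using H01_seq[OF H] by blast
  obtain r where r: "0 < r" "\<And>\<phi>. test_fun \<Omega> \<phi> \<Longrightarrow>
     (\<integral>x. (\<phi> x)\<^sup>2 \<partial>lebesgue) \<le> r\<^sup>2 * (\<integral>x. (norm (grad \<phi> x))\<^sup>2 \<partial>lebesgue)"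
    using poincare_constant_exists[OF \<Omega>(1)] by blast
  \<comment> \<open>Beyond the closed ball \<open>w\<close> is negative and the composition would be
    positive where \<phi> vanishes. Cutting it off is smooth, because the support of
    \<open>\<phi> n\<close> is a compact part of the open ball.\<close>
  define \<psi> where "\<psi> n x = (if x \<in> ball 0 R then flat_exp (\<phi> n x - w x) else 0)" for n x
  have supp: "tsupport (\<phi> n) \<subseteq> ball 0 R" for n using test_fun_subset[OF \<phi>(1)] \<Omega>(2) by blast
  have \<psi>0: "\<psi> n x = 0" if "\<phi> n x = 0" for n x
    using w0[of x] that by (auto simp: \<psi>_def)
  have sE: "smooth_fun (\<lambda>x. flat_exp (\<phi> n x - w x))" for n
    by (intro smooth_compose[OF smooth_flat_exp] smooth_diff sw test_fun_smooth[OF \<phi>(1)])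
  have s\<psi>: "smooth_fun (\<psi> n)" for n
  proof (rule smooth_local)
    fix x
    show "\<exists>U g. open U \<and> x \<in> U \<and> smooth_fun g \<and> (\<forall>y\<in>U. \<psi> n y = g y)"
    proof (cases "x \<in> ball 0 R")
      case True
      then show ?thesis using sE[of n]
        by (intro exI[of _ "ball 0 R"] exI[of _ "\<lambda>x. flat_exp (\<phi> n x - w x)"] conjI ballI) (simp_all add: \<psi>_def)
    next
      case False
      then have "x \<in> - tsupport (\<phi> n)" using supp by blast
      moreover have "\<psi> n y = 0" if "y \<in> - tsupport (\<phi> n)" for y
        by (rule \<psi>0, rule not_tsupport) (use that in simp)
      moreover have "open (- tsupport (\<phi> n))" by (simp add: tsupport_def open_Compl)
      ultimately show ?thesis
        by (intro exI[of _ "- tsupport (\<phi> n)"] exI[of _ "\<lambda>x. 0"] conjI ballI smooth_const)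
    qed
  qed
  have t\<psi>: "test_fun \<Omega> (\<psi> n)" for n
    by (rule test_fun_supported[OF \<phi>(1) s\<psi> \<psi>0])
  define e where "e n x = flat_exp' (\<phi> n x - w x)" for n x
  define d where "d n x = grad (\<phi> n) x + (1 / ?m) *\<^sub>R x" for n x
  have g\<psi>: "grad (\<psi> n) x = e n x *\<^sub>R d n x" if "x \<in> ball 0 R" for n x
  proof -
    have "grad (\<psi> n) x = grad (\<lambda>x. flat_exp (\<phi> n x - w x)) x"
      by (rule grad_eq_on_open[of "ball 0 R"]) (use that sE in \<open>auto simp: \<psi>_def intro: smooth_fun_differentiable\<close>)
    also have "\<dots> = e n x *\<^sub>R grad (\<lambda>x. \<phi> n x - w x) x"
      unfolding e_def by (rule grad_compose[OF _ flat_exp_deriv])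
        (intro smooth_fun_differentiable smooth_diff sw test_fun_smooth[OF \<phi>(1)])
    also have "grad (\<lambda>x. \<phi> n x - w x) x = d n x"
      unfolding d_def by (subst grad_diff)
        (auto simp: gw intro: smooth_fun_differentiable sw test_fun_smooth[OF \<phi>(1)])
    finally show ?thesis .
  qed
  \<comment> \<open>Inside the ball the gradient is \<open>e\<close> times \<open>d\<close>, where
    \<open>d\<close> is the gradient of \<open>\<phi> n - w\<close>, and
    \<open>e\<^sup>2 \<le> e\<close> removes one factor \<open>e\<close>.\<close>
  have sq: "(norm (grad (\<psi> n) x))\<^sup>2 \<le> d n x \<bullet> grad (\<psi> n) x" for n x
  proof (cases "x \<in> ball 0 R")
    case True
    have "(e n x)\<^sup>2 \<le> e n x" using flat_exp'_le_1[of "\<phi> n x - w x"]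
      by (simp add: e_def power2_eq_square mult_left_le)
    then have "(e n x)\<^sup>2 * (norm (d n x))\<^sup>2 \<le> e n x * (norm (d n x))\<^sup>2" by (intro mult_right_mono) auto
    then show ?thesis by (simp add: g\<psi>[OF True] power_mult_distrib power2_norm_eq_inner)
  next
    case False
    then have "x \<notin> \<Omega>" using \<Omega>(2) by blast
    then show ?thesis using test_fun_grad_zero[OF t\<psi>] by simp
  qed
  \<comment> \<open>Subtract the two weak equations: \<open>w\<close> has source 1, \<open>v\<close>
    has source \<open>c \<le> 1\<close>, and \<psi> is nonnegative, so only the approximation error
    of \<open>\<phi> n\<close> remains.\<close>
  have main: "(\<integral>x. (norm (grad (\<psi> n) x))\<^sup>2 \<partial>lebesgue) \<le> (\<integral>x. (norm (grad (\<phi> n) x - G x))\<^sup>2 \<partial>lebesgue)" (is "?D \<le> ?E") for n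
  proof -
    note L\<psi> = test_fun_grad_L2[OF t\<psi>[of n]] and L\<phi> = test_fun_grad_L2[OF \<phi>(1)[of n]]
    have i: "integrable lebesgue (\<lambda>x. grad (\<phi> n) x \<bullet> grad (\<psi> n) x)" "integrable lebesgue (\<lambda>x. G x \<bullet> grad (\<psi> n) x)"
      by (rule L2_inner[OF L\<phi> L\<psi>], rule L2_inner[OF H01_grad_L2[OF H] L\<psi>])
    note eu = test_fun_euler_identity[OF t\<psi>[of n]]
    have p: "(\<integral>x. \<psi> n x \<partial>lebesgue) \<ge> 0" by (intro integral_nonneg_AE) (auto simp: \<psi>_def)
    have deq: "d n x \<bullet> grad (\<psi> n) x = grad (\<phi> n) x \<bullet> grad (\<psi> n) x + (1 / ?m) * (x \<bullet> grad (\<psi> n) x)" for x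
      by (simp add: d_def inner_add_left)
    have id: "integrable lebesgue (\<lambda>x. d n x \<bullet> grad (\<psi> n) x)"
      unfolding deq using i eu(2) by auto
    have "?D \<le> (\<integral>x. d n x \<bullet> grad (\<psi> n) x \<partial>lebesgue)"
      by (rule integral_mono[OF L2_integrable[OF L\<psi>] id sq])
    also have "\<dots> = (\<integral>x. grad (\<phi> n) x \<bullet> grad (\<psi> n) x \<partial>lebesgue) + (1 / ?m) * (\<integral>x. x \<bullet> grad (\<psi> n) x \<partial>lebesgue)"
      unfolding deq using i eu(2) by simp
    also have "\<dots> = (\<integral>x. grad (\<phi> n) x \<bullet> grad (\<psi> n) x \<partial>lebesgue) - (\<integral>x. \<psi> n x \<partial>lebesgue)"
      using m by (simp add: eu(1))
    also have "\<dots> \<le> (\<integral>x. grad (\<phi> n) x \<bullet> grad (\<psi> n) x \<partial>lebesgue) - c * (\<integral>x. \<psi> n x \<partial>lebesgue)"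
      using mult_right_mono[OF c p] by simp
    also have "\<dots> = (\<integral>x. (grad (\<phi> n) x - G x) \<bullet> grad (\<psi> n) x \<partial>lebesgue)"
      using i weak[OF t\<psi>[of n]] by (simp add: inner_diff_left)
    also have "\<dots> \<le> sqrt ?E * sqrt ?D"
      using L2_Cauchy_Schwarz_abs[OF L2_diff[OF L\<phi> H01_grad_L2[OF H]] L\<psi>] by simp
    finally have le: "?D \<le> sqrt ?E * sqrt ?D" .
    have "sqrt ?D \<le> sqrt ?E"
    proof (cases "?D = 0")
      case False
      then have "sqrt ?D > 0" by (simp add: less_le)
      moreover have "?D = sqrt ?D * sqrt ?D" by simp
      ultimately have "sqrt ?D * sqrt ?D \<le> sqrt ?E * sqrt ?D" using le by linarith
      then show ?thesis using \<open>sqrt ?D > 0\<close> by (rule mult_right_le_imp_le)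
    qed simp
    then show ?thesis by simp
  qed
  \<comment> \<open>It vanishes on \<Omega> exactly where \<open>v \<le> w\<close>, so it remains to
    show that its integral is 0.\<close>
  let ?F = "\<lambda>x. indicator \<Omega> x * (flat_exp (v x - w x))\<^sup>2"
  have [measurable]: "v \<in> borel_measurable lebesgue" "\<Omega> \<in> sets lebesgue" "w \<in> borel_measurable lebesgue"
    "flat_exp \<in> borel_measurable borel"
    using H01_L2[OF H] \<Omega>(1) by (auto simp: L2_def intro!: continuous_imp_lebesgue_measurable smooth_fun_continuous sw
      borel_measurable_continuous_onI smooth_flat_exp)
  have iF: "integrable lebesgue ?F"
    by (rule integrable_bounded_on_lmeasurable[OF _ \<Omega>(1), of _ 1])
      (auto simp: indicator_def abs_square_le_1 flat_exp_le_1 power_le_one)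
  have bound: "(\<integral>x. ?F x \<partial>lebesgue) \<le> 2 * r\<^sup>2 * (\<integral>x. (norm (grad (\<phi> n) x - G x))\<^sup>2 \<partial>lebesgue) + 2 * (\<integral>x. (norm (\<phi> n x - v x))\<^sup>2 \<partial>lebesgue)" for n
  proof -
    have i1: "integrable lebesgue (\<lambda>x. (\<psi> n x)\<^sup>2)" using L2_integrable[OF test_fun_L2[OF t\<psi>[of n]]] by simp
    have i2: "integrable lebesgue (\<lambda>x. (norm (\<phi> n x - v x))\<^sup>2)"
      using L2_integrable[OF L2_diff[OF test_fun_L2[OF \<phi>(1)[of n]] H01_L2[OF H]]] by simp
    have "?F x \<le> 2 * (\<psi> n x)\<^sup>2 + 2 * (norm (\<phi> n x - v x))\<^sup>2" for x
    proof (cases "x \<in> \<Omega>")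
      case True
      then have \<psi>x: "\<psi> n x = flat_exp (\<phi> n x - w x)" using \<Omega>(2) by (auto simp: \<psi>_def)
      let ?a = "flat_exp (v x - w x) - \<psi> n x"
      have "\<bar>?a\<bar> \<le> \<bar>\<phi> n x - v x\<bar>"
        using flat_exp_lipschitz[of "v x - w x" "\<phi> n x - w x"] by (simp add: \<psi>x abs_minus_commute)
      then have "?a\<^sup>2 \<le> (\<phi> n x - v x)\<^sup>2" by (simp add: abs_le_square_iff)
      moreover have "(\<psi> n x + ?a)\<^sup>2 \<le> 2 * (\<psi> n x)\<^sup>2 + 2 * ?a\<^sup>2" using norm_add_square_le[of "\<psi> n x" ?a] by simp
      ultimately show ?thesis using True by simp
    qed auto
    then have "(\<integral>x. ?F x \<partial>lebesgue) \<le> (\<integral>x. 2 * (\<psi> n x)\<^sup>2 + 2 * (norm (\<phi> n x - v x))\<^sup>2 \<partial>lebesgue)"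
      using i1 i2 iF by (intro integral_mono) auto
    also have "\<dots> = 2 * (\<integral>x. (\<psi> n x)\<^sup>2 \<partial>lebesgue) + 2 * (\<integral>x. (norm (\<phi> n x - v x))\<^sup>2 \<partial>lebesgue)"
      using i1 i2 by simp
    also have "(\<integral>x. (\<psi> n x)\<^sup>2 \<partial>lebesgue) \<le> r\<^sup>2 * (\<integral>x. (norm (grad (\<phi> n) x - G x))\<^sup>2 \<partial>lebesgue)"
      using r(2)[OF t\<psi>[of n]] mult_left_mono[OF main[of n], of "r\<^sup>2"] by simp
    finally show ?thesis by simp
  qed
  have "(\<lambda>n. 2 * r\<^sup>2 * (\<integral>x. (norm (grad (\<phi> n) x - G x))\<^sup>2 \<partial>lebesgue) + 2 * (\<integral>x. (norm (\<phi> n x - v x))\<^sup>2 \<partial>lebesgue)) \<longlonglongrightarrow> 2 * r\<^sup>2 * 0 + 2 * 0"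
    by (intro tendsto_intros \<phi>(2,3))
  from LIMSEQ_le_const[OF this exI[of _ 0]] bound have "(\<integral>x. ?F x \<partial>lebesgue) \<le> 2 * r\<^sup>2 * 0 + 2 * 0" by blast
  then have "(\<integral>x. ?F x \<partial>lebesgue) \<le> 0" by simp
  moreover have "(\<integral>x. ?F x \<partial>lebesgue) \<ge> 0" by (intro integral_nonneg_AE) auto
  ultimately have "AE x in lebesgue. ?F x = 0"
    using integral_nonneg_eq_0_iff_AE[OF iF] by auto
  then show ?thesis
  proof eventually_elim
    case (elim x)
    have "w x \<le> R\<^sup>2 / (2 * ?m)" by (auto simp: w_def intro!: divide_right_mono)
    then show ?case using elim by (auto simp: indicator_def)
  qed
qed

text \<open>Both signs come from one comparison, since \<open>- v\<close> solves the weak equation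
  with \<open>c = -1\<close>, which is also at most 1.\<close>

lemma torsion_bounded:
  fixes \<Omega> :: "'a::euclidean_space set"
  assumes \<Omega>: "\<Omega> \<in> lmeasurable" "\<Omega> \<subseteq> ball 0 R" and v: "is_torsion \<Omega> v"
  shows "AE x in lebesgue. x \<in> \<Omega> \<longrightarrow> \<bar>v x\<bar> \<le> R\<^sup>2 / (2 * real DIM('a))"
proof -
  obtain G where G: "H01 \<Omega> v G" "\<And>\<phi>. test_fun \<Omega> \<phi> \<Longrightarrow> (\<integral>x. G x \<bullet> grad \<phi> x \<partial>lebesgue) = (\<integral>x. \<phi> x \<partial>lebesgue)"
    using v by (auto simp: is_torsion_def)
  have t0: "test_fun \<Omega> (\<lambda>x. 0)" by (rule test_funI[of _ "{}"]) (auto intro: smooth_const)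
  have N: "H01 \<Omega> (\<lambda>x. - v x) (\<lambda>x. - G x)"
    using H01_diff[OF H01_test_fun[OF t0] G(1)] by simp
  have "AE x in lebesgue. x \<in> \<Omega> \<longrightarrow> v x \<le> R\<^sup>2 / (2 * real DIM('a))"
    by (rule weak_subsolution_le_paraboloid[OF \<Omega> G(1), of 1]) (auto simp: G(2))
  moreover have "AE x in lebesgue. x \<in> \<Omega> \<longrightarrow> - v x \<le> R\<^sup>2 / (2 * real DIM('a))"
    by (rule weak_subsolution_le_paraboloid[OF \<Omega> N, of "-1"]) (auto simp: G(2))
  ultimately show ?thesis by eventually_elim auto
qed

section \<open>Power means and the functional Fp\<close>

text \<open>Bernoulli's inequality for real exponents, obtained from Young's inequality with weights
  1/r and 1 - 1/r.\<close>

lemma powr_ge_tangent: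
  assumes "r \<ge> 1" "t \<ge> (0::real)"
  shows "1 + r * (t - 1) \<le> t powr r"
proof (cases "t = 0")
  case False
  then have t: "t > 0" using assms by simp
  have "(t powr r) powr (1 / r) * 1 powr (1 - 1 / r) \<le> (1 / r) * (t powr r) + (1 - 1 / r) * 1"
    using assms t by (intro Youngs_inequality_0) auto
  then have "t \<le> (1 / r) * (t powr r) + (1 - 1 / r)" using assms t by (simp add: powr_powr)
  then have "r * t \<le> r * ((1 / r) * (t powr r) + (1 - 1 / r))" using assms by (intro mult_left_mono) auto
  also have "\<dots> = t powr r + r - 1" using assms by (simp add: field_simps)
  finally show ?thesis by (simp add: algebra_simps)
qed (use assms in auto)

text \<open>Jensen for powers: integrate the tangent bound at height \<open>B\<close>, then take for
  \<open>B\<close> the mean of order \<open>r\<close>. That mean must be positive, so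
  \<open>S = 0\<close> is separate. Without integrability of the power its integral would be 0 by
  convention and the bound could fail.\<close>

lemma power_mean_integral:
  fixes g :: "'x \<Rightarrow> real"
  assumes A: "A \<in> sets M" "emeasure M A < \<infinity>" "measure M A > 0" and r: "r \<ge> 1"
    and g: "g \<in> borel_measurable M" "\<And>x. 0 \<le> g x" and int: "integrable M (\<lambda>x. indicator A x * g x powr r)"
  shows "(\<integral>x. indicator A x * g x \<partial>M) / measure M A \<le> ((\<integral>x. indicator A x * g x powr r \<partial>M) / measure M A) powr (1 / r)"
proof -
  define S where "S = (\<integral>x. indicator A x * g x powr r \<partial>M)"
  let ?a = "measure M A"
  have iA: "integrable M (\<lambda>x. indicator A x :: real)" using A by simp
  have young: "(\<integral>x. indicator A x * g x \<partial>M) \<le> ?a * (B * (1 - 1 / r)) + (B powr (1 - r) / r) * S" if B: "B > 0" for B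
  proof -
    have "(\<integral>x. indicator A x * g x \<partial>M) \<le> (\<integral>x. (B * (1 - 1 / r)) * indicator A x + (B powr (1 - r) / r) * (indicator A x * g x powr r) \<partial>M)"
    proof (rule integral_mono')
      show "integrable M (\<lambda>x. (B * (1 - 1 / r)) * indicator A x + (B powr (1 - r) / r) * (indicator A x * g x powr r))"
        using iA int by auto
      fix x
      have p: "B powr (1 - r) = B / B powr r" using B by (simp add: powr_diff)
      have "1 + r * (g x / B - 1) \<le> (g x / B) powr r" using r g(2)[of x] B by (intro powr_ge_tangent) auto
      then have "1 + r * (g x / B - 1) \<le> g x powr r / B powr r" using g(2)[of x] B by (simp add: powr_divide)
      then have "(B / r) * (1 + r * (g x / B - 1)) \<le> (B / r) * (g x powr r / B powr r)"
        using B r by (intro mult_left_mono) auto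
      also have "(B / r) * (1 + r * (g x / B - 1)) = g x - B * (1 - 1 / r)"
        using B r by (simp add: field_simps)
      also have "(B / r) * (g x powr r / B powr r) = B powr (1 - r) / r * g x powr r" by (simp add: p)
      finally have "g x \<le> B * (1 - 1 / r) + B powr (1 - r) / r * g x powr r" by linarith
      then show "indicator A x * g x \<le> (B * (1 - 1 / r)) * indicator A x + (B powr (1 - r) / r) * (indicator A x * g x powr r)"
        by (auto simp: indicator_def)
      show "0 \<le> (B * (1 - 1 / r)) * indicator A x + (B powr (1 - r) / r) * (indicator A x * g x powr r)"
        using B r by (intro add_nonneg_nonneg mult_nonneg_nonneg) auto
    qed
    also have "\<dots> = (B * (1 - 1 / r)) * ?a + (B powr (1 - r) / r) * S"
      using iA int A by (simp add: S_def)
    finally show ?thesis by (simp add: mult.commute)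
  qed
  have S0: "S \<ge> 0" unfolding S_def by (intro integral_nonneg_AE) auto
  show ?thesis
  proof (cases "S = 0")
    case True
    then have "AE x in M. indicator A x * g x powr r = 0"
      using integral_nonneg_eq_0_iff_AE[OF int] by (auto simp: S_def)
    then have "AE x in M. indicator A x * g x = 0" by eventually_elim auto
    then have "(\<integral>x. indicator A x * g x \<partial>M) = 0" by (rule integral_eq_zero_AE)
    then show ?thesis using A(3) by simp
  next
    case False
    then have S: "S > 0" using S0 by simp
    define B where "B = (S / ?a) powr (1 / r)"
    have B: "B > 0" using S A(3) by (simp add: B_def)
    have "B powr r = S / ?a" unfolding B_def using r S A(3) by (simp add: powr_powr)
    then have "B powr (1 - r) * S = B * ?a" using B S A(3) by (simp add: powr_diff field_simps)
    then have "?a * (B * (1 - 1 / r)) + (B powr (1 - r) / r) * S = ?a * B"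
      using r by (simp add: field_simps)
    then have "(\<integral>x. indicator A x * g x \<partial>M) \<le> ?a * B" using young[OF B] by linarith
    then have "(\<integral>x. indicator A x * g x \<partial>M) / ?a \<le> B" using A(3) by (simp add: divide_le_eq mult.commute)
    then show ?thesis by (simp add: B_def S_def)
  qed
qed

lemma Fp_eq_average:
  assumes "measure lebesgue \<Omega> > 0"
  shows "Fp p \<Omega> = lambda1 \<Omega> * ((\<integral>x. indicator \<Omega> x * \<bar>torsion \<Omega> x\<bar> powr p \<partial>lebesgue) / measure lebesgue \<Omega>) powr (1 / p)"
proof -
  have "(\<integral>x. indicator \<Omega> x * \<bar>torsion \<Omega> x\<bar> powr p \<partial>lebesgue) \<ge> 0" by (intro integral_nonneg_AE) auto
  then show ?thesis using assms
    by (simp add: Fp_def Lp_norm_def set_lebesgue_integral_def powr_divide)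
qed

lemma torsion_L2: "\<Omega> \<in> lmeasurable \<Longrightarrow> L2 lebesgue (torsion \<Omega>)"
  using is_torsion_torsion[of \<Omega>] H01_L2 by (auto simp: is_torsion_def)

lemma Fp_le_1:
  assumes \<Omega>: "\<Omega> \<in> lmeasurable" "measure lebesgue \<Omega> > 0" and p: "1 \<le> p" "p \<le> 2"
  shows "Fp p \<Omega> \<le> 1"
proof (cases "lambda1 \<Omega> \<ge> 0")
  \<comment> \<open>The sign of \<open>lambda1\<close> is left open here; a negative value makes the
    product nonpositive.\<close>
  case False
  then show ?thesis by (simp add: Fp_eq_average[OF \<Omega>(2)] mult_nonpos_nonneg order_trans[OF mult_nonpos_nonneg])
next
  case True
  let ?v = "torsion \<Omega>" and ?a = "measure lebesgue \<Omega>"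
  have sm: "\<Omega> \<in> sets lebesgue" "emeasure lebesgue \<Omega> < \<infinity>" using \<Omega> by (auto simp: fmeasurable_def)
  obtain G where G: "H01 \<Omega> ?v G" "\<And>\<phi>. test_fun \<Omega> \<phi> \<Longrightarrow> (\<integral>x. G x \<bullet> grad \<phi> x \<partial>lebesgue) = (\<integral>x. \<phi> x \<partial>lebesgue)"
    using is_torsion_torsion[OF \<Omega>(1)] by (auto simp: is_torsion_def)
  have L: "L2 lebesgue ?v" by (rule torsion_L2[OF \<Omega>(1)])
  have [measurable]: "?v \<in> borel_measurable lebesgue" using L by (simp add: L2_def)
  have i2: "integrable lebesgue (\<lambda>x. indicator \<Omega> x * (?v x)\<^sup>2)"
    using integrable_mult_indicator[OF sm(1) L2_integrable_real[OF L]] by simp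
  have powr2: "\<bar>t\<bar> powr 2 = t\<^sup>2" for t :: real by simp
  define V where "V = (\<integral>x. indicator \<Omega> x * (?v x)\<^sup>2 \<partial>lebesgue)"
  \<comment> \<open>In terms of the quadratic mean \<open>X\<close> the energy chain reads
    \<open>lambda1 \<Omega> * X\<^sup>2 \<le> X\<close>, which is the case p = 2; smaller exponents
    follow because power means increase.\<close>
  define X where "X = (V / ?a) powr (1 / 2)"
  have V0: "V \<ge> 0" unfolding V_def by (intro integral_nonneg_AE) auto
  have X0: "X \<ge> 0" by (simp add: X_def)
  have "X\<^sup>2 = V / ?a" using V0 \<Omega>(2) by (simp add: X_def powr_half_sqrt)
  then have V: "V = ?a * X\<^sup>2" using \<Omega>(2) by (simp add: field_simps)
  have le1: "(\<integral>x. indicator \<Omega> x * \<bar>?v x\<bar> \<partial>lebesgue) / ?a \<le> X"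
    using power_mean_integral[OF sm \<Omega>(2), of 2 "\<lambda>x. \<bar>?v x\<bar>"] i2 by (simp add: powr2 X_def V_def)
  have il: "integrable lebesgue (\<lambda>x. indicator \<Omega> x * ?v x)"
    using L2_inner[OF L2_indicator[OF sm] L] by simp
  have "lambda1 \<Omega> * V \<le> lambda1 \<Omega> * (\<integral>x. (?v x)\<^sup>2 \<partial>lebesgue)"
    unfolding V_def using i2 L2_integrable_real[OF L] True
    by (intro mult_left_mono integral_mono) (auto simp: indicator_def)
  also have "\<dots> \<le> (\<integral>x. (norm (G x))\<^sup>2 \<partial>lebesgue)" by (rule lambda1_le[OF G(1)])
  also have "\<dots> = (\<integral>x. indicator \<Omega> x * ?v x \<partial>lebesgue)" by (rule torsion_energy[OF \<Omega>(1) G])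
  also have "\<dots> \<le> (\<integral>x. indicator \<Omega> x * \<bar>?v x\<bar> \<partial>lebesgue)"
    using il integrable_abs[OF il] by (intro integral_mono) (auto simp: abs_mult indicator_def)
  also have "\<dots> \<le> ?a * X" using le1 \<Omega>(2) by (simp add: field_simps)
  finally have "?a * ((lambda1 \<Omega> * X) * X) \<le> ?a * (1 * X)" by (simp add: V power2_eq_square mult_ac)
  then have "(lambda1 \<Omega> * X) * X \<le> 1 * X" using \<Omega>(2) mult_left_le_imp_le by blast
  then have F2: "lambda1 \<Omega> * X \<le> 1"
    using X0 by (cases "X = 0") (auto simp: mult_le_cancel_right)
  have pp: "(\<bar>t\<bar> powr p) powr (2 / p) = t\<^sup>2" for t :: real using p by (simp add: powr_powr)
  have "(\<integral>x. indicator \<Omega> x * \<bar>?v x\<bar> powr p \<partial>lebesgue) / ?a \<le> (V / ?a) powr (1 / (2 / p))"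
    using power_mean_integral[OF sm \<Omega>(2), of "2 / p" "\<lambda>x. \<bar>?v x\<bar> powr p"] i2 p
    by (simp add: pp V_def)
  then have "((\<integral>x. indicator \<Omega> x * \<bar>?v x\<bar> powr p \<partial>lebesgue) / ?a) powr (1 / p) \<le> ((V / ?a) powr (1 / (2 / p))) powr (1 / p)"
    using p \<Omega>(2) by (intro powr_mono2 divide_nonneg_nonneg integral_nonneg_AE) auto
  also have "\<dots> = X" using p by (simp add: powr_powr X_def)
  finally show ?thesis unfolding Fp_eq_average[OF \<Omega>(2)]
    using mult_left_mono[OF _ True] F2 order_trans by blast
qed

text \<open>Power means increase with \<open>p\<close>, provided the power of \<open>|v|\<close> is
  integrable; the boundedness of \<Omega> supplies this through the pointwise bound on
  \<open>v\<close>.\<close>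

lemma Fp_ge_mean_torsion:
  fixes \<Omega> :: "'a::euclidean_space set"
  assumes \<Omega>: "\<Omega> \<in> lmeasurable" "measure lebesgue \<Omega> > 0" "bounded \<Omega>" and p: "1 \<le> p" and l: "lambda1 \<Omega> \<ge> 0"
  shows "lambda1 \<Omega> * ((\<integral>x. indicator \<Omega> x * torsion \<Omega> x \<partial>lebesgue) / measure lebesgue \<Omega>) \<le> Fp p \<Omega>"
proof -
  let ?v = "torsion \<Omega>" and ?a = "measure lebesgue \<Omega>"
  have sm: "\<Omega> \<in> sets lebesgue" "emeasure lebesgue \<Omega> < \<infinity>" using \<Omega> by (auto simp: fmeasurable_def)
  have L: "L2 lebesgue ?v" by (rule torsion_L2[OF \<Omega>(1)])
  have [measurable]: "?v \<in> borel_measurable lebesgue" "\<Omega> \<in> sets lebesgue" using L sm by (simp_all add: L2_def)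
  obtain R where R: "\<Omega> \<subseteq> ball 0 R" using \<Omega>(3) bounded_subset_ballD by blast
  let ?C = "R\<^sup>2 / (2 * real DIM('a))"
  have ip: "integrable lebesgue (\<lambda>x. indicator \<Omega> x * \<bar>?v x\<bar> powr p)"
  proof (rule Bochner_Integration.integrable_bound)
    show "integrable lebesgue (\<lambda>x. ?C powr p * indicator \<Omega> x)" using sm by (intro integrable_mult_right) auto
    show "AE x in lebesgue. norm (indicator \<Omega> x * \<bar>?v x\<bar> powr p) \<le> norm (?C powr p * indicator \<Omega> x)"
      using torsion_bounded[OF \<Omega>(1) R is_torsion_torsion[OF \<Omega>(1)]]
      by eventually_elim (use p in \<open>auto simp: indicator_def intro!: powr_mono2\<close>)
  qed measurable
  have il: "integrable lebesgue (\<lambda>x. indicator \<Omega> x * ?v x)"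
    using L2_inner[OF L2_indicator[OF sm] L] by simp
  have "(\<integral>x. indicator \<Omega> x * ?v x \<partial>lebesgue) \<le> (\<integral>x. indicator \<Omega> x * \<bar>?v x\<bar> \<partial>lebesgue)"
    using il integrable_abs[OF il] by (intro integral_mono) (auto simp: abs_mult indicator_def)
  then have "(\<integral>x. indicator \<Omega> x * ?v x \<partial>lebesgue) / ?a \<le> (\<integral>x. indicator \<Omega> x * \<bar>?v x\<bar> \<partial>lebesgue) / ?a"
    using \<Omega>(2) by (intro divide_right_mono) auto
  also have "\<dots> \<le> ((\<integral>x. indicator \<Omega> x * \<bar>?v x\<bar> powr p \<partial>lebesgue) / ?a) powr (1 / p)"
    by (rule power_mean_integral[OF sm \<Omega>(2) p _ _ ip]) auto
  finally show ?thesis unfolding Fp_eq_average[OF \<Omega>(2)] using l by (rule mult_left_mono)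
qed

text \<open>If \<open>|v|\<^sup>p\<close> is not integrable, its Bochner integral, and with it \<open>Fp\<close>, is 0 by convention.\<close>
lemma Fp_le_1_left_closed:
  assumes \<Omega>: "\<Omega> \<in> lmeasurable" "measure lebesgue \<Omega> > 0" and p: "1 < p"
    and le: "\<And>q. 1 \<le> q \<Longrightarrow> q < p \<Longrightarrow> Fp q \<Omega> \<le> 1"
  shows "Fp p \<Omega> \<le> 1"
proof (cases "integrable lebesgue (\<lambda>x. indicator \<Omega> x * \<bar>torsion \<Omega> x\<bar> powr p)")
  case False
  then show ?thesis by (simp add: Fp_eq_average[OF \<Omega>(2)] not_integrable_integral_eq)
next
  case True
  let ?v = "torsion \<Omega>" and ?a = "measure lebesgue \<Omega>"
  have sm: "\<Omega> \<in> sets lebesgue" "emeasure lebesgue \<Omega> < \<infinity>" using \<Omega> by (auto simp: fmeasurable_def)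
  have L: "L2 lebesgue ?v" by (rule torsion_L2[OF \<Omega>(1)])
  have [measurable]: "?v \<in> borel_measurable lebesgue" "\<Omega> \<in> sets lebesgue" using L sm by (simp_all add: L2_def)
  define q where "q n = p - (p - 1) * (1 / real (Suc n))" for n
  have q: "1 \<le> q n" "q n < p" for n
  proof -
    have "(p - 1) * (1 / real (Suc n)) \<le> (p - 1) * 1" using p by (intro mult_left_mono) auto
    then show "1 \<le> q n" by (simp add: q_def)
    show "q n < p" using p by (simp add: q_def)
  qed
  have qp: "q \<longlonglongrightarrow> p"
  proof -
    have "(\<lambda>n. p - (p - 1) * inverse (real (Suc n))) \<longlonglongrightarrow> p - (p - 1) * 0"
      by (intro tendsto_intros LIMSEQ_inverse_real_of_nat)
    then show ?thesis by (simp add: q_def[abs_def] inverse_eq_divide)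
  qed
  have "(\<lambda>n. \<integral>x. indicator \<Omega> x * \<bar>?v x\<bar> powr q n \<partial>lebesgue) \<longlonglongrightarrow> (\<integral>x. indicator \<Omega> x * \<bar>?v x\<bar> powr p \<partial>lebesgue)"
  proof (rule integral_dominated_convergence)
    show "integrable lebesgue (\<lambda>x. indicator \<Omega> x + indicator \<Omega> x * \<bar>?v x\<bar> powr p)" using True sm by auto
    show "AE x in lebesgue. (\<lambda>n. indicator \<Omega> x * \<bar>?v x\<bar> powr q n) \<longlonglongrightarrow> indicator \<Omega> x * \<bar>?v x\<bar> powr p"
      using p by (intro AE_I2 tendsto_intros tendsto_powr' qp) (auto intro: tendsto_const)
    show "AE x in lebesgue. norm (indicator \<Omega> x * \<bar>?v x\<bar> powr q n) \<le> indicator \<Omega> x + indicator \<Omega> x * \<bar>?v x\<bar> powr p" for n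
    proof (intro AE_I2)
      fix x
      have "\<bar>?v x\<bar> powr q n \<le> 1 + \<bar>?v x\<bar> powr p"
      proof (cases "\<bar>?v x\<bar> \<le> 1")
        case True
        then have "\<bar>?v x\<bar> powr q n \<le> 1 powr q n" using q[of n] by (intro powr_mono2) auto
        then show ?thesis by (simp add: add_increasing2)
      next
        case False
        then have "\<bar>?v x\<bar> powr q n \<le> \<bar>?v x\<bar> powr p" using q[of n] by (intro powr_mono) auto
        then show ?thesis by simp
      qed
      then show "norm (indicator \<Omega> x * \<bar>?v x\<bar> powr q n) \<le> indicator \<Omega> x + indicator \<Omega> x * \<bar>?v x\<bar> powr p"
        by (auto simp: indicator_def)
    qed
  qed measurable
  then have "(\<lambda>n. (\<integral>x. indicator \<Omega> x * \<bar>?v x\<bar> powr q n \<partial>lebesgue) / ?a) \<longlonglongrightarrow> (\<integral>x. indicator \<Omega> x * \<bar>?v x\<bar> powr p \<partial>lebesgue) / ?a"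
    using \<Omega>(2) by (intro tendsto_divide tendsto_const) auto
  moreover have "(\<lambda>n. 1 / q n) \<longlonglongrightarrow> 1 / p" using p by (intro tendsto_divide tendsto_const qp) auto
  ultimately have "(\<lambda>n. ((\<integral>x. indicator \<Omega> x * \<bar>?v x\<bar> powr q n \<partial>lebesgue) / ?a) powr (1 / q n))
     \<longlonglongrightarrow> ((\<integral>x. indicator \<Omega> x * \<bar>?v x\<bar> powr p \<partial>lebesgue) / ?a) powr (1 / p)"
    using p \<Omega>(2) by (intro tendsto_powr') (auto intro!: always_eventually divide_nonneg_nonneg integral_nonneg_AE)
  from tendsto_mult_left[OF this, of "lambda1 \<Omega>"]
  have "(\<lambda>n. Fp (q n) \<Omega>) \<longlonglongrightarrow> Fp p \<Omega>" unfolding Fp_eq_average[OF \<Omega>(2)] .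
  then show ?thesis by (rule LIMSEQ_le_const2) (use le q in auto)
qed

section \<open>The unit ball\<close>

lemma measurable_norm_diff_square:
  fixes f g :: "'x \<Rightarrow> 'b::euclidean_space"
  assumes [measurable]: "f \<in> borel_measurable M" "g \<in> borel_measurable M"
  shows "(\<lambda>x. (norm (f x - g x))\<^sup>2) \<in> borel_measurable M"
  by measurable

lemma L2_bounded:
  fixes f :: "'a::euclidean_space \<Rightarrow> 'b::euclidean_space"
  assumes f: "f \<in> borel_measurable lebesgue" "A \<in> lmeasurable" "\<And>x. norm (f x) \<le> C"
    "\<And>x. x \<notin> A \<Longrightarrow> f x = 0"
  shows "L2 lebesgue f"
  unfolding L2_def
proof
  show "integrable lebesgue (\<lambda>x. (norm (f x))\<^sup>2)"
  proof (rule integrable_bounded_on_lmeasurable[OF _ f(2)])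
    show "(\<lambda>x. (norm (f x))\<^sup>2) \<in> borel_measurable lebesgue"
      using f(1) by measurable
    show "norm ((norm (f x))\<^sup>2) \<le> C\<^sup>2" for x using power_mono[OF f(3)[of x], of 2] by simp
  qed (simp add: f(4))
qed (rule f)

text \<open>The weight \<open>2k + 24/25\<close> is \<open>-2w'/w\<close> for the trial ground state \<open>w(s) = (1 - s) exp (- 12 s / 25)\<close>,
  \<open>s = |x|\<^sup>2\<close>.\<close>
lemma ball_weight_inequality:
  fixes m s :: real
  assumes "m \<ge> 2" "0 \<le> s" "s < 1"
  defines "k \<equiv> 1 / (1 - s)"
  shows "14 / 5 * m \<le> 4 * k\<^sup>2 * s + m * (2 * k + 24 / 25) - (2 * k + 24 / 25)\<^sup>2 * s"
proof -
  define t where "t = 1 - s"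
  have t: "0 < t" "t \<le> 1" "s = 1 - t" using assms by (auto simp: t_def)
  have kt: "k * t = 1" using t(1) by (simp add: k_def t_def)
  have k1: "k \<ge> 1" using t(1,2) by (simp add: k_def t_def field_simps)
  have ks: "k * s = k - 1" using kt by (simp add: t(3) algebra_simps)
  have "4 * k\<^sup>2 * s + m * (2 * k + 24 / 25) - (2 * k + 24 / 25)\<^sup>2 * s =
     2 * m * k + 24 / 25 * m - (96 / 25) * (k * s) - (24 / 25)\<^sup>2 * s"
    by (simp add: power2_eq_square algebra_simps)
  also have "\<dots> = (2 * m - 4) * k + 24 / 25 * m + 96 / 25 - (24 / 25)\<^sup>2 + (4 / 25 * k + (24 / 25)\<^sup>2 * t)"
    unfolding ks by (simp add: t(3) field_simps power2_eq_square)
  finally have eq: "4 * k\<^sup>2 * s + m * (2 * k + 24 / 25) - (2 * k + 24 / 25)\<^sup>2 * s = \<dots>" .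
  \<comment> \<open>Arithmetic-geometric mean with \<open>k * t = 1\<close>: the two terms
    \<open>4 / 25 * k\<close> and \<open>(24 / 25)\<^sup>2 * t\<close> add up to at least twice 2/5
    times 24/25.\<close>
  have "t * (2 / 5 * k - 24 / 25)\<^sup>2 = 4 / 25 * k * (k * t) - 96 / 125 * (k * t) + (24 / 25)\<^sup>2 * t"
    by (simp add: power2_eq_square algebra_simps)
  then have "4 / 25 * k + (24 / 25)\<^sup>2 * t - 96 / 125 = t * (2 / 5 * k - 24 / 25)\<^sup>2" by (simp add: kt)
  moreover have "t * (2 / 5 * k - 24 / 25)\<^sup>2 \<ge> 0" using t by simp
  ultimately have 1: "4 / 25 * k + (24 / 25)\<^sup>2 * t \<ge> 96 / 125" by linarith
  have 2: "(2 * m - 4) * k \<ge> (2 * m - 4) * 1" using k1 assms by (intro mult_left_mono) auto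
  \<comment> \<open>The lower bounds add up to 74 m / 25 - 196 / 625, which is at least 14 m / 5
    once m \<ge> 49 / 25.\<close>
  show ?thesis unfolding eq using 1 2 assms(1) by (simp add: power2_eq_square)
qed

text \<open>With the trial ground state w, the field a(x) x is -grad w / w. Expand |grad \<phi> + a
  \<phi> x|^2 \<ge> 0: the cross term is the divergence \<open>S\<close> of a \<phi>^2 x minus
  \<phi>^2 div (a x), and \<open>S\<close> integrates to 0. What is left is \<phi>^2 times div (a x)
  - a^2 |x|^2, the quantity bounded in \<open>ball_weight_inequality\<close>.\<close>

lemma ball_rayleigh:
  fixes \<phi> :: "'a::euclidean_space \<Rightarrow> real"
  assumes m: "DIM('a) \<ge> 2" and \<phi>: "test_fun (ball 0 1) \<phi>"
  shows "14 / 5 * real DIM('a) * (\<integral>x. (\<phi> x)\<^sup>2 \<partial>lebesgue) \<le> (\<integral>x. (norm (grad \<phi> x))\<^sup>2 \<partial>lebesgue)"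
proof -
  let ?m = "real DIM('a)"
  define k where "k x = inverse (1 - (norm x)\<^sup>2)" for x :: 'a
  define a where "a x = 2 * k x + 24 / 25" for x :: 'a
  define f where "f b x = a x * (x \<bullet> b) * (\<phi> x)\<^sup>2" for b x
  define D where "D b x h = (4 * (k x)\<^sup>2 * (x \<bullet> h)) * (x \<bullet> b) * (\<phi> x)\<^sup>2 + a x * (h \<bullet> b) * (\<phi> x)\<^sup>2
      + a x * (x \<bullet> b) * (2 * \<phi> x * (grad \<phi> x \<bullet> h))" for b x h
  have n1: "1 - (norm x)\<^sup>2 > 0" if "x \<in> ball 0 1" for x :: 'a
    using that by (simp add: power_less_one_iff abs_square_less_1)
  have supp: "tsupport \<phi> \<subseteq> ball 0 1" by (rule test_fun_subset[OF \<phi>])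
  \<comment> \<open>The weight is singular on the unit sphere, but off the support of \<phi>, a
    compact part of the ball, the field is identically 0.\<close>
  have der: "(f b has_derivative D b x) (at x)" for b x
  proof (cases "x \<in> tsupport \<phi>")
    case True
    then have x: "1 - (norm x)\<^sup>2 \<noteq> 0" using supp n1[of x] by auto
    have dn: "((\<lambda>x. (norm x)\<^sup>2) has_derivative (\<lambda>h. 2 * (x \<bullet> h))) (at x)"
      using smooth_fun_grad[OF smooth_norm2, of x] by (simp add: grad_norm2)
    have dk: "(k has_derivative (\<lambda>h. 2 * (k x)\<^sup>2 * (x \<bullet> h))) (at x)"
    proof -
      have "((\<lambda>x. inverse (1 - (norm x)\<^sup>2)) has_derivative
          (\<lambda>h. - (inverse (1 - (norm x)\<^sup>2) * (0 - 2 * (x \<bullet> h)) * inverse (1 - (norm x)\<^sup>2)))) (at x)"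
        by (rule Deriv.has_derivative_inverse[OF x has_derivative_diff[OF has_derivative_const dn]])
      then show ?thesis
        unfolding k_def[abs_def] by (rule has_derivative_eq_rhs)
          (auto simp: fun_eq_iff power2_eq_square)
    qed
    have dp: "(\<phi> has_derivative (\<lambda>h. grad \<phi> x \<bullet> h)) (at x)" by (rule smooth_fun_grad[OF test_fun_smooth[OF \<phi>]])
    show ?thesis unfolding f_def[abs_def] a_def[abs_def]
      by (auto intro!: derivative_eq_intros dk dp simp: fun_eq_iff D_def a_def power2_eq_square algebra_simps)
  next
    case False
    have z: "\<phi> x = 0" "grad \<phi> x = 0" using False by (auto simp: not_tsupport grad_not_tsupport)
    have "((\<lambda>x. 0) has_derivative D b x) (at x)" by (simp add: D_def[abs_def] z)
    then show ?thesis
    proof (rule has_derivative_transform_within_open[of _ _ _ _ "- tsupport \<phi>"])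
      show "open (- tsupport \<phi>)" by (simp add: tsupport_def open_Compl)
      show "x \<in> - tsupport \<phi>" using False by simp
      fix y assume "y \<in> - tsupport \<phi>"
      then show "0 = f b y" by (simp add: f_def not_tsupport)
    qed
  qed
  have fz: "f b x = 0" if "x \<notin> tsupport \<phi>" for b x using that by (simp add: f_def not_tsupport)
  have bd: "\<exists>C. \<forall>x. \<bar>D b x b\<bar> \<le> C" for b
  proof -
    have "1 - (norm x)\<^sup>2 \<noteq> 0" if "x \<in> tsupport \<phi>" for x using n1[of x] supp that by force
    then have ne: "\<forall>x\<in>tsupport \<phi>. 1 - (norm x)\<^sup>2 \<noteq> 0" by blast
    have "continuous_on (tsupport \<phi>) (\<lambda>x. D b x b)"
      unfolding D_def a_def k_def
      by (intro continuous_intros test_fun_continuous[OF \<phi>] test_fun_grad_continuous[OF \<phi>] ne)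
    then have "bounded ((\<lambda>x. D b x b) ` tsupport \<phi>)"
      by (intro compact_imp_bounded compact_continuous_image test_fun_compact[OF \<phi>])
    then obtain C where C: "\<And>x. x \<in> tsupport \<phi> \<Longrightarrow> \<bar>D b x b\<bar> \<le> C" by (auto simp: bounded_iff)
    have "\<bar>D b x b\<bar> \<le> max C 0" for x
    proof (cases "x \<in> tsupport \<phi>")
      case True
      then show ?thesis using C[of x] by simp
    next
      case False
      then show ?thesis by (simp add: D_def not_tsupport)
    qed
    then show ?thesis by blast
  qed
  have I: "(\<integral>x. D b x b \<partial>lebesgue) = 0" "integrable lebesgue (\<lambda>x. D b x b)" for b
    using bd[of b] integral_directional_derivative_eq_0[OF der _ test_fun_compact[OF \<phi>] fz] by blast+
  define S where "S x = (\<Sum>b\<in>Basis. D b x b)" for x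
  have S: "integrable lebesgue S" "(\<integral>x. S x \<partial>lebesgue) = 0"
    unfolding S_def[abs_def] using I by auto
  have Seq: "S x = (4 * (k x)\<^sup>2 * (norm x)\<^sup>2 + ?m * a x) * (\<phi> x)\<^sup>2 + 2 * a x * \<phi> x * (x \<bullet> grad \<phi> x)" for x
  proof -
    have "D b x b = (4 * (k x)\<^sup>2 * (\<phi> x)\<^sup>2) * ((x \<bullet> b) * (x \<bullet> b)) + a x * (\<phi> x)\<^sup>2
      + (2 * a x * \<phi> x) * ((x \<bullet> b) * (grad \<phi> x \<bullet> b))" if "b \<in> Basis" for b
      using that by (simp add: D_def algebra_simps)
    then have "S x = (4 * (k x)\<^sup>2 * (\<phi> x)\<^sup>2) * (x \<bullet> x) + ?m * (a x * (\<phi> x)\<^sup>2) + (2 * a x * \<phi> x) * (x \<bullet> grad \<phi> x)"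
      unfolding S_def euclidean_inner[of x x] euclidean_inner[of x "grad \<phi> x"]
      by (simp add: sum.distrib sum_distrib_left)
    then show ?thesis by (simp add: power2_norm_eq_inner algebra_simps)
  qed
  have pt: "14 / 5 * ?m * (\<phi> x)\<^sup>2 - S x \<le> (norm (grad \<phi> x))\<^sup>2" for x
  proof (cases "x \<in> ball 0 1")
    case True
    let ?s = "(norm x)\<^sup>2"
    have "14 / 5 * ?m \<le> 4 * (k x)\<^sup>2 * ?s + ?m * a x - (a x)\<^sup>2 * ?s"
      using ball_weight_inequality[of ?m ?s] m n1[OF True] by (simp add: k_def a_def inverse_eq_divide)
    then have "14 / 5 * ?m * (\<phi> x)\<^sup>2 \<le> (4 * (k x)\<^sup>2 * ?s + ?m * a x - (a x)\<^sup>2 * ?s) * (\<phi> x)\<^sup>2"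
      by (rule mult_right_mono) simp
    moreover have "0 \<le> (norm (grad \<phi> x + (a x * \<phi> x) *\<^sub>R x))\<^sup>2" by simp
    moreover have "(norm (grad \<phi> x + (a x * \<phi> x) *\<^sub>R x))\<^sup>2 =
       (norm (grad \<phi> x))\<^sup>2 + 2 * a x * \<phi> x * (x \<bullet> grad \<phi> x) + (a x)\<^sup>2 * (\<phi> x)\<^sup>2 * ?s"
      unfolding power2_norm_eq_inner by (simp add: inner_simps inner_commute power2_eq_square algebra_simps)
    moreover have "(4 * (k x)\<^sup>2 * ?s + ?m * a x - (a x)\<^sup>2 * ?s) * (\<phi> x)\<^sup>2 =
        (4 * (k x)\<^sup>2 * ?s + ?m * a x) * (\<phi> x)\<^sup>2 - (a x)\<^sup>2 * (\<phi> x)\<^sup>2 * ?s"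
      by (simp add: algebra_simps)
    ultimately show ?thesis unfolding Seq by linarith
  next
    case False
    then show ?thesis using test_fun_zero[OF \<phi> False] by (simp add: Seq)
  qed
  have i2: "integrable lebesgue (\<lambda>x. (\<phi> x)\<^sup>2)" by (rule L2_integrable_real[OF test_fun_L2[OF \<phi>]])
  have "(\<integral>x. 14 / 5 * ?m * (\<phi> x)\<^sup>2 - S x \<partial>lebesgue) \<le> (\<integral>x. (norm (grad \<phi> x))\<^sup>2 \<partial>lebesgue)"
    using i2 S(1) L2_integrable[OF test_fun_grad_L2[OF \<phi>]] pt by (intro integral_mono) auto
  then show ?thesis using i2 S by simp
qed

section \<open>The torsion function of the unit ball\<close>

lemma smooth_ball_profile: "smooth_fun (\<lambda>x::'a::euclidean_space. 1 - (norm x)\<^sup>2)"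
  by (intro smooth_intros)

text \<open>The exact solution is multiplied by a cutoff that vanishes where 1 - |x|^2 \<le> 1 / (n
  + 1). Because the solution itself vanishes on the sphere, the factor 1 - |x|^2 compensates the
  steepness of the cutoff and the gradients stay bounded.\<close>

lemma ball_torsion_approx:
  fixes n :: nat
  defines "\<phi> \<equiv> \<lambda>x::'a::euclidean_space. (1 / (2 * real DIM('a))) *
      ((1 - (norm x)\<^sup>2) * flat_exp (real (Suc n) * (1 - (norm x)\<^sup>2) - 1))"
  shows "test_fun (ball 0 1) \<phi>"
    and "grad \<phi> x = (- (1 / real DIM('a)) * (flat_exp (real (Suc n) * (1 - (norm x)\<^sup>2) - 1) +
      (1 - (norm x)\<^sup>2) * (real (Suc n) * flat_exp' (real (Suc n) * (1 - (norm x)\<^sup>2) - 1)))) *\<^sub>R x"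
proof -
  let ?N = "real (Suc n)"
  let ?s = "\<lambda>x::'a. 1 - (norm x)\<^sup>2"
  have sm: "smooth_fun (\<lambda>x. flat_exp (?N * ?s x - 1))"
    by (intro smooth_compose[OF smooth_flat_exp] smooth_intros)
  have sm2: "smooth_fun (\<lambda>x. ?s x * flat_exp (?N * ?s x - 1))"
    by (intro smooth_mult sm smooth_ball_profile)
  show "test_fun (ball 0 1) \<phi>"
  proof (rule test_funI)
    show "smooth_fun \<phi>" unfolding \<phi>_def by (intro smooth_mult smooth_const sm2)
    show "compact (cball (0::'a) (sqrt (1 - 1 / ?N)))" by simp
    show "cball (0::'a) (sqrt (1 - 1 / ?N)) \<subseteq> ball 0 1"
    proof
      fix x :: 'a assume "x \<in> cball 0 (sqrt (1 - 1 / ?N))"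
      then have "norm x \<le> sqrt (1 - 1 / ?N)" by simp
      also have "\<dots> < 1" by (simp del: of_nat_Suc)
      finally show "x \<in> ball 0 1" by simp
    qed
    fix x :: 'a assume "x \<notin> cball 0 (sqrt (1 - 1 / ?N))"
    then have "sqrt (1 - 1 / ?N) < norm x" by simp
    then have "1 - 1 / ?N < (norm x)\<^sup>2" using real_sqrt_less_iff[of "1 - 1 / ?N" "(norm x)\<^sup>2"] by simp
    then have "?N * ?s x \<le> 1" by (simp add: field_simps del: of_nat_Suc)
    then show "\<phi> x = 0" by (simp add: \<phi>_def del: of_nat_Suc)
  qed
  have gs: "grad ?s x = - 2 *\<^sub>R x" for x
    by (subst grad_diff) (auto simp: grad_norm2 intro!: smooth_fun_differentiable smooth_intros)
  have ge: "grad (\<lambda>x. flat_exp (?N * ?s x - 1)) x = flat_exp' (?N * ?s x - 1) *\<^sub>R (?N *\<^sub>R (- 2 *\<^sub>R x))" for x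
  proof -
    have "grad (\<lambda>x. ?N * ?s x - 1) x = grad (\<lambda>x. ?N * ?s x) x - grad (\<lambda>x. 1) x"
      by (rule grad_diff) (intro smooth_fun_differentiable smooth_intros)+
    also have "grad (\<lambda>x. ?N * ?s x) x = ?N *\<^sub>R grad ?s x"
      by (rule grad_cmult) (intro smooth_fun_differentiable smooth_intros)
    finally have g: "grad (\<lambda>x. ?N * ?s x - 1) x = ?N *\<^sub>R (- 2 *\<^sub>R x)" by (simp add: gs)
    show ?thesis unfolding g[symmetric]
      by (rule grad_compose[OF _ flat_exp_deriv]) (intro smooth_fun_differentiable smooth_intros)
  qed
  have "grad \<phi> x = (1 / (2 * real DIM('a))) *\<^sub>R grad (\<lambda>x. ?s x * flat_exp (?N * ?s x - 1)) x"
    unfolding \<phi>_def by (rule grad_cmult) (intro smooth_fun_differentiable sm2)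
  also have "grad (\<lambda>x. ?s x * flat_exp (?N * ?s x - 1)) x =
     ?s x *\<^sub>R (flat_exp' (?N * ?s x - 1) *\<^sub>R (?N *\<^sub>R (- 2 *\<^sub>R x))) + flat_exp (?N * ?s x - 1) *\<^sub>R (- 2 *\<^sub>R x)"
    unfolding gs[symmetric] ge[symmetric] 
    by (subst ge[symmetric, unfolded gs[symmetric]]) (rule grad_mult; intro smooth_fun_differentiable sm smooth_ball_profile)
  finally have G: "grad \<phi> x = (1 / (2 * real DIM('a))) *\<^sub>R
       (?s x *\<^sub>R (flat_exp' (?N * ?s x - 1) *\<^sub>R (?N *\<^sub>R (- 2 *\<^sub>R x))) + flat_exp (?N * ?s x - 1) *\<^sub>R (- 2 *\<^sub>R x))" .
  show "grad \<phi> x = (- (1 / real DIM('a)) * (flat_exp (?N * ?s x - 1) +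
      ?s x * (?N * flat_exp' (?N * ?s x - 1)))) *\<^sub>R x"
  proof -
    have "(1 / (2 * d)) *\<^sub>R (s *\<^sub>R (e' *\<^sub>R (N *\<^sub>R (- 2 *\<^sub>R x))) + e *\<^sub>R (- 2 *\<^sub>R x)) =
        (- (1 / d) * (e + s * (N * e'))) *\<^sub>R x" if "d > 0" for d s e e' N :: real
    proof -
      have "s *\<^sub>R (e' *\<^sub>R (N *\<^sub>R (- 2 *\<^sub>R x))) + e *\<^sub>R (- 2 *\<^sub>R x) = (- 2 * (e + s * (N * e'))) *\<^sub>R x"
        by (simp only: scaleR_scaleR scaleR_add_left[symmetric]) (simp add: algebra_simps)
      moreover have "(1 / (2 * d)) * (- 2 * (e + s * (N * e'))) = - (1 / d) * (e + s * (N * e'))"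
        using that by (simp add: field_simps)
      ultimately show ?thesis by (simp only: scaleR_scaleR)
    qed
    from this[OF DIM_positive[THEN of_nat_0_less_iff[THEN iffD2]]] show ?thesis unfolding G .
  qed
qed

text \<open>In \<open>t = N * s - 1\<close> the parameter disappears, since
  \<open>N * s = t + 1\<close>; with \<open>y = 1 / t\<close> the expression is
  \<open>(1 + y + y\<^sup>2) * exp (- y)\<close>. The uniform bound dominates the approximating
  gradients.\<close>

lemma flat_exp_profile_bound:
  assumes "N > 0" "s > 0"
  shows "0 \<le> flat_exp (N * s - 1) + s * (N * flat_exp' (N * s - 1))"
    "flat_exp (N * s - 1) + s * (N * flat_exp' (N * s - 1)) \<le> 2"
proof -
  show "0 \<le> flat_exp (N * s - 1) + s * (N * flat_exp' (N * s - 1))" using assms by simp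
  show "flat_exp (N * s - 1) + s * (N * flat_exp' (N * s - 1)) \<le> 2"
  proof (cases "N * s - 1 > 0")
    case True
    define t where "t = N * s - 1"
    define y where "y = 1 / t"
    have t: "t > 0" and y: "y > 0" using True by (auto simp: t_def y_def)
    have "flat_exp t + (t + 1) * flat_exp' t = (1 + y + y\<^sup>2) * exp (- y)"
      using t by (simp add: flat_exp_def flat_exp'_def y_def power2_eq_square field_simps)
    also have "\<dots> \<le> 2"
    proof -
      have "1 + y + y\<^sup>2 \<le> 2 * exp y" using exp_ge_quadratic[of y] y by simp
      then show ?thesis by (simp add: exp_minus field_simps)
    qed
    finally show ?thesis by (simp add: t_def algebra_simps)
  next
    case False
    then show ?thesis by (simp add: flat_exp_def flat_exp'_def)
  qed
qed

lemma flat_exp_profile_tendsto: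
  assumes "s > 0"
  shows "(\<lambda>n. flat_exp (real (Suc n) * s - 1)) \<longlonglongrightarrow> 1"
    "(\<lambda>n. flat_exp (real (Suc n) * s - 1) + s * (real (Suc n) * flat_exp' (real (Suc n) * s - 1))) \<longlonglongrightarrow> 1"
proof -
  have "filterlim (\<lambda>n. real (Suc n) * s) at_top sequentially"
    by (rule filterlim_at_top_mult_tendsto_pos[OF tendsto_const assms
          filterlim_compose[OF filterlim_real_sequentially filterlim_Suc]])
  from filterlim_tendsto_add_at_top[OF tendsto_const this, of "-1"]
  have top: "filterlim (\<lambda>n. real (Suc n) * s - 1) at_top sequentially" by (simp add: algebra_simps)
  have inv: "((\<lambda>t::real. inverse t) \<longlongrightarrow> 0) at_top" by (rule tendsto_inverse_0_at_top[OF filterlim_ident])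
  have "((\<lambda>t::real. exp (- inverse t)) \<longlongrightarrow> exp (- 0)) at_top" by (intro tendsto_intros inv)
  moreover have "\<forall>\<^sub>F t in at_top. exp (- inverse t) = flat_exp t"
    using eventually_gt_at_top[of 0] by eventually_elim (simp add: flat_exp_def divide_inverse)
  ultimately have "(flat_exp \<longlongrightarrow> exp (- 0)) at_top" by (rule Lim_transform_eventually)
  from filterlim_compose[OF this top]
  show 1: "(\<lambda>n. flat_exp (real (Suc n) * s - 1)) \<longlonglongrightarrow> 1" by simp
  have "((\<lambda>t::real. (inverse t + inverse t * inverse t) * exp (- inverse t)) \<longlongrightarrow> (0 + 0 * 0) * exp (- 0)) at_top"
    by (intro tendsto_intros inv)
  moreover have "\<forall>\<^sub>F t in at_top. (inverse t + inverse t * inverse t) * exp (- inverse t) = (t + 1) * flat_exp' t"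
    using eventually_gt_at_top[of 0] by eventually_elim (simp add: flat_exp'_def field_simps power2_eq_square)
  ultimately have "((\<lambda>t. (t + 1) * flat_exp' t) \<longlongrightarrow> (0 + 0 * 0) * exp (- 0)) at_top" by (rule Lim_transform_eventually)
  from filterlim_compose[OF this top]
  have "(\<lambda>n. s * (real (Suc n) * flat_exp' (real (Suc n) * s - 1))) \<longlonglongrightarrow> 0" by (simp add: mult_ac)
  from tendsto_add[OF 1 this]
  show "(\<lambda>n. flat_exp (real (Suc n) * s - 1) + s * (real (Suc n) * flat_exp' (real (Suc n) * s - 1))) \<longlonglongrightarrow> 1"
    by simp
qed

text \<open>The weak equation is the Euler identity. The work lies in membership in
  \<open>H01\<close>, by dominated convergence along the cut-off paraboloids.\<close>

lemma is_torsion_ball: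
  "is_torsion (ball 0 1) (\<lambda>x::'a::euclidean_space. indicator (ball 0 1) x * ((1 - (norm x)\<^sup>2) / (2 * real DIM('a))))"
    (is "is_torsion ?B ?v")
proof -
  let ?m = "real DIM('a)"
  let ?s = "\<lambda>x::'a. 1 - (norm x)\<^sup>2"
  let ?G = "\<lambda>x::'a. indicator ?B x *\<^sub>R (- (1 / ?m) *\<^sub>R x)"
  define \<phi> where "\<phi> n x = (1 / (2 * ?m)) * (?s x * flat_exp (real (Suc n) * ?s x - 1))" for n and x :: 'a
  define K where "K n s = flat_exp (real (Suc n) * s - 1) + s * (real (Suc n) * flat_exp' (real (Suc n) * s - 1))" for n s
  have t: "test_fun ?B (\<phi> n)" for n unfolding \<phi>_def[abs_def] by (rule ball_torsion_approx)
  have g: "grad (\<phi> n) x = (- (1 / ?m) * K n (?s x)) *\<^sub>R x" for n x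
    unfolding \<phi>_def[abs_def] K_def by (rule ball_torsion_approx)
  have s01: "0 < ?s x" "?s x \<le> 1" if "x \<in> ?B" for x
    using that by (auto simp: power_less_one_iff abs_square_less_1)
  have m1: "?m \<ge> 1" using DIM_positive[where 'a='a] by linarith
  have vm: "?v \<in> borel_measurable lebesgue" "?G \<in> borel_measurable lebesgue"
  proof -
    have [measurable]: "?B \<in> sets borel" by simp
    show "?v \<in> borel_measurable lebesgue" by (rule borel_imp_lebesgue_measurable) measurable
    show "?G \<in> borel_measurable lebesgue" by (rule borel_imp_lebesgue_measurable) measurable
  qed
  have lB: "?B \<in> lmeasurable" by (rule lmeasurable_ball)
  have vb: "\<bar>?v x\<bar> \<le> 1" for x
  proof (cases "x \<in> ?B")
    case True
    have "\<bar>?s x\<bar> \<le> 2 * ?m" using s01[OF True] m1 by linarith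
    then show ?thesis using True m1 by (simp add: abs_divide divide_le_eq)
  qed simp
  have Gb: "norm (?G x) \<le> 1" for x
  proof (cases "x \<in> ?B")
    case True
    then have "norm x < 1" by simp
    then have "norm x \<le> ?m" using m1 by linarith
    then show ?thesis using True m1 by (simp add: divide_le_eq)
  qed simp
  have \<phi>b: "\<bar>\<phi> n x\<bar> \<le> 1" for n x
  proof (cases "x \<in> ?B")
    case True
    have "?s x * flat_exp (real (Suc n) * ?s x - 1) \<le> 1 * 1"
      using s01[OF True] by (intro mult_mono flat_exp_le_1) auto
    moreover have "0 \<le> ?s x * flat_exp (real (Suc n) * ?s x - 1)" using s01[OF True] by simp
    ultimately have "\<bar>?s x * flat_exp (real (Suc n) * ?s x - 1)\<bar> \<le> 1" by linarith
    moreover have "1 / (2 * ?m) \<le> 1" using m1 by (intro divide_le_eq_1[THEN iffD2] disjI1 conjI) linarith+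
    ultimately show ?thesis unfolding \<phi>_def abs_mult[of "1 / (2 * ?m)"] by (intro mult_le_one) auto
  next
    case False
    then show ?thesis using test_fun_zero[OF t False] by simp
  qed
  have gb: "norm (grad (\<phi> n) x) \<le> 2" for n x
  proof (cases "x \<in> ?B")
    case True
    have "\<bar>K n (?s x)\<bar> \<le> 2"
      using flat_exp_profile_bound[of "real (Suc n)" "?s x"] s01[OF True] by (simp add: K_def del: of_nat_Suc)
    moreover have "1 / ?m \<le> 1" using m1 by simp
    moreover have "norm x \<le> 1" using True by simp
    ultimately have "(1 / ?m) * \<bar>K n (?s x)\<bar> * norm x \<le> 1 * 2 * 1"
      by (intro mult_mono) auto
    then show ?thesis by (simp add: g abs_mult)
  next
    case False
    then show ?thesis using test_fun_grad_zero[OF t False] by simp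
  qed
  have H: "H01 ?B ?v ?G"
  proof (rule H01I[of _ _ _ \<phi>])
    show "L2 lebesgue ?v" by (rule L2_bounded[OF vm(1) lB, of 1]) (use vb in \<open>simp_all only: real_norm_def indicator_simps mult_zero_left not_False_eq_True\<close>)
    show "L2 lebesgue ?G" by (rule L2_bounded[OF vm(2) lB Gb]) simp
    show "test_fun ?B (\<phi> n)" for n by (rule t)
    have iB: "integrable lebesgue (\<lambda>x. c * indicator ?B x :: real)" for c
      using lB by (intro integrable_mult_right) (auto simp: fmeasurable_def less_top)
    have "(\<lambda>n. \<integral>x. (norm (\<phi> n x - ?v x))\<^sup>2 \<partial>lebesgue) \<longlonglongrightarrow> integral\<^sup>L lebesgue (\<lambda>x::'a. 0)"
    proof (rule integral_dominated_convergence[where w="\<lambda>x. 4 * indicator ?B x"])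
      show "(\<lambda>x. (norm (\<phi> n x - ?v x))\<^sup>2) \<in> borel_measurable lebesgue" for n
        using vm(1) continuous_imp_lebesgue_measurable[OF test_fun_continuous[OF t[of n]]]
        by (intro measurable_norm_diff_square)
      show "AE x in lebesgue. (\<lambda>n. (norm (\<phi> n x - ?v x))\<^sup>2) \<longlonglongrightarrow> 0"
      proof (intro AE_I2)
        fix x
        show "(\<lambda>n. (norm (\<phi> n x - ?v x))\<^sup>2) \<longlonglongrightarrow> 0"
        proof (cases "x \<in> ?B")
          case True
          have "(\<lambda>n. (norm (\<phi> n x - ?v x))\<^sup>2) \<longlonglongrightarrow> (norm ((1 / (2 * ?m)) * (?s x * 1) - ?v x))\<^sup>2"
            unfolding \<phi>_def by (intro tendsto_intros flat_exp_profile_tendsto s01[OF True])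
          then show ?thesis using True by simp
        next
          case False
          then show ?thesis using test_fun_zero[OF t False] by simp
        qed
      qed
      show "AE x in lebesgue. norm ((norm (\<phi> n x - ?v x))\<^sup>2) \<le> 4 * indicator ?B x" for n
      proof (intro AE_I2)
        fix x
        show "norm ((norm (\<phi> n x - ?v x))\<^sup>2) \<le> 4 * indicator ?B x"
        proof (cases "x \<in> ?B")
          case True
          have "\<bar>\<phi> n x - ?v x\<bar> \<le> 2" using \<phi>b[of n x] vb[of x] by linarith
          then have "(\<phi> n x - ?v x)\<^sup>2 \<le> 2\<^sup>2" using abs_le_square_iff[of "\<phi> n x - ?v x" 2] by simp
          then show ?thesis using True by simp
        next
          case False
          then show ?thesis using test_fun_zero[OF t False] by simp
        qed
      qed
    qed (use iB in auto)
    then show "(\<lambda>n. \<integral>x. (norm (\<phi> n x - ?v x))\<^sup>2 \<partial>lebesgue) \<longlonglongrightarrow> 0" by simp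
    have "(\<lambda>n. \<integral>x. (norm (grad (\<phi> n) x - ?G x))\<^sup>2 \<partial>lebesgue) \<longlonglongrightarrow> integral\<^sup>L lebesgue (\<lambda>x::'a. 0)"
    \<comment> \<open>The approximating gradients are bounded by 2 and the limit by 1, hence 9 as
      the square of 3.\<close>
    proof (rule integral_dominated_convergence[where w="\<lambda>x. 9 * indicator ?B x"])
      show "(\<lambda>x. (norm (grad (\<phi> n) x - ?G x))\<^sup>2) \<in> borel_measurable lebesgue" for n
        using vm(2) continuous_imp_lebesgue_measurable[OF test_fun_grad_continuous[OF t[of n]]]
        by (intro measurable_norm_diff_square)
      show "AE x in lebesgue. (\<lambda>n. (norm (grad (\<phi> n) x - ?G x))\<^sup>2) \<longlonglongrightarrow> 0"
      proof (intro AE_I2)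
        fix x
        show "(\<lambda>n. (norm (grad (\<phi> n) x - ?G x))\<^sup>2) \<longlonglongrightarrow> 0"
        proof (cases "x \<in> ?B")
          case True
          have "(\<lambda>n. (norm (grad (\<phi> n) x - ?G x))\<^sup>2) \<longlonglongrightarrow> (norm ((- (1 / ?m) * 1) *\<^sub>R x - ?G x))\<^sup>2"
            unfolding g K_def by (intro tendsto_intros flat_exp_profile_tendsto s01[OF True])
          then show ?thesis using True by simp
        next
          case False
          then show ?thesis using test_fun_grad_zero[OF t False] by simp
        qed
      qed
      show "AE x in lebesgue. norm ((norm (grad (\<phi> n) x - ?G x))\<^sup>2) \<le> 9 * indicator ?B x" for n
      proof (intro AE_I2)
        fix x
        show "norm ((norm (grad (\<phi> n) x - ?G x))\<^sup>2) \<le> 9 * indicator ?B x"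
        proof (cases "x \<in> ?B")
          case True
          have "norm (grad (\<phi> n) x - ?G x) \<le> 3"
            using gb[of n x] Gb[of x] norm_triangle_ineq4[of "grad (\<phi> n) x" "?G x"] by linarith
          then have "(norm (grad (\<phi> n) x - ?G x))\<^sup>2 \<le> 3\<^sup>2" by (intro power_mono) auto
          then show ?thesis using True by simp
        next
          case False
          then show ?thesis using test_fun_grad_zero[OF t False] by simp
        qed
      qed
    qed (use iB in auto)
    then show "(\<lambda>n. \<integral>x. (norm (grad (\<phi> n) x - ?G x))\<^sup>2 \<partial>lebesgue) \<longlonglongrightarrow> 0" by simp
  qed
  have "(\<integral>x. ?G x \<bullet> grad \<psi> x \<partial>lebesgue) = (\<integral>x. \<psi> x \<partial>lebesgue)" if \<psi>: "test_fun ?B \<psi>" for \<psi>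
  proof -
    have "?G x \<bullet> grad \<psi> x = - (1 / ?m) * (x \<bullet> grad \<psi> x)" for x
      using test_fun_grad_zero[OF \<psi>, of x] by (cases "x \<in> ?B") auto
    then have "(\<integral>x. ?G x \<bullet> grad \<psi> x \<partial>lebesgue) = - (1 / ?m) * (\<integral>x. x \<bullet> grad \<psi> x \<partial>lebesgue)"
      by (simp only: integral_mult_right_zero)
    also have "\<dots> = (\<integral>x. \<psi> x \<partial>lebesgue)"
      using m1 by (simp add: test_fun_euler_identity(1)[OF \<psi>])
    finally show ?thesis .
  qed
  with H show ?thesis unfolding is_torsion_def by blast
qed

lemma exists_test_fun:
  fixes \<Omega> :: "'a::euclidean_space set"
  assumes "open \<Omega>" "\<Omega> \<noteq> {}"
  obtains \<phi> where "test_fun \<Omega> \<phi>" "(\<integral>x. (\<phi> x)\<^sup>2 \<partial>lebesgue) \<noteq> 0"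
proof -
  obtain z e where e: "e > 0" "cball z e \<subseteq> \<Omega>" using assms by (meson all_not_in_conv open_contains_cball)
  define \<phi> where "\<phi> x = flat_exp (e\<^sup>2 - (norm (x + (- z)))\<^sup>2)" for x
  have sm: "smooth_fun \<phi>" unfolding \<phi>_def
    by (intro smooth_compose[OF smooth_flat_exp] smooth_diff smooth_const smooth_translate[of "\<lambda>x. (norm x)\<^sup>2"] smooth_norm2)
  have t: "test_fun \<Omega> \<phi>"
  proof (rule test_funI[OF sm _ e(2)])
    fix x assume "x \<notin> cball z e"
    then have "e\<^sup>2 \<le> (norm (x - z))\<^sup>2" using e(1) by (intro power_mono) (auto simp: dist_norm norm_minus_commute)
    then show "\<phi> x = 0" by (simp add: \<phi>_def)
  qed simp
  have "0 < (\<integral>x. (\<phi> x)\<^sup>2 \<partial>lebesgue)"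
  proof (rule integral_pos_of_open[where U="ball z e"])
    show "integrable lebesgue (\<lambda>x. (\<phi> x)\<^sup>2)" by (rule L2_integrable_real[OF test_fun_L2[OF t]])
    fix x assume "x \<in> ball z e"
    then have "(norm (x - z))\<^sup>2 < e\<^sup>2" by (intro power_strict_mono) (auto simp: dist_norm norm_minus_commute)
    then show "(\<phi> x)\<^sup>2 > 0" by (simp add: \<phi>_def)
  qed (use e in auto)
  then show thesis using that[OF t] by simp
qed

lemma lambda1_ball_ge:
  assumes "DIM('a::euclidean_space) \<ge> 2"
  shows "14 / 5 * real DIM('a) \<le> lambda1 (ball (0::'a) 1)"
proof -
  obtain \<phi> where "test_fun (ball (0::'a) 1) \<phi>" "(\<integral>x. (\<phi> x)\<^sup>2 \<partial>lebesgue) \<noteq> 0"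
    using exists_test_fun[of "ball (0::'a) 1"] by auto
  then show ?thesis by (rule lambda1_ge) (rule ball_rayleigh[OF assms])
qed

text \<open>On the ball of radius 1/4 one has 1 - |x|^2 \<ge> 15/16, so v \<ge> \<open>q\<close>,
  and the eigenvalue bound times \<open>q\<close> is 14/5 times 15/32 = 21/16. The volume fraction
  is 4^(-m), whose root of order 8m is 4^(-1/8) in every dimension. The exponent 8m works because
  this exceeds 16/21.\<close>

lemma Fp_ball_gt_1:
  assumes m2: "DIM('a::euclidean_space) \<ge> 2"
  shows "Fp (8 * real DIM('a)) (ball (0::'a) 1) > 1"
proof -
  let ?m = "real DIM('a)" and ?B = "ball (0::'a) 1" and ?B' = "ball (0::'a) (1 / 4)"
  let ?p = "8 * ?m"
  let ?v = "\<lambda>x::'a. indicator ?B x * ((1 - (norm x)\<^sup>2) / (2 * ?m))"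
  have m: "?m \<ge> 2" using m2 by simp
  have vol: "measure lebesgue ?B > 0" "measure lebesgue ?B' = (1 / 4) ^ DIM('a) * measure lebesgue ?B"
    by (simp_all add: content_ball)
  define q where "q = 15 / (32 * ?m)"
  have q: "q > 0" using m by (simp add: q_def)
  have lm: "?B \<in> lmeasurable" "?B' \<in> lmeasurable" by (auto intro: lmeasurable_ball)
  have "AE x in lebesgue. torsion ?B x = ?v x"
    by (rule is_torsion_AE_unique[OF lm(1) is_torsion_torsion[OF lm(1)] is_torsion_ball])
  then have "(\<integral>x. indicator ?B x * \<bar>torsion ?B x\<bar> powr ?p \<partial>lebesgue) = (\<integral>x. indicator ?B x * \<bar>?v x\<bar> powr ?p \<partial>lebesgue)"
  proof (intro integral_cong_AE)
    have [measurable]: "torsion ?B \<in> borel_measurable lebesgue" "?B \<in> sets lebesgue"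
      using L2_measurable[OF torsion_L2[OF lm(1)]] lm by auto
    show "(\<lambda>x. indicator ?B x * \<bar>torsion ?B x\<bar> powr ?p) \<in> borel_measurable lebesgue" by measurable
    have [measurable]: "?B \<in> sets borel" by simp
    show "(\<lambda>x. indicator ?B x * \<bar>?v x\<bar> powr ?p) \<in> borel_measurable lebesgue"
      by (rule borel_imp_lebesgue_measurable) measurable
  qed auto
  moreover have "(\<integral>x. q powr ?p * indicator ?B' x \<partial>lebesgue) \<le> (\<integral>x. indicator ?B x * \<bar>?v x\<bar> powr ?p \<partial>lebesgue)"
  proof (rule integral_mono')
    show "integrable lebesgue (\<lambda>x. indicator ?B x * \<bar>?v x\<bar> powr ?p)"
    proof (rule integrable_bounded_on_lmeasurable[OF _ lm(1), of _ 1])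
      show "(\<lambda>x. indicator ?B x * \<bar>?v x\<bar> powr ?p) \<in> borel_measurable lebesgue"
      proof -
        have [measurable]: "?B \<in> sets borel" by simp
        show ?thesis by (rule borel_imp_lebesgue_measurable) measurable
      qed
      fix x assume x: "x \<in> ?B"
      then have "0 \<le> 1 - (norm x)\<^sup>2" by (simp add: power_le_one)
      then have "\<bar>1 - (norm x)\<^sup>2\<bar> \<le> 2 * ?m" using m zero_le_power2[of "norm x"] by linarith
      then have "\<bar>?v x\<bar> \<le> 1" using m2 x by (simp add: abs_divide divide_le_eq)
      then have "\<bar>?v x\<bar> powr ?p \<le> 1 powr ?p" using m by (intro powr_mono2) auto
      then show "norm (indicator ?B x * \<bar>?v x\<bar> powr ?p) \<le> 1" using x by simp
    qed auto
    fix x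
    show "q powr ?p * indicator ?B' x \<le> indicator ?B x * \<bar>?v x\<bar> powr ?p"
    proof (cases "x \<in> ?B'")
      case True
      then have n: "norm x < 1 / 4" by simp
      then have "(norm x)\<^sup>2 \<le> (1 / 4)\<^sup>2" by (intro power_mono) auto
      then have "15 / 16 \<le> 1 - (norm x)\<^sup>2" by (simp add: power2_eq_square)
      then have "q \<le> (1 - (norm x)\<^sup>2) / (2 * ?m)" using m by (simp add: q_def field_simps)
      then have "q powr ?p \<le> \<bar>(1 - (norm x)\<^sup>2) / (2 * ?m)\<bar> powr ?p" using q m by (intro powr_mono2 order_trans[OF _ abs_ge_self]) auto
      moreover have "x \<in> ?B" using n by simp
      ultimately show ?thesis using True by simp
    qed auto
  qed auto
  moreover have "(\<integral>x. q powr ?p * indicator ?B' x \<partial>lebesgue) = q powr ?p * measure lebesgue ?B'"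
    by simp
  ultimately have "q powr ?p * (1 / 4) ^ DIM('a) \<le> (\<integral>x. indicator ?B x * \<bar>torsion ?B x\<bar> powr ?p \<partial>lebesgue) / measure lebesgue ?B"
    using vol by (simp add: le_divide_eq)
  then have "(q powr ?p * (1 / 4) powr ?m) powr (1 / ?p) \<le>
     ((\<integral>x. indicator ?B x * \<bar>torsion ?B x\<bar> powr ?p \<partial>lebesgue) / measure lebesgue ?B) powr (1 / ?p)"
    using q m by (intro powr_mono2) (auto simp: powr_realpow)
  moreover have "(q powr ?p * (1 / 4) powr ?m) powr (1 / ?p) = q * (1 / 4) powr (1 / 8)"
    using q m by (simp add: powr_mult powr_powr)
  ultimately have "lambda1 ?B * (q * (1 / 4) powr (1 / 8)) \<le> Fp ?p ?B"
    unfolding Fp_eq_average[OF vol(1)] using lambda1_ball_ge[OF m2] m by (intro mult_left_mono) auto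
  moreover have "1 < lambda1 ?B * (q * (1 / 4) powr (1 / 8))"
  proof -
    have "(1 / 4 :: real) powr (1 / 8) > 16 / 21"
    proof -
      have "((16 / 21 :: real) powr 8) powr (1 / 8) < (1 / 4) powr (1 / 8)"
        by (intro powr_less_mono2) (auto simp: powr_numeral power_divide)
      moreover have "((16 / 21 :: real) powr 8) powr (1 / 8) = 16 / 21" by (subst powr_powr) simp
      ultimately show ?thesis by simp
    qed
    then have "21 / 16 * (1 / 4 :: real) powr (1 / 8) > 1" by simp
    also have "21 / 16 = 14 / 5 * ?m * q" using m by (simp add: q_def)
    also have "14 / 5 * ?m * q * (1 / 4) powr (1 / 8) \<le> lambda1 ?B * q * (1 / 4) powr (1 / 8)"
      using lambda1_ball_ge[OF m2] q by (intro mult_right_mono) auto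
    finally show ?thesis by (simp add: mult.assoc)
  qed
  ultimately show ?thesis by simp
qed

section \<open>Integer periodic functions\<close>

definition lat :: "'a::euclidean_space set" where
  "lat = {k. \<forall>b\<in>Basis. k \<bullet> b \<in> \<int>}"

text \<open>Half-open, so that the lattice translates partition the space exactly and pointwise
  identities hold without exceptional sets.\<close>

definition cell :: "'a::euclidean_space set" where
  "cell = {x. \<forall>b\<in>Basis. 0 \<le> x \<bullet> b \<and> x \<bullet> b < 1}"

definition periodic :: "('a::euclidean_space \<Rightarrow> 'b) \<Rightarrow> bool" where
  "periodic f \<longleftrightarrow> (\<forall>k\<in>lat. \<forall>x. f (x + k) = f x)"

definition floor_vec :: "'a::euclidean_space \<Rightarrow> 'a" where
  "floor_vec x = (\<Sum>b\<in>Basis. of_int \<lfloor>x \<bullet> b\<rfloor> *\<^sub>R b)"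

lemma lat_0 [simp]: "0 \<in> lat" and lat_add: "k \<in> lat \<Longrightarrow> l \<in> lat \<Longrightarrow> k + l \<in> lat"
  and lat_uminus: "k \<in> lat \<Longrightarrow> - k \<in> lat"
  by (auto simp: lat_def inner_add_left)

lemma lat_diff: "k \<in> lat \<Longrightarrow> l \<in> lat \<Longrightarrow> k - l \<in> lat"
  by (auto simp: lat_def inner_diff_left)

lemma floor_vec_inner: "b \<in> Basis \<Longrightarrow> floor_vec x \<bullet> b = of_int \<lfloor>x \<bullet> b\<rfloor>"
  by (simp add: floor_vec_def inner_sum_left inner_Basis if_distrib sum.delta cong: if_cong)

lemma floor_vec_lat: "floor_vec x \<in> lat"
  by (auto simp: lat_def floor_vec_inner)

lemma diff_floor_vec_cell: "x - floor_vec x \<in> cell"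
  by (auto simp: cell_def inner_diff_left floor_vec_inner) linarith

lemma cell_lat_unique:
  assumes "x \<in> cell" "x + k \<in> cell" "k \<in> lat"
  shows "k = 0"
proof (rule euclidean_eqI)
  fix b :: 'a assume b: "b \<in> Basis"
  then obtain n :: int where n: "k \<bullet> b = of_int n" using assms(3) by (auto simp: lat_def elim: Ints_cases)
  have "0 \<le> x \<bullet> b" "x \<bullet> b < 1" "0 \<le> x \<bullet> b + k \<bullet> b" "x \<bullet> b + k \<bullet> b < 1"
    using assms(1,2) b by (auto simp: cell_def inner_add_left)
  then have "-1 < real_of_int n" "real_of_int n < 1" using n by linarith+
  then have "n = 0" by linarith
  then show "k \<bullet> b = 0 \<bullet> b" using n by simp
qed

lemma cell_norm: "x \<in> cell \<Longrightarrow> norm (x::'a::euclidean_space) \<le> real DIM('a)"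
proof -
  assume x: "x \<in> cell"
  have "norm x \<le> (\<Sum>b\<in>Basis. \<bar>x \<bullet> b\<bar>)" by (rule norm_le_l1)
  also have "\<dots> \<le> (\<Sum>b\<in>(Basis::'a set). 1)" using x by (intro sum_mono) (auto simp: cell_def abs_if dest!: bspec)
  finally show ?thesis by simp
qed

lemma cell_cbox: "cell \<subseteq> cbox 0 One" and box_cell: "box 0 One \<subseteq> cell"
  by (auto simp: cell_def cbox_def box_def less_imp_le)

lemma cell_borel [measurable]: "cell \<in> sets borel"
proof -
  have "cell = (\<Inter>b\<in>Basis. {x::'a. 0 \<le> x \<bullet> b} \<inter> {x. x \<bullet> b < 1})" by (auto simp: cell_def)
  also have "\<dots> \<in> sets borel"
    by (intro sets.finite_INT sets.Int borel_closed borel_open closed_Collect_le open_Collect_less continuous_intros) auto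
  finally show ?thesis .
qed

lemma AE_cell_box: "AE x in lebesgue. x \<in> cell \<longrightarrow> x \<in> box (0::'a::euclidean_space) One"
proof -
  have "cbox 0 (One::'a) - box 0 One \<in> null_sets lebesgue"
    using negligible_frontier_interval[of "0::'a" One] by (simp add: negligible_iff_null_sets)
  then have "AE x in lebesgue. x \<notin> cbox 0 (One::'a) - box 0 One" by (rule AE_not_in)
  then show ?thesis by eventually_elim (use cell_cbox in blast)
qed

lemma cell_lmeasurable: "cell \<in> lmeasurable"
  by (rule bounded_set_imp_lmeasurable[OF bounded_subset[OF bounded_cbox cell_cbox]]) simp

lemma measure_cell [simp]: "measure lebesgue (cell::'a::euclidean_space set) = 1"
proof (rule antisym)
  have "measure lebesgue (cell::'a set) \<le> measure lebesgue (cbox 0 (One::'a))"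
    by (rule measure_mono_fmeasurable[OF cell_cbox]) auto
  then show "measure lebesgue (cell::'a set) \<le> 1" by simp
  have "measure lebesgue (box 0 (One::'a)) \<le> measure lebesgue (cell::'a set)"
    by (rule measure_mono_fmeasurable[OF box_cell]) (auto simp: cell_lmeasurable)
  moreover have "measure lebesgue (box 0 (One::'a)) = 1" by (subst measure_completion) (auto simp: measure_lborel_box_eq)
  ultimately show "1 \<le> measure lebesgue (cell::'a set)" by simp
qed

lemma finite_lat_ball: "finite {k\<in>lat. norm (k::'a::euclidean_space) \<le> R}"
proof -
  define N where "N = \<lceil>R\<rceil>"
  have "{k\<in>lat. norm (k::'a) \<le> R} \<subseteq> (\<lambda>f. \<Sum>b\<in>Basis. of_int (f b) *\<^sub>R b) ` (PiE Basis (\<lambda>_. {-N..N}))"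
  proof
    fix k :: 'a assume k: "k \<in> {k\<in>lat. norm k \<le> R}"
    let ?f = "restrict (\<lambda>b. \<lfloor>k \<bullet> b\<rfloor>) Basis"
    have "\<bar>k \<bullet> b\<bar> \<le> R" if "b \<in> Basis" for b using Basis_le_norm[OF that, of k] k by simp
    moreover have "R \<le> of_int N" by (simp add: N_def)
    ultimately have "of_int (- N) \<le> k \<bullet> b \<and> k \<bullet> b \<le> of_int N" if "b \<in> Basis" for b
      using that by (smt (verit) of_int_minus)
    then have "- N \<le> \<lfloor>k \<bullet> b\<rfloor> \<and> \<lfloor>k \<bullet> b\<rfloor> \<le> N" if "b \<in> Basis" for b
      using that by (metis floor_mono floor_of_int)
    then have "?f \<in> PiE Basis (\<lambda>_. {-N..N})" by auto
    moreover have "k = (\<Sum>b\<in>Basis. of_int (?f b) *\<^sub>R b)"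
    proof -
      have "of_int \<lfloor>k \<bullet> b\<rfloor> = k \<bullet> b" if "b \<in> Basis" for b
        using k that by (auto simp: lat_def elim!: Ints_cases dest!: bspec)
      then have "(\<Sum>b\<in>Basis. of_int (?f b) *\<^sub>R b) = (\<Sum>b\<in>Basis. (k \<bullet> b) *\<^sub>R b)" by (intro sum.cong) auto
      then show ?thesis by (simp add: euclidean_representation)
    qed
    ultimately show "k \<in> (\<lambda>f. \<Sum>b\<in>Basis. of_int (f b) *\<^sub>R b) ` (PiE Basis (\<lambda>_. {-N..N}))" by blast
  qed
  then show ?thesis by (rule finite_subset) (intro finite_imageI finite_PiE; simp)
qed

text \<open>Finite sums stand in for lattice sums: points of the cell have norm at most m, so only
  lattice vectors of norm at most R + m can carry the cell to a point of norm at most R. A larger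
  \<open>F\<close> is allowed, so that several functions can share one.\<close>

lemma lat_translates_partition:
  fixes y :: "'a::euclidean_space"
  assumes F: "finite F" "F \<subseteq> lat" "{k\<in>lat. norm k \<le> R + real DIM('a)} \<subseteq> F" and y: "norm y \<le> R"
  shows "(\<Sum>k\<in>F. indicator cell (y - k)) = (1::real)"
proof -
  let ?k = "floor_vec y"
  have "norm ?k = norm (y - (y - ?k))" by simp
  also have "\<dots> \<le> norm y + norm (y - ?k)" by (rule norm_triangle_ineq4)
  also have "\<dots> \<le> R + real DIM('a)" using y cell_norm[OF diff_floor_vec_cell[of y]] by linarith
  finally have k: "?k \<in> F" using F(3) floor_vec_lat by blast
  have "indicator cell (y - l) = (0::real)" if "l \<in> F - {?k}" for l
  proof -
    have "y - l \<notin> cell"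
    proof
      assume "y - l \<in> cell"
      moreover have "y - ?k = (y - l) + (l - ?k)" by simp
      ultimately have "l - ?k = 0"
        using cell_lat_unique[of "y - l" "l - ?k"] diff_floor_vec_cell[of y] lat_diff[OF _ floor_vec_lat] that F(2) by auto
      then show False using that by simp
    qed
    then show ?thesis by simp
  qed
  then have "(\<Sum>k\<in>F. indicator cell (y - k)) = (indicator cell (y - ?k) :: real)"
    using F(1) k by (subst sum.remove[OF F(1) k]) simp
  then show ?thesis using diff_floor_vec_cell[of y] by simp
qed

text \<open>Shift each term back by \<open>k\<close>; the shifted cells have indicator sum 1 on a
  ball that contains the support.\<close>

lemma integral_unfold_cell:
  fixes g :: "'a::euclidean_space \<Rightarrow> real"
  assumes [measurable]: "g \<in> borel_measurable borel" and int: "integrable lebesgue g"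
    and supp: "\<And>x. R < norm x \<Longrightarrow> g x = 0"
    and F: "finite F" "F \<subseteq> lat" "{k\<in>lat. norm k \<le> R + real DIM('a)} \<subseteq> F"
  shows "(\<integral>x. indicator cell x * (\<Sum>k\<in>F. g (x + k)) \<partial>lebesgue) = (\<integral>x. g x \<partial>lebesgue)"
    and "integrable lebesgue (\<lambda>x. indicator cell x * (\<Sum>k\<in>F. g (x + k)))"
proof -
  have ik: "integrable lebesgue (\<lambda>y. indicator cell (y - k) * g y)" for k
  proof -
    have "(\<lambda>y. indicator cell (y - k) * g y) \<in> borel_measurable lebesgue"
      by (rule borel_imp_lebesgue_measurable) measurable
    then show ?thesis
      by (rule Bochner_Integration.integrable_bound[OF int]) (auto simp: indicator_def)
  qed
  have tr: "integrable lebesgue (\<lambda>x. indicator cell x * g (x + k))"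
    "(\<integral>x. indicator cell x * g (x + k) \<partial>lebesgue) = (\<integral>y. indicator cell (y - k) * g y \<partial>lebesgue)" for k
    using lebesgue_integrable_translate[OF _ ik[of k], of k] lebesgue_integral_translate[of "\<lambda>y. indicator cell (y - k) * g y" k]
    by auto
  show "integrable lebesgue (\<lambda>x. indicator cell x * (\<Sum>k\<in>F. g (x + k)))"
    unfolding sum_distrib_left by (intro Bochner_Integration.integrable_sum tr)
  have "(\<integral>x. indicator cell x * (\<Sum>k\<in>F. g (x + k)) \<partial>lebesgue) = (\<Sum>k\<in>F. \<integral>x. indicator cell x * g (x + k) \<partial>lebesgue)"
    unfolding sum_distrib_left by (rule Bochner_Integration.integral_sum) (rule tr)
  also have "\<dots> = (\<Sum>k\<in>F. \<integral>y. indicator cell (y - k) * g y \<partial>lebesgue)" by (simp only: tr)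
  also have "\<dots> = (\<integral>y. (\<Sum>k\<in>F. indicator cell (y - k) * g y) \<partial>lebesgue)"
    by (rule Bochner_Integration.integral_sum[symmetric]) (rule ik)
  also have "\<dots> = (\<integral>y. g y \<partial>lebesgue)"
  proof (rule Bochner_Integration.integral_cong[OF refl])
    fix y
    show "(\<Sum>k\<in>F. indicator cell (y - k) * g y) = g y"
      using lat_translates_partition[OF F, of y] supp[of y]
      by (cases "norm y \<le> R") (auto simp: sum_distrib_right[symmetric])
  qed
  finally show "(\<integral>x. indicator cell x * (\<Sum>k\<in>F. g (x + k)) \<partial>lebesgue) = (\<integral>x. g x \<partial>lebesgue)" .
qed

lemma periodic_bounded:
  fixes f :: "'a::euclidean_space \<Rightarrow> 'b::euclidean_space"
  assumes "periodic f" "continuous_on UNIV f"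
  obtains C where "C > 0" "\<And>x. norm (f x) \<le> C"
proof -
  have "bounded (f ` cbox 0 One)"
    by (intro compact_imp_bounded compact_continuous_image continuous_on_subset[OF assms(2)]) auto
  then obtain C where C: "\<And>x. x \<in> cbox 0 One \<Longrightarrow> norm (f x) \<le> C" by (auto simp: bounded_iff)
  have "norm (f x) \<le> max C 1" for x
  proof -
    have "f x = f ((x - floor_vec x) + floor_vec x)" by simp
    also have "\<dots> = f (x - floor_vec x)" using assms(1) floor_vec_lat unfolding periodic_def by blast
    finally show ?thesis using C[of "x - floor_vec x"] diff_floor_vec_cell[of x] cell_cbox by force
  qed
  then show thesis using that[of "max C 1"] by auto
qed

lemma periodic_grad:
  assumes "periodic u" "smooth_fun u"
  shows "periodic (grad u)"
  unfolding periodic_def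
proof (intro ballI allI)
  fix k :: 'a and x assume k: "k \<in> lat"
  have "u = (\<lambda>x. u (x + k))" using assms(1) k by (auto simp: periodic_def)
  then show "grad u (x + k) = grad u x" using grad_translate[OF assms(2), of k x] by simp
qed

lemma integrable_cell_continuous:
  fixes f :: "'a::euclidean_space \<Rightarrow> real"
  assumes "continuous_on UNIV f"
  shows "integrable lebesgue (\<lambda>x. indicator cell x * f x)"
proof -
  have "bounded (f ` cbox 0 One)"
    by (intro compact_imp_bounded compact_continuous_image continuous_on_subset[OF assms]) auto
  then obtain C where C: "\<And>x. x \<in> cbox 0 One \<Longrightarrow> norm (f x) \<le> C" by (auto simp: bounded_iff)
  have [measurable]: "f \<in> borel_measurable borel" by (rule borel_measurable_continuous_onI[OF assms])
  show ?thesis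
    by (rule integrable_bounded_on_lmeasurable[OF _ cell_lmeasurable, of _ C])
      (use C cell_cbox in \<open>auto intro!: borel_imp_lebesgue_measurable\<close>)
qed

text \<open>Restrict \<open>f\<close> to the shifted cell, which gives a function of bounded
  support, and unfold it over the lattice: by periodicity \<open>f\<close> factors out, and the
  indicators sum to 1.\<close>

lemma integral_cell_translate:
  fixes f :: "'a::euclidean_space \<Rightarrow> real"
  assumes per: "periodic f" and cont: "continuous_on UNIV f"
  shows "(\<integral>x. indicator cell x * f (x + h) \<partial>lebesgue) = (\<integral>x. indicator cell x * f x \<partial>lebesgue)"
proof -
  have [measurable]: "f \<in> borel_measurable borel" by (rule borel_measurable_continuous_onI[OF cont])
  let ?g = "\<lambda>y. indicator cell (y - h) * f y"
  let ?m = "real DIM('a)"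
  have eq: "(\<integral>x. indicator cell x * f (x + h) \<partial>lebesgue) = (\<integral>y. ?g y \<partial>lebesgue)"
    using lebesgue_integral_translate[of ?g h] by simp
  let ?F = "{k\<in>lat. norm k \<le> (norm h + ?m) + ?m}"
  have ig: "integrable lebesgue ?g"
  proof -
    have "continuous_on UNIV (\<lambda>x. f (x + h))"
      by (rule continuous_on_compose2[OF cont]) (auto intro!: continuous_intros)
    from lebesgue_integrable_translate[OF _ integrable_cell_continuous[OF this], of "- h"]
    show ?thesis by simp
  qed
  have out: "?g x = 0" if "norm h + ?m < norm x" for x
  proof -
    have "norm (x - h) > ?m" using that norm_triangle_ineq2[of x h] by linarith
    then show ?thesis using cell_norm[of "x - h"] by (auto simp: indicator_def)
  qed
  have "(\<integral>y. ?g y \<partial>lebesgue) = (\<integral>x. indicator cell x * (\<Sum>k\<in>?F. ?g (x + k)) \<partial>lebesgue)"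
    by (rule integral_unfold_cell(1)[symmetric, OF _ ig out finite_lat_ball]) auto
  also have "\<dots> = (\<integral>x. indicator cell x * f x \<partial>lebesgue)"
  proof (rule Bochner_Integration.integral_cong[OF refl])
    fix x :: 'a
    show "indicator cell x * (\<Sum>k\<in>?F. ?g (x + k)) = indicator cell x * f x"
    proof (cases "x \<in> cell")
      case True
      have "(\<Sum>k\<in>?F. ?g (x + k)) = (\<Sum>k\<in>?F. indicator cell (x + k - h) * f x)"
        using per by (intro sum.cong) (auto simp: periodic_def)
      also have "\<dots> = f x * (\<Sum>k\<in>?F. indicator cell (x + k - h))" by (simp add: sum_distrib_left mult.commute)
      also have "(\<Sum>k\<in>?F. indicator cell (x + k - h)) = (\<Sum>k\<in>?F. indicator cell ((x - h) - k) :: real)"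
        by (rule sum.reindex_bij_witness[of _ uminus uminus]) (auto simp: lat_uminus algebra_simps)
      also have "\<dots> = 1"
        using norm_triangle_ineq4[of x h] cell_norm[OF True]
        by (intro lat_translates_partition[of _ "norm h + ?m"] finite_lat_ball) auto
      finally show ?thesis by simp
    qed simp
  qed
  finally show ?thesis using eq by simp
qed

section \<open>Boxes made of lattice cells\<close>

definition big_cell :: "nat \<Rightarrow> 'a::euclidean_space set" where
  "big_cell N = {x. \<forall>b\<in>Basis. 0 \<le> x \<bullet> b \<and> x \<bullet> b < real N}"

lemma indicator_big_cell: "N > 0 \<Longrightarrow> indicator (big_cell N) x = indicator cell ((1 / real N) *\<^sub>R x)"
  by (auto simp: big_cell_def cell_def indicator_def field_simps)

lemma integral_big_cell_scale:
  fixes f :: "'a::euclidean_space \<Rightarrow> real"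
  assumes [measurable]: "f \<in> borel_measurable borel" and N: "N > 0"
  shows "(\<integral>x. indicator (big_cell N) x * f ((1 / real N) *\<^sub>R x) \<partial>lebesgue) = real N ^ DIM('a) * (\<integral>x. indicator cell x * f x \<partial>lebesgue)"
  using lebesgue_integral_scale[of "\<lambda>x. indicator cell x * f x" "1 / real N"] N
  by (simp add: indicator_big_cell field_simps)

lemma big_cell_lmeasurable: "big_cell N \<in> lmeasurable"
proof -
  have "big_cell N = (\<Inter>b\<in>Basis. {x::'a. 0 \<le> x \<bullet> b} \<inter> {x. x \<bullet> b < real N})" by (auto simp: big_cell_def)
  also have "\<dots> \<in> sets borel"
    by (intro sets.finite_INT sets.Int borel_closed borel_open closed_Collect_le open_Collect_less continuous_intros) auto
  finally have 1: "(big_cell N::'a set) \<in> sets borel" .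
  have "big_cell N \<subseteq> cbox 0 (real N *\<^sub>R One :: 'a)" by (auto simp: big_cell_def cbox_def less_imp_le)
  then have "bounded (big_cell N::'a set)" by (rule bounded_subset[OF bounded_cbox])
  then show ?thesis using 1 by (intro bounded_set_imp_lmeasurable) auto
qed

lemma measure_big_cell: "N > 0 \<Longrightarrow> measure lebesgue (big_cell N::'a::euclidean_space set) = real N ^ DIM('a)"
  using integral_big_cell_scale[of "\<lambda>_::'a. 1" N] cell_lmeasurable[where 'a='a] big_cell_lmeasurable[where 'a='a, of N]
  by (simp add: fmeasurable_def)

text \<open>No lattice points are counted explicitly: unfolding yields the identity with their
  number in the box as factor, and the constant function 1, whose integral is known from scaling,
  determines it.\<close>

lemma integral_big_cell_periodic:
  fixes f :: "'a::euclidean_space \<Rightarrow> real"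
  assumes per: "periodic f" and cont: "continuous_on UNIV f" and N: "N > 0"
  shows "(\<integral>x. indicator (big_cell N) x * f x \<partial>lebesgue) = real N ^ DIM('a) * (\<integral>x. indicator cell x * f x \<partial>lebesgue)"
    and "integrable lebesgue (\<lambda>x. indicator (big_cell N) x * f x)"
proof -
  let ?m = "real DIM('a)"
  define F where "F = {k\<in>lat. norm (k::'a) \<le> real N * ?m + ?m}"
  have F: "finite F" "F \<subseteq> lat" "{k\<in>lat. norm k \<le> real N * ?m + ?m} \<subseteq> F"
    by (auto simp: F_def finite_lat_ball)
  have bn: "norm x \<le> real N * ?m" if "x \<in> big_cell N" for x :: 'a
  proof -
    have "(1 / real N) *\<^sub>R x \<in> cell" using that N by (simp add: big_cell_def cell_def field_simps)
    from cell_norm[OF this] show ?thesis using N by (simp add: field_simps)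
  qed
  have key: "(\<integral>x. indicator (big_cell N) x * g x \<partial>lebesgue) = (\<Sum>k\<in>F. indicator (big_cell N) k) * (\<integral>x. indicator cell x * g x \<partial>lebesgue)"
    and int: "integrable lebesgue (\<lambda>x. indicator (big_cell N) x * g x)"
    if g: "periodic g" "continuous_on UNIV g" for g :: "'a \<Rightarrow> real"
  proof -
    have [measurable]: "g \<in> borel_measurable borel" by (rule borel_measurable_continuous_onI[OF g(2)])
    have [measurable]: "(big_cell N::'a set) \<in> sets borel"
    proof -
      have "big_cell N = (\<lambda>x::'a. (1 / real N) *\<^sub>R x) -` cell \<inter> space borel"
        using N by (auto simp: big_cell_def cell_def field_simps)
      also have "\<dots> \<in> sets borel" by measurable
      finally show ?thesis .
    qed
    obtain C where C: "\<And>x. norm (g x) \<le> C" using periodic_bounded[OF g] by blast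
    show int: "integrable lebesgue (\<lambda>x. indicator (big_cell N) x * g x)"
      by (rule integrable_bounded_on_lmeasurable[OF _ big_cell_lmeasurable[of N], of _ C])
        (use C in \<open>auto intro!: borel_imp_lebesgue_measurable\<close>)
    have "(\<integral>x. indicator (big_cell N) x * g x \<partial>lebesgue) = (\<integral>x. indicator cell x * (\<Sum>k\<in>F. indicator (big_cell N) (x + k) * g (x + k)) \<partial>lebesgue)"
      by (rule integral_unfold_cell(1)[symmetric, OF _ int _ F]) (use bn in \<open>force simp: indicator_def\<close>)+
    also have "\<dots> = (\<integral>x. (\<Sum>k\<in>F. indicator (big_cell N) k) * (indicator cell x * g x) \<partial>lebesgue)"
    proof (rule Bochner_Integration.integral_cong[OF refl])
      fix x :: 'a
      show "indicator cell x * (\<Sum>k\<in>F. indicator (big_cell N) (x + k) * g (x + k)) = (\<Sum>k\<in>F. indicator (big_cell N) k) * (indicator cell x * g x)"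
      proof (cases "x \<in> cell")
        case True
        have "indicator (big_cell N) (x + k) * g (x + k) = indicator (big_cell N) k * g x" if "k \<in> F" for k
        proof -
          have kl: "k \<in> lat" using that F(2) by blast
          have "x + k \<in> big_cell N \<longleftrightarrow> k \<in> big_cell N"
          proof -
            have "(0 \<le> (x + k) \<bullet> b \<and> (x + k) \<bullet> b < real N) = (0 \<le> k \<bullet> b \<and> k \<bullet> b < real N)" if b: "b \<in> Basis" for b
            proof -
              obtain n :: int where n: "k \<bullet> b = of_int n" using kl b by (auto simp: lat_def elim: Ints_cases)
              have x: "0 \<le> x \<bullet> b" "x \<bullet> b < 1" using True b by (auto simp: cell_def)
              have "0 \<le> x \<bullet> b + of_int n \<longleftrightarrow> 0 \<le> n" using x by linarith
              moreover have "x \<bullet> b + of_int n < real N \<longleftrightarrow> n < int N" using x by linarith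
              ultimately show ?thesis by (simp add: inner_add_left n) linarith
            qed
            then show ?thesis by (simp add: big_cell_def)
          qed
          then show ?thesis using g(1) kl by (simp add: periodic_def indicator_def)
        qed
        then show ?thesis using True by (simp add: sum_distrib_right)
      qed simp
    qed
    also have "\<dots> = (\<Sum>k\<in>F. indicator (big_cell N) k) * (\<integral>x. indicator cell x * g x \<partial>lebesgue)"
      by (rule integral_mult_right_zero)
    finally show "(\<integral>x. indicator (big_cell N) x * g x \<partial>lebesgue) = (\<Sum>k\<in>F. indicator (big_cell N) k) * (\<integral>x. indicator cell x * g x \<partial>lebesgue)" .
  qed
  have "(\<Sum>k\<in>F. indicator (big_cell N) k) = real N ^ DIM('a)"
    using key[of "\<lambda>_. 1"] measure_big_cell[OF N, where 'a='a] by (simp add: periodic_def)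
  then show "(\<integral>x. indicator (big_cell N) x * f x \<partial>lebesgue) = real N ^ DIM('a) * (\<integral>x. indicator cell x * f x \<partial>lebesgue)"
    using key[OF per cont] by simp
  show "integrable lebesgue (\<lambda>x. indicator (big_cell N) x * f x)" by (rule int[OF per cont])
qed

section \<open>Poincare inequality on the cell\<close>

abbreviation cell_mass :: "('a::euclidean_space \<Rightarrow> real) \<Rightarrow> real" where
  "cell_mass u \<equiv> \<integral>x. indicator cell x * (u x)\<^sup>2 \<partial>lebesgue"

abbreviation cell_energy :: "('a::euclidean_space \<Rightarrow> real) \<Rightarrow> real" where
  "cell_energy u \<equiv> \<integral>x. indicator cell x * (norm (grad u x))\<^sup>2 \<partial>lebesgue"

lemma periodic_translation_bound:
  fixes u :: "'a::euclidean_space \<Rightarrow> real"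
  assumes u: "smooth_fun u" "periodic u"
  shows "(\<integral>x. indicator cell x * (u (x + h) - u x)\<^sup>2 \<partial>lebesgue) \<le> (norm h)\<^sup>2 * cell_energy u"
proof -
  obtain C where C: "\<And>x. norm (grad u x) \<le> C"
    using periodic_bounded[OF periodic_grad[OF u(2,1)] continuous_grad[OF u(1)]] by blast
  have "(\<integral>x. indicator cell x * (u (x + h) - u x)\<^sup>2 \<partial>lebesgue) \<le> (\<integral>x. indicator cell x * (grad u x \<bullet> h)\<^sup>2 \<partial>lebesgue)"
  proof (rule translation_square_bound[OF u(1) C cell_lmeasurable])
    fix n k :: nat
    let ?t = "real k / real (Suc n)"
    let ?f = "\<lambda>x. (u (x + (1 / real (Suc n)) *\<^sub>R h) - u x)\<^sup>2"
    have "periodic ?f"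
      unfolding periodic_def
    proof (intro ballI allI)
      fix l :: 'a and x assume l: "l \<in> lat"
      have "u (x + l + v) = u (x + v)" for v
        using u(2) l unfolding periodic_def by (metis add.assoc add.commute)
      then show "?f (x + l) = ?f x" using u(2) l by (simp add: periodic_def)
    qed
    moreover have "continuous_on UNIV ?f"
      by (intro continuous_intros smooth_fun_continuous smooth_translate u)
    ultimately have "(\<integral>x. indicator cell x * ?f (x + ?t *\<^sub>R h) \<partial>lebesgue) = (\<integral>x. indicator cell x * ?f x \<partial>lebesgue)"
      by (rule integral_cell_translate)
    moreover have "?f (x + ?t *\<^sub>R h) = (u (x + (real (Suc k) / real (Suc n)) *\<^sub>R h) - u (x + ?t *\<^sub>R h))\<^sup>2" for x
      by (simp add: add_divide_distrib algebra_simps)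
    ultimately show "(\<integral>x. indicator cell x * (u (x + (real (Suc k) / real (Suc n)) *\<^sub>R h) - u (x + ?t *\<^sub>R h))\<^sup>2 \<partial>lebesgue) =
      (\<integral>x. indicator cell x * ?f x \<partial>lebesgue)" by simp
  qed
  also have "\<dots> \<le> (\<integral>x. (norm h)\<^sup>2 * (indicator cell x * (norm (grad u x))\<^sup>2) \<partial>lebesgue)"
  proof (rule integral_mono')
    show "integrable lebesgue (\<lambda>x. (norm h)\<^sup>2 * (indicator cell x * (norm (grad u x))\<^sup>2))"
      by (intro integrable_mult_right integrable_cell_continuous continuous_intros continuous_grad u)
    fix x
    have "(grad u x \<bullet> h)\<^sup>2 \<le> (norm h)\<^sup>2 * (norm (grad u x))\<^sup>2"
      using Cauchy_Schwarz_ineq[of "grad u x" h] by (simp add: power2_norm_eq_inner mult.commute)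
    then show "indicator cell x * (grad u x \<bullet> h)\<^sup>2 \<le> (norm h)\<^sup>2 * (indicator cell x * (norm (grad u x))\<^sup>2)"
      by (auto simp: indicator_def)
  qed auto
  finally show ?thesis by simp
qed

lemma periodic_compose:
  assumes "periodic u"
  shows "periodic (\<lambda>x. f (u x))"
  using assms by (simp add: periodic_def)

text \<open>Averaging the squared increments as on the whole space, but over \<open>h\<close> in the
  cell: the mean correlation on the torus is exactly the square of the integral of \<open>u\<close>.
  The constant comes from |h| \<le> m on the cell; nonnegativity of \<open>u\<close> lets Tonelli
  work in \<open>ennreal\<close>.\<close>

lemma periodic_poincare:
  fixes u :: "'a::euclidean_space \<Rightarrow> real"
  assumes u: "smooth_fun u" "periodic u" "\<And>x. 0 \<le> u x"
  shows "cell_mass u - (\<integral>x. indicator cell x * u x \<partial>lebesgue)\<^sup>2 \<le> (real DIM('a))\<^sup>2 / 2 * cell_energy u"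
proof -
  let ?m = "real DIM('a)"
  define A where "A = (\<integral>x. indicator cell x * u x \<partial>lebesgue)"
  define k where "k = max 0 (cell_mass u - ?m\<^sup>2 / 2 * cell_energy u)"
  have cont: "continuous_on UNIV u" by (rule smooth_fun_continuous[OF u(1)])
  have ct: "continuous_on UNIV (\<lambda>x. u (x + h))" for h by (intro smooth_fun_continuous smooth_translate u)
  have [measurable]: "u \<in> borel_measurable borel" by (rule borel_measurable_continuous_onI[OF cont])
  have E0: "cell_energy u \<ge> 0" by (intro integral_nonneg_AE) auto
  have A0: "A \<ge> 0" unfolding A_def by (intro integral_nonneg_AE) (use u(3) in auto)
  have corr: "ennreal k \<le> (\<integral>\<^sup>+x. ennreal (indicator cell x * u x * u (x + h)) \<partial>lborel)" if h: "h \<in> cell" for h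
  proof -
    have i: "integrable lebesgue (\<lambda>x. indicator cell x * (u x * u (x + h)))"
      by (intro integrable_cell_continuous continuous_intros cont ct)
    have "(\<integral>x. indicator cell x * (u (x + h) - u x)\<^sup>2 \<partial>lebesgue) =
      (\<integral>x. indicator cell x * (u (x + h))\<^sup>2 + indicator cell x * (u x)\<^sup>2 - 2 * (indicator cell x * (u x * u (x + h))) \<partial>lebesgue)"
      by (intro Bochner_Integration.integral_cong) (auto simp: power2_diff algebra_simps)
    also have "\<dots> = (\<integral>x. indicator cell x * (u (x + h))\<^sup>2 \<partial>lebesgue) + cell_mass u - 2 * (\<integral>x. indicator cell x * (u x * u (x + h)) \<partial>lebesgue)"
      using i integrable_cell_continuous[OF continuous_on_power[OF ct[of h], of 2]]
        integrable_cell_continuous[OF continuous_on_power[OF cont, of 2]] by simp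
    also have "(\<integral>x. indicator cell x * (u (x + h))\<^sup>2 \<partial>lebesgue) = cell_mass u"
      using integral_cell_translate[of "\<lambda>x. (u x)\<^sup>2" h] periodic_compose[OF u(2), of "\<lambda>t. t\<^sup>2"] cont
      by (simp add: continuous_on_power)
    finally have "2 * cell_mass u - 2 * (\<integral>x. indicator cell x * (u x * u (x + h)) \<partial>lebesgue) \<le> (norm h)\<^sup>2 * cell_energy u"
      using periodic_translation_bound[OF u(1,2), of h] by simp
    also have "\<dots> \<le> ?m\<^sup>2 * cell_energy u" using cell_norm[OF h] E0 by (intro mult_right_mono power_mono) auto
    finally have "cell_mass u - ?m\<^sup>2 / 2 * cell_energy u \<le> (\<integral>x. indicator cell x * (u x * u (x + h)) \<partial>lebesgue)" by simp
    moreover have "0 \<le> (\<integral>x. indicator cell x * (u x * u (x + h)) \<partial>lebesgue)"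
      using u(3) by (intro integral_nonneg_AE) auto
    ultimately have "k \<le> (\<integral>x. indicator cell x * (u x * u (x + h)) \<partial>lebesgue)" by (simp add: k_def)
    moreover have "(\<integral>\<^sup>+x. ennreal (indicator cell x * (u x * u (x + h))) \<partial>lebesgue) = ennreal (\<integral>x. indicator cell x * (u x * u (x + h)) \<partial>lebesgue)"
      using u(3) by (intro nn_integral_eq_integral i) auto
    ultimately show ?thesis by (simp add: nn_integral_completion mult.assoc ennreal_leI)
  qed
  have inner: "(\<integral>\<^sup>+h. ennreal (indicator cell h * u (x + h)) \<partial>lborel) = ennreal A" for x
  proof -
    have "(\<integral>\<^sup>+h. ennreal (indicator cell h * u (h + x)) \<partial>lebesgue) = ennreal (\<integral>h. indicator cell h * u (h + x) \<partial>lebesgue)"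
      using u(3) by (intro nn_integral_eq_integral integrable_cell_continuous ct) auto
    also have "(\<integral>h. indicator cell h * u (h + x) \<partial>lebesgue) = A"
      unfolding A_def by (rule integral_cell_translate[OF u(2) cont])
    finally show ?thesis by (simp add: nn_integral_completion add.commute)
  qed
  have "ennreal k = (\<integral>\<^sup>+h. ennreal k * indicator (cell::'a set) h \<partial>lborel)"
  proof -
    have "emeasure lborel (cell::'a set) = 1"
    proof -
      have "emeasure lebesgue (cell::'a set) = 1"
        using emeasure_eq_ennreal_measure[OF fmeasurableD2[OF cell_lmeasurable[where 'a='a]]] by simp
      then show ?thesis by (simp add: cell_borel)
    qed
    then show ?thesis by (simp add: nn_integral_cmult_indicator)
  qed
  also have "\<dots> \<le> (\<integral>\<^sup>+h. \<integral>\<^sup>+x. ennreal (indicator cell x * u x) * ennreal (indicator cell h * u (x + h)) \<partial>lborel \<partial>lborel)"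
  proof (rule nn_integral_mono)
    fix h :: 'a
    show "ennreal k * indicator cell h \<le> (\<integral>\<^sup>+x. ennreal (indicator cell x * u x) * ennreal (indicator cell h * u (x + h)) \<partial>lborel)"
    proof (cases "h \<in> cell")
      case True
      then show ?thesis using corr[OF True] u(3) by (simp add: ennreal_mult'[symmetric])
    qed simp
  qed
  also have "\<dots> = (\<integral>\<^sup>+x. \<integral>\<^sup>+h. ennreal (indicator cell x * u x) * ennreal (indicator cell h * u (x + h)) \<partial>lborel \<partial>lborel)"
    by (rule lborel_pair.Fubini') measurable
  also have "\<dots> = (\<integral>\<^sup>+x. ennreal (indicator cell x * u x) * (\<integral>\<^sup>+h. ennreal (indicator cell h * u (x + h)) \<partial>lborel) \<partial>lborel)"
    by (intro nn_integral_cong nn_integral_cmult) measurable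
  also have "\<dots> = (\<integral>\<^sup>+x. ennreal (indicator cell x * u x) \<partial>lborel) * ennreal A"
    unfolding inner by (rule nn_integral_multc) measurable
  also have "(\<integral>\<^sup>+x. ennreal (indicator cell x * u x) \<partial>lborel) = ennreal A"
    using inner[of 0] by simp
  finally have "k \<le> A * A" using A0 by (simp add: ennreal_mult[symmetric])
  moreover have "cell_mass u - ?m\<^sup>2 / 2 * cell_energy u \<le> k" by (simp add: k_def)
  ultimately show ?thesis by (simp add: A_def power2_eq_square)
qed

section \<open>Periodization\<close>

text \<open>Meant for \<psi> vanishing beyond radius \<open>R\<close>, where it is the full lattice
  sum. The cutoff depends on \<open>x + k\<close> only, which keeps the sum finite and exactly
  periodic.\<close>

definition periodize :: "real \<Rightarrow> ('a::euclidean_space \<Rightarrow> real) \<Rightarrow> 'a \<Rightarrow> real" where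
  "periodize R \<psi> x = (\<Sum>k | k \<in> lat \<and> norm (x + k) \<le> R. \<psi> (x + k))"

lemma periodize_eq:
  fixes x :: "'a::euclidean_space"
  assumes \<psi>: "\<And>x. R < norm x \<Longrightarrow> \<psi> x = 0" and F: "finite F" "F \<subseteq> lat" "{k\<in>lat. norm k \<le> R + T} \<subseteq> F"
    and x: "norm x \<le> T"
  shows "periodize R \<psi> x = (\<Sum>k\<in>F. \<psi> (x + k))"
  unfolding periodize_def
proof (rule sum.mono_neutral_left[OF F(1)])
  show "{k. k \<in> lat \<and> norm (x + k) \<le> R} \<subseteq> F"
  proof
    fix k assume k: "k \<in> {k. k \<in> lat \<and> norm (x + k) \<le> R}"
    have "norm k \<le> norm (x + k) + norm x" using norm_triangle_ineq4[of "x + k" x] by simp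
    then show "k \<in> F" using F(3) k x by auto
  qed
  show "\<forall>k\<in>F - {k. k \<in> lat \<and> norm (x + k) \<le> R}. \<psi> (x + k) = 0"
    using F(2) \<psi> by (auto simp: not_le subset_iff)
qed

lemma periodize_smooth:
  fixes \<psi> :: "'a::euclidean_space \<Rightarrow> real"
  assumes \<psi>: "\<And>x. R < norm x \<Longrightarrow> \<psi> x = 0" and s: "smooth_fun \<psi>"
  shows "smooth_fun (periodize R \<psi>)"
proof (rule smooth_local)
  fix x :: 'a
  let ?T = "norm x + 1"
  let ?F = "{k\<in>lat. norm (k::'a) \<le> R + ?T}"
  have "periodize R \<psi> y = (\<Sum>k\<in>?F. \<psi> (y + k))" if "y \<in> ball 0 ?T" for y
    by (rule periodize_eq[where T="?T", OF \<psi> finite_lat_ball]) (use that in auto)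
  moreover have "smooth_fun (\<lambda>y. \<Sum>k\<in>?F. \<psi> (y + k))" by (intro smooth_sum smooth_translate s)
  ultimately show "\<exists>U g. open U \<and> x \<in> U \<and> smooth_fun g \<and> (\<forall>y\<in>U. periodize R \<psi> y = g y)"
    by (intro exI[of _ "ball 0 ?T"] exI[of _ "\<lambda>y. \<Sum>k\<in>?F. \<psi> (y + k)"]) simp
qed

lemma periodize_grad:
  fixes x :: "'a::euclidean_space"
  assumes \<psi>: "\<And>x. R < norm x \<Longrightarrow> \<psi> x = 0" and s: "smooth_fun \<psi>"
    and F: "finite F" "F \<subseteq> lat" "{k\<in>lat. norm k \<le> R + T} \<subseteq> F" and x: "norm x < T"
  shows "grad (periodize R \<psi>) x = (\<Sum>k\<in>F. grad \<psi> (x + k))"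
proof -
  have sk: "smooth_fun (\<lambda>y. \<psi> (y + k))" for k by (rule smooth_translate[OF s])
  have "grad (periodize R \<psi>) x = grad (\<lambda>y. \<Sum>k\<in>F. \<psi> (y + k)) x"
    by (rule grad_eq_on_open[of "ball 0 T"])
      (use x in \<open>auto intro!: periodize_eq[OF \<psi> F] smooth_fun_differentiable smooth_sum sk\<close>)
  also have "\<dots> = (\<Sum>k\<in>F. grad (\<lambda>y. \<psi> (y + k)) x)"
    by (rule grad_sum[OF F(1)]) (rule smooth_fun_differentiable[OF sk])
  finally show ?thesis by (simp add: grad_translate[OF s])
qed

lemma periodize_periodic: "periodic (periodize R \<psi>)"
  unfolding periodic_def
proof (intro ballI allI)
  fix l :: 'a and x assume l: "l \<in> lat"
  show "periodize R \<psi> (x + l) = periodize R \<psi> x"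
    unfolding periodize_def
    by (rule sum.reindex_bij_witness[of _ "\<lambda>k. k - l" "\<lambda>k. k + l"])
      (use l in \<open>auto simp: lat_add lat_diff algebra_simps\<close>)
qed

lemma periodize_nonneg: "(\<And>x. 0 \<le> \<psi> x) \<Longrightarrow> 0 \<le> periodize R \<psi> x"
  unfolding periodize_def by (intro sum_nonneg) auto

section \<open>Periodically perforated space\<close>

text \<open>Competitors of the cell problem. The margin \<open>r'\<close> makes them vanish in a
  neighbourhood of the closed holes, so after a cutoff in a box they are test functions of the
  perforated box; nonnegativity is what the Poincare inequality on the cell asks for.\<close>

definition perforated :: "real \<Rightarrow> ('a::euclidean_space \<Rightarrow> real) \<Rightarrow> bool" where
  "perforated r u \<longleftrightarrow> smooth_fun u \<and> periodic u \<and> (\<forall>x. 0 \<le> u x) \<and>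
     (\<exists>r'>r. \<forall>x. infdist x lat < r' \<longrightarrow> u x = 0)"

lemma lat_nonempty: "lat \<noteq> {}"
  using lat_0 by blast

lemma infdist_lat_add_le:
  assumes "k \<in> lat"
  shows "infdist (x + k) lat \<le> infdist x lat"
proof -
  have "infdist (x + k) lat \<le> (INF a\<in>lat. dist x a)"
  proof (rule cINF_greatest[OF lat_nonempty])
    fix a :: 'a assume "a \<in> lat"
    then have "infdist (x + k) lat \<le> dist (x + k) (a + k)" by (intro infdist_le lat_add assms)
    then show "infdist (x + k) lat \<le> dist x a" by simp
  qed
  then show ?thesis by (simp add: infdist_notempty[OF lat_nonempty])
qed

lemma norm_sum_scaleR_square_le:
  fixes g :: "'i \<Rightarrow> 'b::real_normed_vector" and a :: "'i \<Rightarrow> real"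
  assumes "finite F"
  shows "(norm (\<Sum>k\<in>F. a k *\<^sub>R g k))\<^sup>2 \<le> (\<Sum>k\<in>F. (a k)\<^sup>2) * (\<Sum>k\<in>F. (norm (g k))\<^sup>2)"
proof -
  have "norm (\<Sum>k\<in>F. a k *\<^sub>R g k) \<le> (\<Sum>k\<in>F. \<bar>a k\<bar> * norm (g k))"
    by (rule order_trans[OF norm_sum]) simp
  then have "(norm (\<Sum>k\<in>F. a k *\<^sub>R g k))\<^sup>2 \<le> (\<Sum>k\<in>F. \<bar>a k\<bar> * norm (g k))\<^sup>2" by (intro power_mono) auto
  also have "\<dots> \<le> (\<Sum>k\<in>F. \<bar>a k\<bar>\<^sup>2) * (\<Sum>k\<in>F. (norm (g k))\<^sup>2)" by (rule Cauchy_Schwarz_ineq_sum)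
  finally show ?thesis by simp
qed

text \<open>The periodic competitor \<open>\<rho> = sqrt (\<delta>\<^sup>2 + \<Sum>k. \<phi>(x + k)\<^sup>2) - \<delta>\<close> has no more energy per cell than
  \<open>\<phi>\<close> has on the whole space, and almost its mass.\<close>
lemma perforated_rayleigh:
  fixes \<phi> :: "'a::euclidean_space \<Rightarrow> real"
  assumes \<mu>: "0 \<le> \<mu>" "\<And>u::'a \<Rightarrow> real. perforated r u \<Longrightarrow> \<mu> * cell_mass u \<le> cell_energy u"
    and \<phi>: "test_fun {x. r < infdist x lat} \<phi>"
  shows "\<mu> * (\<integral>x. (\<phi> x)\<^sup>2 \<partial>lebesgue) \<le> (\<integral>x. (norm (grad \<phi> x))\<^sup>2 \<partial>lebesgue)"
proof -
  let ?m = "real DIM('a)"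
  define N where "N = (\<integral>x. (\<phi> x)\<^sup>2 \<partial>lebesgue)"
  define D where "D = (\<integral>x. (norm (grad \<phi> x))\<^sup>2 \<partial>lebesgue)"
  obtain R where R: "\<And>x. x \<in> tsupport \<phi> \<Longrightarrow> norm x \<le> R"
    using compact_imp_bounded[OF test_fun_compact[OF \<phi>]] by (auto simp: bounded_iff)
  have out: "\<phi> x = 0" "grad \<phi> x = 0" if "R < norm x" for x
    using R[of x] that not_tsupport[of x \<phi>] grad_not_tsupport[of x \<phi>] by auto
  obtain r' where r': "r < r'" "\<And>x. infdist x lat < r' \<Longrightarrow> \<phi> x = 0"
  proof (cases "tsupport \<phi> = {}")
    case True
    then show thesis using that[of "r + 1"] not_tsupport[of _ \<phi>] by auto
  next
    case False
    obtain x0 where x0: "x0 \<in> tsupport \<phi>" "\<And>y. y \<in> tsupport \<phi> \<Longrightarrow> infdist x0 lat \<le> infdist y lat"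
      using continuous_attains_inf[OF test_fun_compact[OF \<phi>] False continuous_on_infdist[OF continuous_on_id]]
      by blast
    have "r < infdist x0 lat" using test_fun_subset[OF \<phi>] x0(1) by auto
    moreover have "\<phi> x = 0" if "infdist x lat < infdist x0 lat" for x
      using x0(2)[of x] that not_tsupport[of x \<phi>] by auto
    ultimately show thesis using that by blast
  qed
  define \<psi> where "\<psi> x = (\<phi> x)\<^sup>2" for x
  have s\<psi>: "smooth_fun \<psi>" unfolding \<psi>_def by (intro smooth_power2 test_fun_smooth[OF \<phi>])
  have \<psi>0: "\<psi> x = 0" if "R < norm x" for x using out(1)[OF that] by (simp add: \<psi>_def)
  have g\<psi>: "grad \<psi> x = (2 * \<phi> x) *\<^sub>R grad \<phi> x" for x
    unfolding \<psi>_def[abs_def] power2_eq_square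
    by (subst grad_mult) (auto simp: test_fun_differentiable[OF \<phi>] scaleR_add_left[symmetric])
  define F where "F = {k\<in>lat. norm (k::'a) \<le> R + (?m + 1)}"
  have F: "finite F" "F \<subseteq> lat" "{k\<in>lat. norm k \<le> R + (?m + 1)} \<subseteq> F" "{k\<in>lat. norm k \<le> R + ?m} \<subseteq> F"
    by (auto simp: F_def finite_lat_ball)
  define S where "S = periodize R \<psi>"
  have sS: "smooth_fun S" unfolding S_def by (rule periodize_smooth[OF \<psi>0 s\<psi>])
  have S0: "0 \<le> S x" for x unfolding S_def by (rule periodize_nonneg) (simp add: \<psi>_def)
  have Seq: "S x = (\<Sum>k\<in>F. (\<phi> (x + k))\<^sup>2)" if "x \<in> cell" for x
    unfolding S_def using cell_norm[OF that] by (subst periodize_eq[OF \<psi>0 F(1-3)]) (auto simp: \<psi>_def)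
  have gS: "grad S x = (\<Sum>k\<in>F. (2 * \<phi> (x + k)) *\<^sub>R grad \<phi> (x + k))" if "x \<in> cell" for x
    unfolding S_def using cell_norm[OF that] by (subst periodize_grad[OF \<psi>0 s\<psi> F(1-3)]) (auto simp: g\<psi>)
  have c\<phi>: "continuous_on UNIV \<phi>" "continuous_on UNIV (grad \<phi>)"
    by (rule test_fun_continuous[OF \<phi>], rule test_fun_grad_continuous[OF \<phi>])
  have [measurable]: "\<phi> \<in> borel_measurable borel" "grad \<phi> \<in> borel_measurable borel"
    by (intro borel_measurable_continuous_onI c\<phi>)+
  have unfN: "(\<integral>x. indicator cell x * (\<Sum>k\<in>F. (\<phi> (x + k))\<^sup>2) \<partial>lebesgue) = N"
    "integrable lebesgue (\<lambda>x. indicator cell x * (\<Sum>k\<in>F. (\<phi> (x + k))\<^sup>2))"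
    unfolding N_def using integral_unfold_cell[OF _ L2_integrable_real[OF test_fun_L2[OF \<phi>]] _ F(1,2,4)] out by auto
  have unfD: "(\<integral>x. indicator cell x * (\<Sum>k\<in>F. (norm (grad \<phi> (x + k)))\<^sup>2) \<partial>lebesgue) = D"
    "integrable lebesgue (\<lambda>x. indicator cell x * (\<Sum>k\<in>F. (norm (grad \<phi> (x + k)))\<^sup>2))"
    unfolding D_def using integral_unfold_cell[OF _ L2_integrable[OF test_fun_grad_L2[OF \<phi>]] _ F(1,2,4)] out by auto
  have key: "\<mu> * ((1 - \<delta>) * N - \<delta>) \<le> D" if \<delta>: "0 < \<delta>" for \<delta>
  proof -
    define \<rho> where "\<rho> x = sqrt (\<delta>\<^sup>2 + S x) - \<delta>" for x
    have pos: "0 < \<delta>\<^sup>2 + S x" for x using S0[of x] \<delta> by (simp add: add_pos_nonneg)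
    have s\<rho>: "smooth_fun \<rho>" unfolding \<rho>_def
      by (intro smooth_diff smooth_const smooth_sqrt smooth_add sS pos)
    have "perforated r \<rho>"
      unfolding perforated_def
    proof (intro conjI allI exI[of _ r'] impI)
      show "smooth_fun \<rho>" by (rule s\<rho>)
      show "periodic \<rho>" using periodize_periodic[of R \<psi>] by (simp add: periodic_def \<rho>_def S_def)
      show "0 \<le> \<rho> x" for x
        using real_sqrt_le_mono[of "\<delta>\<^sup>2" "\<delta>\<^sup>2 + S x"] S0[of x] \<delta> by (simp add: \<rho>_def)
      show "r < r'" by (rule r')
      fix x :: 'a assume x: "infdist x lat < r'"
      have "\<psi> (x + k) = 0" if "k \<in> lat" for k
        using infdist_lat_add_le[OF that, of x] x r'(2)[of "x + k"] by (simp add: \<psi>_def)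
      then have "S x = 0" unfolding S_def periodize_def by (intro sum.neutral) auto
      then show "\<rho> x = 0" using \<delta> by (simp add: \<rho>_def)
    qed
    then have le: "\<mu> * cell_mass \<rho> \<le> cell_energy \<rho>" by (rule \<mu>(2))
    have "cell_energy \<rho> \<le> (\<integral>x. indicator cell x * (\<Sum>k\<in>F. (norm (grad \<phi> (x + k)))\<^sup>2) \<partial>lebesgue)"
    proof (rule integral_mono[OF _ unfD(2)])
      show "integrable lebesgue (\<lambda>x. indicator cell x * (norm (grad \<rho> x))\<^sup>2)"
        by (intro integrable_cell_continuous continuous_intros continuous_grad s\<rho>)
      fix x :: 'a
      show "indicator cell x * (norm (grad \<rho> x))\<^sup>2 \<le> indicator cell x * (\<Sum>k\<in>F. (norm (grad \<phi> (x + k)))\<^sup>2)"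
      proof (cases "x \<in> cell")
        case True
        let ?G = "\<Sum>k\<in>F. (norm (grad \<phi> (x + k)))\<^sup>2"
        have "((\<lambda>t. sqrt (\<delta>\<^sup>2 + t) - \<delta>) has_field_derivative (inverse (sqrt (\<delta>\<^sup>2 + S x)) / 2)) (at (S x))"
          using pos[of x] by (auto intro!: derivative_eq_intros simp: field_simps)
        from grad_compose[OF smooth_fun_differentiable[OF sS] this]
        have "grad \<rho> x = (inverse (sqrt (\<delta>\<^sup>2 + S x)) / 2) *\<^sub>R grad S x" unfolding \<rho>_def[abs_def] .
        also have "grad S x = 2 *\<^sub>R (\<Sum>k\<in>F. \<phi> (x + k) *\<^sub>R grad \<phi> (x + k))"
          unfolding gS[OF True] by (simp add: scaleR_sum_right)
        finally have "grad \<rho> x = inverse (sqrt (\<delta>\<^sup>2 + S x)) *\<^sub>R (\<Sum>k\<in>F. \<phi> (x + k) *\<^sub>R grad \<phi> (x + k))" by simp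
        then have "(norm (grad \<rho> x))\<^sup>2 = (norm (\<Sum>k\<in>F. \<phi> (x + k) *\<^sub>R grad \<phi> (x + k)))\<^sup>2 / (\<delta>\<^sup>2 + S x)"
          using pos[of x] by (simp add: power_mult_distrib power_inverse divide_inverse)
        \<comment> \<open>Cauchy-Schwarz over the translates; its factor \<open>S x\<close> is then
          absorbed by the denominator.\<close>
        also have "\<dots> \<le> (S x * ?G) / (\<delta>\<^sup>2 + S x)"
          using norm_sum_scaleR_square_le[OF F(1), of "\<lambda>k. \<phi> (x + k)" "\<lambda>k. grad \<phi> (x + k)"] pos[of x]
          by (intro divide_right_mono) (auto simp: Seq[OF True])
        also have "\<dots> \<le> ((\<delta>\<^sup>2 + S x) * ?G) / (\<delta>\<^sup>2 + S x)"
          using pos[of x] by (intro divide_right_mono mult_right_mono sum_nonneg) auto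
        also have "\<dots> = ?G" using pos[of x] by simp
        finally show ?thesis using True by simp
      qed simp
    qed
    then have en: "cell_energy \<rho> \<le> D" unfolding unfD(1) .
    have "(\<integral>x. (1 - \<delta>) * (indicator cell x * (\<Sum>k\<in>F. (\<phi> (x + k))\<^sup>2)) - \<delta> * indicator cell x \<partial>lebesgue) \<le> cell_mass \<rho>"
    proof (rule integral_mono)
      show "integrable lebesgue (\<lambda>x. (1 - \<delta>) * (indicator cell x * (\<Sum>k\<in>F. (\<phi> (x + k))\<^sup>2)) - \<delta> * indicator cell x)"
        using unfN(2) integrable_cell_continuous[of "\<lambda>_::'a. 1"] by simp
      show "integrable lebesgue (\<lambda>x. indicator cell x * (\<rho> x)\<^sup>2)"
        by (intro integrable_cell_continuous continuous_intros smooth_fun_continuous s\<rho>)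
      fix x :: 'a
      show "(1 - \<delta>) * (indicator cell x * (\<Sum>k\<in>F. (\<phi> (x + k))\<^sup>2)) - \<delta> * indicator cell x \<le> indicator cell x * (\<rho> x)\<^sup>2"
      proof (cases "x \<in> cell")
        case True
        let ?s = "S x" and ?q = "sqrt (\<delta>\<^sup>2 + S x)"
        \<comment> \<open>A bound on the root that is linear in \<open>S\<close>; inserted in the
          expansion of \<open>(\<rho> x)\<^sup>2\<close> it limits the loss of mass to \<delta> S +
          \<delta>.\<close>
        have "\<delta>\<^sup>2 + ?s \<le> (\<delta> + (1 + ?s) / 2)\<^sup>2"
        proof -
          have "(\<delta> + (1 + ?s) / 2)\<^sup>2 - (\<delta>\<^sup>2 + ?s) = \<delta> * (1 + ?s) + ((1 - ?s) / 2)\<^sup>2"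
            by (simp add: power2_eq_square field_simps)
          moreover have "0 \<le> \<delta> * (1 + ?s) + ((1 - ?s) / 2)\<^sup>2" using \<delta> S0[of x] by simp
          ultimately show ?thesis by linarith
        qed
        then have q: "?q \<le> \<delta> + (1 + ?s) / 2" using \<delta> S0[of x] by (intro real_le_lsqrt) auto
        have q2: "?q * ?q = \<delta>\<^sup>2 + ?s" using pos[of x] by simp
        have "(\<rho> x)\<^sup>2 = ?s + 2 * \<delta>\<^sup>2 - 2 * \<delta> * ?q"
          using q2 by (simp add: \<rho>_def power2_eq_square algebra_simps)
        moreover have "2 * \<delta> * ?q \<le> 2 * \<delta> * (\<delta> + (1 + ?s) / 2)" using q \<delta> by (intro mult_left_mono) auto
        moreover have "2 * \<delta> * (\<delta> + (1 + ?s) / 2) = 2 * \<delta>\<^sup>2 + \<delta> + \<delta> * ?s" by (simp add: power2_eq_square algebra_simps)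
        ultimately have "(1 - \<delta>) * ?s - \<delta> \<le> (\<rho> x)\<^sup>2" by (simp add: left_diff_distrib)
        then show ?thesis using True by (simp add: Seq)
      qed simp
    qed
    also have "(\<integral>x. (1 - \<delta>) * (indicator cell x * (\<Sum>k\<in>F. (\<phi> (x + k))\<^sup>2)) - \<delta> * indicator cell x \<partial>lebesgue) = (1 - \<delta>) * N - \<delta>"
      using unfN integrable_cell_continuous[of "\<lambda>_::'a. 1"] by (simp add: cell_lmeasurable fmeasurableD)
    finally have "\<mu> * ((1 - \<delta>) * N - \<delta>) \<le> \<mu> * cell_mass \<rho>" using \<mu>(1) by (rule mult_left_mono)
    then show ?thesis using le en by linarith
  qed
  have N0: "N \<ge> 0" by (simp add: N_def)
  have "\<mu> * N \<le> D"
  proof (rule field_le_epsilon)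
    fix e :: real assume e: "e > 0"
    \<comment> \<open>By \<open>key\<close> the error is \<delta> \<mu> (N + 1), here at most
      \<open>e\<close>; the final 1 keeps the denominator positive when \<mu> = 0.\<close>
    define \<delta> where "\<delta> = e / (\<mu> * (N + 1) + 1)"
    have c: "\<mu> * (N + 1) + 1 > 0" using \<mu>(1) N0 by (simp add: add_nonneg_pos)
    have \<delta>: "\<delta> > 0" using e c by (simp add: \<delta>_def)
    have "\<delta> * (\<mu> * (N + 1)) \<le> \<delta> * (\<mu> * (N + 1) + 1)" using \<delta> by (intro mult_left_mono) auto
    also have "\<dots> = e" using c by (simp add: \<delta>_def)
    finally show "\<mu> * N \<le> D + e" using key[OF \<delta>] by (simp add: algebra_simps)
  qed
  then show ?thesis by (simp add: N_def D_def)
qed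

text \<open>Vanishing on a part of the cell of measure \<open>z\<close> improves Cauchy-Schwarz: the
  squared integral of \<open>u\<close> is at most 1 - z times its mass, and the Poincare inequality
  on the cell then controls z times the mass. The constant may degenerate as \<open>r\<close>
  shrinks; it only has to make the infimum of the quotients positive.\<close>

lemma perforated_poincare:
  assumes r: "r > 0"
  obtains c where "c > 0" "\<And>u::'a::euclidean_space \<Rightarrow> real. perforated r u \<Longrightarrow> c * cell_mass u \<le> cell_energy u"
proof -
  let ?m = "real DIM('a)"
  let ?Z = "cell \<inter> ball (0::'a) r"
  have lZ: "?Z \<in> lmeasurable" by (intro fmeasurable.Int cell_lmeasurable lmeasurable_ball)
  have "0 < (\<integral>x. indicator ?Z x \<partial>lebesgue :: real)"
  proof (rule integral_pos_of_open[where U="box 0 One \<inter> ball (0::'a) r"])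
    show "integrable lebesgue (indicator ?Z :: 'a \<Rightarrow> real)" using lZ by (auto simp: fmeasurable_def)
    show "box 0 One \<inter> ball (0::'a) r \<noteq> {}"
    proof -
      \<comment> \<open>Places a point of the diagonal inside the open cell and, its norm being at
        most \<open>t * ?m\<close>, within distance r/2 of the origin.\<close>
      define t where "t = min (1 / 2) (r / (2 * ?m))"
      have t: "0 < t" "t < 1" using r by (auto simp: t_def)
      have "t \<le> r / (2 * ?m)" by (simp add: t_def)
      then have "t * ?m \<le> r / 2" by (simp add: field_simps)
      have "norm (t *\<^sub>R (One::'a)) \<le> (\<Sum>b\<in>Basis. \<bar>(t *\<^sub>R (One::'a)) \<bullet> b\<bar>)" by (rule norm_le_l1)
      also have "\<dots> = t * ?m" using t by (simp add: mult.commute)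
      also have "\<dots> < r" using \<open>t * ?m \<le> r / 2\<close> r by linarith
      finally have "t *\<^sub>R (One::'a) \<in> box 0 One \<inter> ball 0 r" using t by (auto simp: box_def)
      then show ?thesis by blast
    qed
    show "indicator ?Z x > (0::real)" if "x \<in> box 0 One \<inter> ball 0 r" for x
      using that box_cell by (auto simp: indicator_def)
  qed auto
  moreover define z where "z = measure lebesgue ?Z"
  ultimately have z: "z > 0" using lZ by (simp add: fmeasurable_def)
  have "2 * z / ?m\<^sup>2 * cell_mass u \<le> cell_energy u" if u: "perforated r u" for u :: "'a \<Rightarrow> real"
  proof -
    obtain r' where u': "smooth_fun u" "periodic u" "\<And>x. 0 \<le> u x" "r < r'" "\<And>x. infdist x lat < r' \<Longrightarrow> u x = 0"
      using u by (auto simp: perforated_def)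
    have cont: "continuous_on UNIV u" by (rule smooth_fun_continuous[OF u'(1)])
    have zero: "u x = 0" if "x \<in> ball 0 r" for x
    proof -
      have "infdist x lat \<le> dist x 0" by (rule infdist_le) simp
      then show ?thesis using that u'(4) u'(5)[of x] by simp
    qed
    let ?f = "\<lambda>x. indicator cell x * u x"
    have sq: "(norm (?f x))\<^sup>2 = indicator cell x * (u x)\<^sup>2" for x by (simp add: indicator_def)
    have L: "L2 lebesgue ?f" unfolding L2_def sq
      using integrable_cell_continuous[OF cont] integrable_cell_continuous[OF continuous_on_power[OF cont, of 2]] by auto
    have dif: "cell - ball (0::'a) r \<in> sets lebesgue" "emeasure lebesgue (cell - ball (0::'a) r) < \<infinity>"
      "measure lebesgue (cell - ball (0::'a) r) = 1 - z"
    proof -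
      have *: "cell - ball (0::'a) r \<in> lmeasurable" by (intro fmeasurable.Diff cell_lmeasurable lmeasurable_ball)
      then show "cell - ball (0::'a) r \<in> sets lebesgue" "emeasure lebesgue (cell - ball (0::'a) r) < \<infinity>"
        by (auto simp: fmeasurable_def)
      have "cell - ball (0::'a) r = cell - ?Z" by auto
      then show "measure lebesgue (cell - ball (0::'a) r) = 1 - z"
        unfolding z_def using lZ by (simp add: measurable_measure_Diff cell_lmeasurable fmeasurableD)
    qed
    have nf: "norm (?f x) = ?f x" for x using u'(3)[of x] by (simp add: indicator_def)
    have "(\<integral>x. norm (?f x) \<partial>lebesgue)\<^sup>2 \<le> measure lebesgue (cell - ball (0::'a) r) * (\<integral>x. (norm (?f x))\<^sup>2 \<partial>lebesgue)"
      by (rule L2_supported_norm_integral[OF L dif(1,2)]) (use zero in \<open>auto simp: indicator_def\<close>)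
    then have "(\<integral>x. ?f x \<partial>lebesgue)\<^sup>2 \<le> (1 - z) * cell_mass u" unfolding sq unfolding nf dif(3) .
    then have "z * cell_mass u \<le> ?m\<^sup>2 / 2 * cell_energy u"
      using periodic_poincare[OF u'(1-3)] by (simp add: left_diff_distrib)
    then show ?thesis by (simp add: field_simps)
  qed
  then show thesis using that[of "2 * z / ?m\<^sup>2"] z by auto
qed

section \<open>Points have zero capacity\<close>

definition smooth_step :: "real \<Rightarrow> real" where
  "smooth_step t = flat_exp t * inverse (flat_exp t + flat_exp (1 - t))"

lemma smooth_step_denom: "flat_exp t + flat_exp (1 - t) > 0"
proof (cases "t > 0")
  case True
  then have "flat_exp t > 0" by (simp add: flat_exp_def)
  then show ?thesis by (simp add: add_pos_nonneg)
next
  case False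
  then have "flat_exp (1 - t) > 0" by (simp add: flat_exp_def)
  then show ?thesis by (simp add: add_nonneg_pos)
qed

lemma smooth_smooth_step: "smooth_fun smooth_step"
proof -
  have "flat_exp t + flat_exp (1 - t) \<noteq> 0" for t using smooth_step_denom[of t] by simp
  then show ?thesis unfolding smooth_step_def[abs_def]
    by (intro smooth_mult smooth_inverse smooth_add smooth_flat_exp smooth_compose[OF smooth_flat_exp] smooth_diff smooth_const smooth_id_real)
qed

lemma smooth_step_nonneg: "0 \<le> smooth_step t"
  using smooth_step_denom[of t] by (simp add: smooth_step_def)

lemma smooth_step_0: "t \<le> 0 \<Longrightarrow> smooth_step t = 0"
  by (simp add: smooth_step_def)

lemma smooth_step_1: "t \<ge> 1 \<Longrightarrow> smooth_step t = 1"
  using smooth_step_denom[of t] by (simp add: smooth_step_def flat_exp_def)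

lemma norm_sum_square_single:
  fixes v :: "'i \<Rightarrow> 'b::real_inner"
  assumes "finite J" "\<And>i j. i \<in> J \<Longrightarrow> j \<in> J \<Longrightarrow> i \<noteq> j \<Longrightarrow> v i = 0 \<or> v j = 0"
  shows "(norm (\<Sum>i\<in>J. v i))\<^sup>2 = (\<Sum>i\<in>J. (norm (v i))\<^sup>2)"
proof (cases "\<exists>j\<in>J. v j \<noteq> 0")
  case True
  then obtain j where j: "j \<in> J" "v j \<noteq> 0" by blast
  have "v i = 0" if "i \<in> J - {j}" for i using assms(2)[of i j] that j by auto
  then show ?thesis using assms(1) j by (simp add: sum.remove[of J j])
next
  case False
  then show ?thesis by simp
qed

text \<open>Average of \<open>n\<close> dyadic rescalings of one bump whose gradients have disjoint supports, each with
  energy bounded independently of the scale.\<close>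
lemma zero_capacity_of_point:
  assumes m2: "DIM('a::euclidean_space) \<ge> 2" and \<epsilon>: "\<epsilon> > 0"
  obtains \<eta> :: "'a::euclidean_space \<Rightarrow> real" and s where "test_fun UNIV \<eta>" "\<And>x. 0 \<le> \<eta> x" "\<And>x. 1 / 4 \<le> norm x \<Longrightarrow> \<eta> x = 0"
    "s > 0" "\<And>x. norm x < s \<Longrightarrow> 1 \<le> \<eta> x" "(\<integral>x. (norm (grad \<eta> x))\<^sup>2 \<partial>lebesgue) \<le> \<epsilon>"
proof -
  let ?m = "DIM('a)"
  \<comment> \<open>The gradient lives where |x|^2 is between 1/2 and 1. Doubling the argument
    multiplies |x|^2 by 4, more than the width 2 of this range, so the dyadic gradients are
    disjoint.\<close>
  define \<xi> where "\<xi> x = smooth_step (2 * (1 - (norm x)\<^sup>2))" for x :: 'a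
  have s\<xi>: "smooth_fun \<xi>" unfolding \<xi>_def by (intro smooth_compose[OF smooth_smooth_step] smooth_intros)
  have \<xi>0: "\<xi> x = 0" if "1 \<le> norm x" for x
    unfolding \<xi>_def by (rule smooth_step_0) (use that one_le_power[of "norm x" 2] in simp)
  have \<xi>1: "\<xi> x = 1" if "(norm x)\<^sup>2 \<le> 1 / 2" for x
    unfolding \<xi>_def by (rule smooth_step_1) (use that in simp)
  have t\<xi>: "test_fun UNIV \<xi>" by (rule test_funI[OF s\<xi>, of "cball 0 1"]) (use \<xi>0 in auto)
  have g0: "grad \<xi> x = 0" if "(norm x)\<^sup>2 < 1 / 2 \<or> 1 < (norm x)\<^sup>2" for x
    using that
  proof
    assume x: "(norm x)\<^sup>2 < 1 / 2"
    have "open {x::'a. (norm x)\<^sup>2 < 1 / 2}" by (intro open_Collect_less continuous_intros)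
    then have "grad \<xi> x = grad (\<lambda>x. 1) x"
      by (rule grad_eq_on_open) (use x \<xi>1 in auto)
    then show ?thesis by simp
  next
    assume x: "1 < (norm x)\<^sup>2"
    have "open {x::'a. 1 < (norm x)\<^sup>2}" by (intro open_Collect_less continuous_intros)
    moreover have "\<xi> y = 0" if "y \<in> {x. 1 < (norm x)\<^sup>2}" for y
      using that \<xi>0[of y] by (simp add: abs_square_less_1[symmetric] power_le_one_iff) (meson linear norm_ge_zero not_less power_le_one)
    ultimately have "grad \<xi> x = grad (\<lambda>x. 0) x"
      using x by (intro grad_eq_on_open[of "{x. 1 < (norm x)\<^sup>2}"]) auto
    then show ?thesis by simp
  qed
  define X where "X = (\<integral>x. (norm (grad \<xi> x))\<^sup>2 \<partial>lebesgue)"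
  have X0: "X \<ge> 0" by (simp add: X_def)
  \<comment> \<open>Disjoint gradients make the energy of the average at most n times X / n^2, that
    is X / n.\<close>
  obtain n0 :: nat where n0: "X / \<epsilon> < real n0" using reals_Archimedean2 by blast
  define n where "n = Suc n0"
  have n: "real n > 0" "X \<le> \<epsilon> * real n" using n0 \<epsilon> by (auto simp: n_def field_simps)
  \<comment> \<open>Starting at 2 puts all supports inside the ball of radius 1/4.\<close>
  define J where "J = {2..<n + 2}"
  have J: "finite J" "card J = n" by (auto simp: J_def)
  define \<eta> where "\<eta> x = (1 / real n) * (\<Sum>j\<in>J. \<xi> (2 ^ j *\<^sub>R x))" for x
  have sj: "smooth_fun (\<lambda>x. \<xi> (2 ^ j *\<^sub>R x))" for j :: nat by (rule smooth_scale[OF s\<xi>])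
  have s\<eta>: "smooth_fun \<eta>" unfolding \<eta>_def[abs_def] by (intro smooth_mult smooth_const smooth_sum sj)
  have \<eta>0: "\<eta> x = 0" if "1 / 4 \<le> norm x" for x
  proof -
    have "\<xi> (2 ^ j *\<^sub>R x) = 0" if "j \<in> J" for j
    proof (rule \<xi>0)
      have "(2::real) ^ 2 \<le> 2 ^ j" using that by (intro power_increasing) (auto simp: J_def)
      then have "4 * (1 / 4) \<le> 2 ^ j * norm x" using \<open>1 / 4 \<le> norm x\<close> by (intro mult_mono) auto
      then show "1 \<le> norm (2 ^ j *\<^sub>R x)" by simp
    qed
    then show ?thesis by (simp add: \<eta>_def)
  qed
  show thesis
  proof (rule that[of \<eta> "(1 / 2) ^ (n + 2)"])
    show "test_fun UNIV \<eta>" by (rule test_funI[OF s\<eta>, of "cball 0 (1 / 4)"]) (use \<eta>0 in auto)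
    show "0 \<le> \<eta> x" for x unfolding \<eta>_def \<xi>_def by (intro mult_nonneg_nonneg sum_nonneg smooth_step_nonneg) auto
    show "\<eta> x = 0" if "1 / 4 \<le> norm x" for x by (rule \<eta>0[OF that])
    show "(1 / 2 :: real) ^ (n + 2) > 0" by simp
    show "1 \<le> \<eta> x" if x: "norm x < (1 / 2) ^ (n + 2)" for x
    proof -
      have "\<xi> (2 ^ j *\<^sub>R x) = 1" if "j \<in> J" for j
      proof (rule \<xi>1)
        have j: "j \<le> n + 1" using that by (auto simp: J_def)
        have "(2::real) ^ j * norm x \<le> 2 ^ (n + 1) * (1 / 2) ^ (n + 2)"
          using x j by (intro mult_mono power_increasing) auto
        also have "\<dots> = 1 / 2" by (simp add: power_divide)
        finally have "norm (2 ^ j *\<^sub>R x) \<le> 1 / 2" by simp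
        then have "(norm (2 ^ j *\<^sub>R x))\<^sup>2 \<le> (1 / 2)\<^sup>2" by (intro power_mono) auto
        then show "(norm (2 ^ j *\<^sub>R x))\<^sup>2 \<le> 1 / 2" by (simp add: power2_eq_square)
      qed
      then show ?thesis using n(1) by (simp add: \<eta>_def J)
    qed
    show "(\<integral>x. (norm (grad \<eta> x))\<^sup>2 \<partial>lebesgue) \<le> \<epsilon>"
    proof -
      let ?v = "\<lambda>j x. 2 ^ j *\<^sub>R grad \<xi> (2 ^ j *\<^sub>R x)"
      have g\<eta>: "grad \<eta> x = (1 / real n) *\<^sub>R (\<Sum>j\<in>J. ?v j x)" for x
      proof -
        have "grad \<eta> x = (1 / real n) *\<^sub>R grad (\<lambda>x. \<Sum>j\<in>J. \<xi> (2 ^ j *\<^sub>R x)) x"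
          unfolding \<eta>_def[abs_def] by (rule grad_cmult) (intro smooth_fun_differentiable smooth_sum sj)
        also have "grad (\<lambda>x. \<Sum>j\<in>J. \<xi> (2 ^ j *\<^sub>R x)) x = (\<Sum>j\<in>J. grad (\<lambda>x. \<xi> (2 ^ j *\<^sub>R x)) x)"
          by (rule grad_sum[OF J(1)]) (rule smooth_fun_differentiable[OF sj])
        finally show ?thesis by (simp add: grad_scale[OF s\<xi>])
      qed
      have single: "?v i x = 0 \<or> ?v j x = 0" if "i < j" for i j x
      proof (rule ccontr)
        assume "\<not> ?thesis"
        then have "grad \<xi> (2 ^ i *\<^sub>R x) \<noteq> 0" "grad \<xi> (2 ^ j *\<^sub>R x) \<noteq> 0" by auto
        then have i: "1 / 2 \<le> (norm (2 ^ i *\<^sub>R x))\<^sup>2" and j: "(norm (2 ^ j *\<^sub>R x))\<^sup>2 \<le> 1"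
          using g0[of "2 ^ i *\<^sub>R x"] g0[of "2 ^ j *\<^sub>R x"] linorder_not_less by blast+
        have "(2::real) ^ Suc i \<le> 2 ^ j" using that by (intro power_increasing) auto
        then have "2 * norm (2 ^ i *\<^sub>R x) \<le> norm (2 ^ j *\<^sub>R x)"
          using mult_right_mono[of "2 ^ Suc i" "2 ^ j" "norm x"] by simp
        then have "(2 * norm (2 ^ i *\<^sub>R x))\<^sup>2 \<le> (norm (2 ^ j *\<^sub>R x))\<^sup>2" by (intro power_mono) auto
        then show False using i j by (simp only: power_mult_distrib) simp
      qed
      have sq: "(norm (grad \<eta> x))\<^sup>2 = (\<Sum>j\<in>J. (4 ^ j / (real n)\<^sup>2) * (norm (grad \<xi> (2 ^ j *\<^sub>R x)))\<^sup>2)" for x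
      proof -
        have "(norm (\<Sum>j\<in>J. ?v j x))\<^sup>2 = (\<Sum>j\<in>J. (norm (?v j x))\<^sup>2)"
        proof (rule norm_sum_square_single[OF J(1)])
          fix i j :: nat assume "i \<noteq> j"
          then show "?v i x = 0 \<or> ?v j x = 0" using single[of i j x] single[of j i x] by (meson linorder_neqE_nat)
        qed
        also have "\<dots> = (\<Sum>j\<in>J. 4 ^ j * (norm (grad \<xi> (2 ^ j *\<^sub>R x)))\<^sup>2)"
          by (intro sum.cong refl) (simp add: power_mult_distrib power_mult[symmetric] mult.commute[of _ 2] power_mult[of 2 2])
        finally show ?thesis unfolding g\<eta> by (simp add: power_mult_distrib power_divide sum_distrib_left sum_divide_distrib)
      qed
      have [measurable]: "grad \<xi> \<in> borel_measurable borel"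
        by (rule borel_measurable_continuous_onI[OF continuous_grad[OF s\<xi>]])
      have ij: "integrable lebesgue (\<lambda>x. (norm (grad \<xi> (2 ^ j *\<^sub>R x)))\<^sup>2)" for j :: nat
      proof -
        have "test_fun UNIV (\<lambda>x. \<xi> (2 ^ j *\<^sub>R x))"
        proof (rule test_funI[OF sj, of "cball 0 1"])
          fix x :: 'a assume "x \<notin> cball 0 1"
          then have "1 * 1 \<le> 2 ^ j * norm x" by (intro mult_mono) auto
          then show "\<xi> (2 ^ j *\<^sub>R x) = 0" by (intro \<xi>0) simp
        qed auto
        from L2_integrable[OF test_fun_grad_L2[OF this]]
        show ?thesis by (simp add: grad_scale[OF s\<xi>] power_mult_distrib)
      qed
      have sc: "4 ^ j * (\<integral>x. (norm (grad \<xi> (2 ^ j *\<^sub>R x)))\<^sup>2 \<partial>lebesgue) \<le> X" for j :: nat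
      proof -
        have "(\<integral>x. (norm (grad \<xi> (2 ^ j *\<^sub>R x)))\<^sup>2 \<partial>lebesgue) = X / (2 ^ j) ^ ?m"
          unfolding X_def by (rule lebesgue_integral_scale) auto
        \<comment> \<open>Dimension at least 2 enters: the gradient gains 4^j, the volume loses
          2^(jm), so shrinking does not increase the Dirichlet energy.\<close>
        moreover have "(4::real) ^ j \<le> (2 ^ j) ^ ?m"
        proof -
          have "((2::real) ^ j) ^ 2 = (2 ^ 2) ^ j" by (simp only: power_mult[symmetric] mult.commute)
          then have "(4::real) ^ j = (2 ^ j) ^ 2" by simp
          also have "\<dots> \<le> (2 ^ j) ^ ?m" using m2 by (intro power_increasing) auto
          finally show ?thesis .
        qed
        moreover have "B * (X / B') \<le> X" if "B \<le> B'" "B' > 0" for B B' :: real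
        proof -
          have "B * (X / B') \<le> B' * (X / B')" using that X0 by (intro mult_right_mono) auto
          then show ?thesis using that by simp
        qed
        ultimately show ?thesis by simp
      qed
      have "(\<integral>x. (norm (grad \<eta> x))\<^sup>2 \<partial>lebesgue) = (\<Sum>j\<in>J. (4 ^ j / (real n)\<^sup>2) * (\<integral>x. (norm (grad \<xi> (2 ^ j *\<^sub>R x)))\<^sup>2 \<partial>lebesgue))"
        unfolding sq using ij by (subst Bochner_Integration.integral_sum) auto
      also have "\<dots> \<le> (\<Sum>j\<in>J. X / (real n)\<^sup>2)"
        using sc by (intro sum_mono) (simp add: divide_right_mono)
      also have "\<dots> = X / real n" using J n by (simp add: power2_eq_square)
      also have "\<dots> \<le> \<epsilon>" using n by (simp add: field_simps)
      finally show ?thesis .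
    qed
  qed
qed

text \<open>Compose \<open>flat_exp\<close> with 1 - S, where \<open>S\<close> is the periodized
  capacity potential: the result vanishes near the lattice, where S \<ge> 1, equals exp(-1) where S
  = 0, and has no more energy than \<open>S\<close>.\<close>

lemma perforated_small_energy:
  assumes m2: "DIM('a::euclidean_space) \<ge> 2" and \<epsilon>: "\<epsilon> > 0"
  obtains r and u :: "'a::euclidean_space \<Rightarrow> real" where "r > 0" "perforated r u" "cell_mass u > 0" "cell_energy u \<le> \<epsilon> * cell_mass u"
proof -
  let ?m = "real DIM('a)"
  define F where "F = {k\<in>lat. norm (k::'a) \<le> 1 / 4 + (?m + 1)}"
  have F: "finite F" "F \<subseteq> lat" "{k\<in>lat. norm k \<le> 1 / 4 + (?m + 1)} \<subseteq> F" "{k\<in>lat. norm k \<le> 1 / 4 + ?m} \<subseteq> F"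
    by (auto simp: F_def finite_lat_ball)
  \<comment> \<open>All coordinates lie between 1/4 and 3/4, so every lattice point is at distance
    at least 1/4 and every translate of \<eta> vanishes.\<close>
  define V where "V = box ((1 / 4) *\<^sub>R One) ((3 / 4) *\<^sub>R One :: 'a)"
  have Vc: "V \<subseteq> cell" by (auto simp: V_def cell_def box_def dest!: bspec)
  have lV: "V \<in> lmeasurable" by (simp add: V_def)
  have Vne: "V \<noteq> {}" "open V" by (auto simp: V_def box_ne_empty)
  have "0 < (\<integral>x. indicator V x \<partial>lebesgue :: real)"
    by (rule integral_pos_of_open[OF _ _ Vne(2,1)]) (use lV in \<open>auto simp: fmeasurable_def\<close>)
  then have V: "measure lebesgue V > 0" using lV by (simp add: fmeasurable_def)
  define w where "w = (exp (- 1))\<^sup>2 * measure lebesgue V"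
  have w: "w > 0" using V by (simp add: w_def)
  \<comment> \<open>Cauchy-Schwarz over the translates costs \<open>card F\<close>; the 1 ensures
    positivity. As \<open>w\<close> and \<open>c\<close> are fixed before \<eta>, its energy can be
    chosen below \<epsilon> w / c.\<close>
  define c where "c = real (card F) + 1"
  have c: "c > 0" by (simp add: c_def)
  obtain \<eta> :: "'a \<Rightarrow> real" and s where \<eta>: "test_fun UNIV \<eta>" "\<And>x. 0 \<le> \<eta> x" "\<And>x. 1 / 4 \<le> norm x \<Longrightarrow> \<eta> x = 0"
    "s > 0" "\<And>x. norm x < s \<Longrightarrow> 1 \<le> \<eta> x" "(\<integral>x. (norm (grad \<eta> x))\<^sup>2 \<partial>lebesgue) \<le> \<epsilon> * w / c"
    using zero_capacity_of_point[OF m2, of "\<epsilon> * w / c"] \<epsilon> w c by auto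
  have s\<eta>: "smooth_fun \<eta>" by (rule test_fun_smooth[OF \<eta>(1)])
  have \<eta>0: "\<eta> x = 0" if "1 / 4 < norm x" for x using \<eta>(3)[of x] that by simp
  define S where "S = periodize (1 / 4) \<eta>"
  have sS: "smooth_fun S" unfolding S_def by (rule periodize_smooth[OF \<eta>0 s\<eta>])
  have pS: "periodic S" unfolding S_def by (rule periodize_periodic)
  have gS: "grad S x = (\<Sum>k\<in>F. 1 *\<^sub>R grad \<eta> (x + k))" if "x \<in> cell" for x
    unfolding S_def using cell_norm[OF that] by (subst periodize_grad[OF \<eta>0 s\<eta> F(1-3)]) auto
  define u where "u x = flat_exp (1 - S x)" for x
  have su: "smooth_fun u" unfolding u_def by (intro smooth_compose[OF smooth_flat_exp] smooth_diff smooth_const sS)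
  have "u x = 0" if x: "infdist x lat < s" for x
  proof -
    obtain a where a: "a \<in> lat" "dist x a < s"
    proof -
      have "(INF a\<in>lat. dist x a) < s" using x by (simp add: infdist_notempty[OF lat_nonempty])
      then show thesis using that cINF_less_iff[of lat "dist x" s] lat_nonempty by (auto intro: bdd_belowI2[of _ 0])
    qed
    have "1 \<le> S x"
    proof (cases "norm (x - a) \<le> 1 / 4")
      case True
      have "1 \<le> \<eta> (x + (- a))" using \<eta>(5)[of "x - a"] a(2) by (simp add: dist_norm)
      also have "\<dots> \<le> S x"
        unfolding S_def periodize_def
      proof (rule member_le_sum)
        show "- a \<in> {k. k \<in> lat \<and> norm (x + k) \<le> 1 / 4}" using True a(1) by (simp add: lat_uminus)
        have "{k. k \<in> lat \<and> norm (x + k) \<le> 1 / 4} \<subseteq> {k\<in>lat. norm k \<le> 1 / 4 + norm x}"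
        proof
          fix k assume k: "k \<in> {k. k \<in> lat \<and> norm (x + k) \<le> 1 / 4}"
          then show "k \<in> {k\<in>lat. norm k \<le> 1 / 4 + norm x}"
            using norm_triangle_ineq4[of "x + k" x] by simp
        qed
        then show "finite {k. k \<in> lat \<and> norm (x + k) \<le> 1 / 4}" by (rule finite_subset) (rule finite_lat_ball)
      qed (use \<eta>(2) in auto)
      finally show ?thesis .
    next
      case False
      then have "\<eta> (x - a) = 0" using \<eta>(3)[of "x - a"] by simp
      moreover have "1 \<le> \<eta> (x - a)" using \<eta>(5)[of "x - a"] a(2) by (simp add: dist_norm)
      ultimately show ?thesis by simp
    qed
    then show ?thesis by (simp add: u_def)
  qed
  \<comment> \<open>Half of \<open>s\<close> leaves the margin that \<open>perforated\<close>
    demands.\<close>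
  then have "perforated (s / 2) u"
    unfolding perforated_def using su pS \<eta>(4) by (auto simp: u_def periodic_def intro!: exI[of _ s])
  moreover have mass: "w \<le> cell_mass u"
  proof -
    have "(\<integral>x. (exp (- 1))\<^sup>2 * indicator V x \<partial>lebesgue) \<le> cell_mass u"
    proof (rule integral_mono)
      show "integrable lebesgue (\<lambda>x. (exp (- 1))\<^sup>2 * indicator V x :: real)"
        using lV by (intro integrable_mult_right) (auto simp: fmeasurable_def)
      show "integrable lebesgue (\<lambda>x. indicator cell x * (u x)\<^sup>2)"
        by (intro integrable_cell_continuous continuous_intros smooth_fun_continuous su)
      fix x :: 'a
      show "(exp (- 1))\<^sup>2 * indicator V x \<le> indicator cell x * (u x)\<^sup>2"
      proof (cases "x \<in> V")
        case True
        have "\<eta> (x + k) = 0" if k: "k \<in> lat" for k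
        proof (rule \<eta>(3))
          obtain b :: 'a where b: "b \<in> Basis" using nonempty_Basis by blast
          obtain n :: int where n: "k \<bullet> b = of_int n" using k b by (auto simp: lat_def elim: Ints_cases)
          have xb: "1 / 4 < x \<bullet> b" "x \<bullet> b < 3 / 4" using True b by (auto simp: V_def box_def)
          have "1 / 4 \<le> \<bar>x \<bullet> b + of_int n\<bar>"
          proof (cases "n \<ge> 0")
            case True
            then show ?thesis using xb by linarith
          next
            case False
            then have "n \<le> -1" by simp
            then have "real_of_int n \<le> -1" by linarith
            then show ?thesis using xb by linarith
          qed
          also have "\<dots> \<le> norm (x + k)" using Basis_le_norm[OF b, of "x + k"] by (simp add: inner_add_left n)
          finally show "1 / 4 \<le> norm (x + k)" .
        qed
        then have "S x = 0" unfolding S_def periodize_def by (intro sum.neutral) auto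
        then have "u x = exp (- 1)" by (simp add: u_def flat_exp_def)
        then show ?thesis using True Vc by auto
      qed (simp add: indicator_def)
    qed
    then show ?thesis using lV by (simp add: w_def fmeasurable_def)
  qed
  moreover have "cell_energy u \<le> \<epsilon> * w"
  proof -
    have [measurable]: "grad \<eta> \<in> borel_measurable borel"
      by (rule borel_measurable_continuous_onI[OF continuous_grad[OF s\<eta>]])
    have g0: "grad \<eta> x = 0" if "1 / 4 < norm x" for x
    proof -
      have "open {x::'a. 1 / 4 < norm x}" by (intro open_Collect_less continuous_intros)
      then have "grad \<eta> x = grad (\<lambda>x. 0) x" by (rule grad_eq_on_open) (use that \<eta>0 in auto)
      then show ?thesis by simp
    qed
    have unf: "(\<integral>x. indicator cell x * (\<Sum>k\<in>F. (norm (grad \<eta> (x + k)))\<^sup>2) \<partial>lebesgue) = (\<integral>x. (norm (grad \<eta> x))\<^sup>2 \<partial>lebesgue)"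
      "integrable lebesgue (\<lambda>x. indicator cell x * (\<Sum>k\<in>F. (norm (grad \<eta> (x + k)))\<^sup>2))"
      using integral_unfold_cell[OF _ L2_integrable[OF test_fun_grad_L2[OF \<eta>(1)]] _ F(1,2,4)] g0 by auto
    have "cell_energy u \<le> (\<integral>x. c * (indicator cell x * (\<Sum>k\<in>F. (norm (grad \<eta> (x + k)))\<^sup>2)) \<partial>lebesgue)"
    proof (rule integral_mono)
      show "integrable lebesgue (\<lambda>x. indicator cell x * (norm (grad u x))\<^sup>2)"
        by (intro integrable_cell_continuous continuous_intros continuous_grad su)
      show "integrable lebesgue (\<lambda>x. c * (indicator cell x * (\<Sum>k\<in>F. (norm (grad \<eta> (x + k)))\<^sup>2)))"
        by (intro integrable_mult_right unf)
      fix x :: 'a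
      show "indicator cell x * (norm (grad u x))\<^sup>2 \<le> c * (indicator cell x * (\<Sum>k\<in>F. (norm (grad \<eta> (x + k)))\<^sup>2))"
      proof (cases "x \<in> cell")
        case True
        have "grad (\<lambda>x. 1 - S x) x = - grad S x"
          by (subst grad_diff) (auto intro: smooth_fun_differentiable sS smooth_const)
        then have "grad u x = flat_exp' (1 - S x) *\<^sub>R (- grad S x)"
          unfolding u_def[abs_def]
          using grad_compose[of "\<lambda>x. 1 - S x" x flat_exp, OF _ flat_exp_deriv]
          by (simp add: smooth_fun_differentiable smooth_diff smooth_const sS)
        then have "norm (grad u x) = flat_exp' (1 - S x) * norm (grad S x)" by simp
        also have "\<dots> \<le> 1 * norm (grad S x)" by (intro mult_right_mono flat_exp'_le_1) auto
        finally have "(norm (grad u x))\<^sup>2 \<le> (norm (grad S x))\<^sup>2" by (intro power_mono) auto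
        also have "\<dots> \<le> (\<Sum>k\<in>F. 1\<^sup>2) * (\<Sum>k\<in>F. (norm (grad \<eta> (x + k)))\<^sup>2)"
          unfolding gS[OF True] by (rule norm_sum_scaleR_square_le[OF F(1)])
        also have "\<dots> \<le> c * (\<Sum>k\<in>F. (norm (grad \<eta> (x + k)))\<^sup>2)"
          by (intro mult_right_mono sum_nonneg) (auto simp: c_def)
        finally show ?thesis using True by simp
      qed simp
    qed
    also have "\<dots> = c * (\<integral>x. (norm (grad \<eta> x))\<^sup>2 \<partial>lebesgue)" using unf by simp
    also have "\<dots> \<le> c * (\<epsilon> * w / c)" using \<eta>(6) c by (intro mult_left_mono) auto
    also have "\<dots> = \<epsilon> * w" using c by simp
    finally show ?thesis .
  qed
  moreover have "\<epsilon> * w \<le> \<epsilon> * cell_mass u" using mass \<epsilon> by (intro mult_left_mono) auto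
  ultimately show thesis using that[of "s / 2" u] \<eta>(4) w by auto
qed

section \<open>Large perforated boxes\<close>

text \<open>A product over the coordinates of factors that vanish within 1/(n + 1) of the two faces
  and tend to 1 inside. The faces of the cell are a null set, so dominated convergence
  applies.\<close>

lemma box_cutoff_exists:
  assumes \<kappa>: "\<kappa> > 0"
  obtains \<zeta> :: "'a::euclidean_space \<Rightarrow> real" where "test_fun (box 0 One) \<zeta>" "\<And>x. 0 \<le> \<zeta> x" "\<And>x. \<zeta> x \<le> 1"
    "(\<integral>x. indicator cell x * (1 - \<zeta> x) \<partial>lebesgue) \<le> \<kappa>"
proof -
  define \<zeta> where "\<zeta> n x = (\<Prod>b\<in>Basis. flat_exp (real (Suc n) * (x \<bullet> b) - 1) * flat_exp (real (Suc n) * (1 - x \<bullet> b) - 1))"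
    for n and x :: 'a
  have s: "smooth_fun (\<zeta> n)" for n unfolding \<zeta>_def
    by (intro smooth_prod smooth_mult smooth_compose[OF smooth_flat_exp] smooth_diff smooth_const smooth_inner)
  have nn: "0 \<le> \<zeta> n x" for n x unfolding \<zeta>_def by (intro prod_nonneg) simp
  have le1: "\<zeta> n x \<le> 1" for n x unfolding \<zeta>_def
    by (intro prod_le_1) (auto intro: mult_le_one flat_exp_le_1)
  have t: "test_fun (box 0 One) (\<zeta> n)" for n
  proof (rule test_funI[OF s])
    let ?N = "real (Suc n)"
    let ?K = "cbox ((1 / ?N) *\<^sub>R One) ((1 - 1 / ?N) *\<^sub>R One) :: 'a set"
    show "compact ?K" by simp
    have "0 < 1 / ?N" by simp
    show "?K \<subseteq> box 0 One"
    proof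
      fix x assume x: "x \<in> ?K"
      have "0 < x \<bullet> b \<and> x \<bullet> b < 1" if "b \<in> Basis" for b
      proof -
        have "1 / ?N \<le> x \<bullet> b" "x \<bullet> b \<le> 1 - 1 / ?N" using x that by (auto simp: cbox_def simp del: of_nat_Suc)
        then show ?thesis using \<open>0 < 1 / ?N\<close> by linarith
      qed
      then show "x \<in> box 0 One" by (simp add: box_def)
    qed
    fix x assume "x \<notin> ?K"
    then obtain b where b: "b \<in> Basis" "\<not> (1 / ?N \<le> x \<bullet> b \<and> x \<bullet> b \<le> 1 - 1 / ?N)"
      by (auto simp: cbox_def simp del: of_nat_Suc)
    then have "?N * (x \<bullet> b) - 1 \<le> 0 \<or> ?N * (1 - x \<bullet> b) - 1 \<le> 0"
      by (auto simp: field_simps simp del: of_nat_Suc)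
    then have "flat_exp (?N * (x \<bullet> b) - 1) * flat_exp (?N * (1 - x \<bullet> b) - 1) = 0" by (simp del: of_nat_Suc)
    then show "\<zeta> n x = 0" unfolding \<zeta>_def using b(1) by (subst prod_zero_iff) auto
  qed
  have "(\<lambda>n. \<integral>x. indicator cell x * (1 - \<zeta> n x) \<partial>lebesgue) \<longlonglongrightarrow> integral\<^sup>L lebesgue (\<lambda>x::'a. 0)"
  proof (rule integral_dominated_convergence[where w="\<lambda>x. indicator cell x * 1"])
    show "integrable lebesgue (\<lambda>x::'a. indicator cell x * 1 :: real)" by (rule integrable_cell_continuous) simp
    show "(\<lambda>x. indicator cell x * (1 - \<zeta> n x)) \<in> borel_measurable lebesgue" for n
      by (rule borel_measurable_integrable, rule integrable_cell_continuous)
        (intro continuous_intros smooth_fun_continuous s)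
    show "AE x in lebesgue. (\<lambda>n. indicator cell x * (1 - \<zeta> n x)) \<longlonglongrightarrow> 0"
      using AE_cell_box
    proof eventually_elim
      case (elim x)
      show ?case
      proof (cases "x \<in> cell")
        case True
        then have "x \<in> box 0 One" using elim by blast
        then have x: "0 < x \<bullet> b" "0 < 1 - x \<bullet> b" if "b \<in> Basis" for b using that by (auto simp: box_def)
        have "(\<lambda>n. \<zeta> n x) \<longlonglongrightarrow> (\<Prod>b\<in>(Basis::'a set). 1 * 1)"
          unfolding \<zeta>_def by (intro tendsto_prod tendsto_mult flat_exp_profile_tendsto(1) x)
        then have "(\<lambda>n. \<zeta> n x) \<longlonglongrightarrow> 1" by simp
        from tendsto_mult[OF tendsto_const tendsto_diff[OF tendsto_const this, of 1], of "indicator cell x"]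
        show ?thesis by simp
      qed simp
    qed
    show "AE x in lebesgue. norm (indicator cell x * (1 - \<zeta> n x)) \<le> indicator cell x * 1" for n
      using nn le1 by (intro AE_I2) (auto simp: indicator_def)
  qed simp
  then have "(\<lambda>n. \<integral>x. indicator cell x * (1 - \<zeta> n x) \<partial>lebesgue) \<longlonglongrightarrow> 0" by simp
  then have "\<forall>\<^sub>F n in sequentially. (\<integral>x. indicator cell x * (1 - \<zeta> n x) \<partial>lebesgue) < \<kappa>"
    using \<kappa> by (rule order_tendstoD(2))
  then obtain n where "(\<integral>x. indicator cell x * (1 - \<zeta> n x) \<partial>lebesgue) < \<kappa>"
    by (auto simp: eventually_sequentially)
  then show thesis using that[of "\<zeta> n"] t nn le1 by auto
qed

text \<open>Young's inequality weighted in favour of \<open>b\<close>: the main term keeps a factor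
  close to 1, while the large factor falls on \<open>a\<close>, which will be the small gradient of
  the cutoff.\<close>

lemma norm_add_square_weighted:
  fixes a b :: "'a::real_inner"
  assumes "\<kappa> > 0"
  shows "(norm (a + b))\<^sup>2 \<le> (1 + 1 / \<kappa>) * (norm a)\<^sup>2 + (1 + \<kappa>) * (norm b)\<^sup>2"
proof -
  have "2 * norm a * norm b \<le> (norm a)\<^sup>2 / \<kappa> + \<kappa> * (norm b)\<^sup>2"
  proof -
    have "0 \<le> (norm a - \<kappa> * norm b)\<^sup>2 / \<kappa>" using assms by simp
    also have "\<dots> = (norm a)\<^sup>2 / \<kappa> + \<kappa> * (norm b)\<^sup>2 - 2 * norm a * norm b"
      using assms by (simp add: power2_eq_square field_simps)
    finally show ?thesis by simp
  qed
  moreover have "(norm (a + b))\<^sup>2 \<le> (norm a + norm b)\<^sup>2" by (intro power_mono norm_triangle_ineq) auto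
  ultimately show ?thesis by (simp add: power2_sum algebra_simps)
qed

text \<open>The torsional rigidity \<open>T\<close> of the perforated box is eliminated between two
  bounds: from above, \<open>\<mu> * T\<close> is at most \<open>X\<close> times the volume because
  \<open>lambda1\<close> is at least \<mu>; from below, by the test function
  \<open>U\<close>.\<close>

lemma perforated_box_estimate:
  fixes u :: "'a::euclidean_space \<Rightarrow> real"
  assumes p: "p \<ge> 1" and X: "X \<ge> 0" "\<And>\<Omega>::'a set. open \<Omega> \<Longrightarrow> \<Omega> \<noteq> {} \<Longrightarrow> bounded \<Omega> \<Longrightarrow> Fp p \<Omega> \<le> X"
    and \<mu>: "\<mu> \<ge> 0" "\<And>u::'a \<Rightarrow> real. perforated r u \<Longrightarrow> \<mu> * cell_mass u \<le> cell_energy u"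
    and u: "perforated r u" and N: "N > 0"
    and \<zeta>: "test_fun (box 0 One) \<zeta>"
  defines "U \<equiv> \<lambda>x. u x * \<zeta> ((1 / real N) *\<^sub>R x)"
  shows "\<mu> * (\<integral>x. U x \<partial>lebesgue)\<^sup>2 \<le> X * real N ^ DIM('a) * (\<integral>x. (norm (grad U x))\<^sup>2 \<partial>lebesgue)"
proof -
  obtain r' where u': "smooth_fun u" "r < r'" "\<And>x. infdist x lat < r' \<Longrightarrow> u x = 0"
    using u by (auto simp: perforated_def)
  define P where "P = {x::'a. r < infdist x lat}"
  define \<Omega> where "\<Omega> = box 0 (real N *\<^sub>R One) \<inter> P"
  have oP: "open P" unfolding P_def by (intro open_Collect_less continuous_on_infdist continuous_intros)
  have o\<Omega>: "open \<Omega>" unfolding \<Omega>_def using oP by (intro open_Int) auto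
  have b\<Omega>: "bounded \<Omega>" unfolding \<Omega>_def by (intro bounded_Int disjI1 bounded_box)
  have sub: "\<Omega> \<subseteq> big_cell N" by (auto simp: \<Omega>_def box_def big_cell_def less_imp_le)
  have l\<Omega>: "\<Omega> \<in> lmeasurable" using b\<Omega> o\<Omega> by (intro bounded_set_imp_lmeasurable) auto
  have tU: "test_fun \<Omega> U"
  proof (rule test_funI)
    show "smooth_fun U" unfolding U_def by (intro smooth_mult u' smooth_scale test_fun_smooth[OF \<zeta>])
    let ?K = "((\<lambda>x. real N *\<^sub>R x) ` tsupport \<zeta>) \<inter> {x. r' \<le> infdist x lat}"
    show "compact ?K"
      by (intro compact_Int_closed compact_scaling test_fun_compact[OF \<zeta>] closed_Collect_le continuous_on_infdist continuous_intros)
    show "?K \<subseteq> \<Omega>"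
    proof
      fix x assume x: "x \<in> ?K"
      then obtain y where y: "y \<in> tsupport \<zeta>" "x = real N *\<^sub>R y" by blast
      then have "y \<in> box 0 One" using test_fun_subset[OF \<zeta>] by blast
      then have "x \<in> box 0 (real N *\<^sub>R One)" using y N by (simp add: box_def)
      then show "x \<in> \<Omega>" using x u'(2) by (auto simp: \<Omega>_def P_def)
    qed
    fix x assume x: "x \<notin> ?K"
    show "U x = 0"
    proof (cases "infdist x lat < r'")
      case True
      then show ?thesis by (simp add: U_def u'(3))
    next
      case False
      then have "x \<notin> (\<lambda>x. real N *\<^sub>R x) ` tsupport \<zeta>" using x by auto
      moreover have "x = real N *\<^sub>R ((1 / real N) *\<^sub>R x)" using N by simp
      ultimately have "(1 / real N) *\<^sub>R x \<notin> tsupport \<zeta>" by blast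
      then show ?thesis by (simp add: U_def not_tsupport)
    qed
  qed
  show ?thesis
  \<comment> \<open>Large holes may cover the whole box; then \<open>U\<close> is identically
    0.\<close>
  proof (cases "\<Omega> = {}")
    case True
    then have "U x = 0" for x using test_fun_zero[OF tU] by simp
    then show ?thesis using X(1) by simp
  next
    case False
    have "0 < (\<integral>x. indicator \<Omega> x \<partial>lebesgue :: real)"
      by (rule integral_pos_of_open[OF _ _ o\<Omega> False]) (use l\<Omega> in \<open>auto simp: fmeasurable_def\<close>)
    then have m\<Omega>: "measure lebesgue \<Omega> > 0" using l\<Omega> by (simp add: fmeasurable_def)
    obtain \<phi>0 where \<phi>0: "test_fun \<Omega> \<phi>0" "(\<integral>x. (\<phi>0 x)\<^sup>2 \<partial>lebesgue) \<noteq> 0"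
      using exists_test_fun[OF o\<Omega> False] by blast
    have l: "\<mu> \<le> lambda1 \<Omega>"
    proof (rule lambda1_ge[OF \<phi>0])
      fix \<phi> assume \<phi>: "test_fun \<Omega> \<phi>"
      have "test_fun {x. r < infdist x lat} \<phi>"
        by (rule test_fun_mono[OF \<phi>]) (auto simp: \<Omega>_def P_def)
      then show "\<mu> * (\<integral>x. (\<phi> x)\<^sup>2 \<partial>lebesgue) \<le> (\<integral>x. (norm (grad \<phi> x))\<^sup>2 \<partial>lebesgue)"
        using perforated_rayleigh[OF \<mu>(1), of r \<phi>] \<mu>(2) by blast
    qed
    define T where "T = (\<integral>x. indicator \<Omega> x * torsion \<Omega> x \<partial>lebesgue)"
    define D where "D = (\<integral>x. (norm (grad U x))\<^sup>2 \<partial>lebesgue)"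
    have D0: "D \<ge> 0" by (simp add: D_def)
    have T0: "T \<ge> 0"
    proof -
      obtain G where G: "H01 \<Omega> (torsion \<Omega>) G" "\<And>\<phi>. test_fun \<Omega> \<phi> \<Longrightarrow> (\<integral>x. G x \<bullet> grad \<phi> x \<partial>lebesgue) = (\<integral>x. \<phi> x \<partial>lebesgue)"
        using is_torsion_torsion[OF l\<Omega>] by (auto simp: is_torsion_def)
      have "T = (\<integral>x. (norm (G x))\<^sup>2 \<partial>lebesgue)" unfolding T_def using torsion_energy[OF l\<Omega> G] by simp
      then show ?thesis by simp
    qed
    have "lambda1 \<Omega> * (T / measure lebesgue \<Omega>) \<le> Fp p \<Omega>"
      unfolding T_def using l \<mu>(1) by (intro Fp_ge_mean_torsion[OF l\<Omega> m\<Omega> b\<Omega> p]) simp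
    also have "\<dots> \<le> X" by (rule X(2)[OF o\<Omega> False b\<Omega>])
    finally have "lambda1 \<Omega> * T \<le> X * measure lebesgue \<Omega>" using m\<Omega> by (simp add: field_simps)
    moreover have "\<mu> * T \<le> lambda1 \<Omega> * T" using l T0 by (rule mult_right_mono)
    moreover have "X * measure lebesgue \<Omega> \<le> X * real N ^ DIM('a)"
    proof -
      have "measure lebesgue \<Omega> \<le> measure lebesgue (big_cell N :: 'a set)"
        using sub l\<Omega> by (intro measure_mono_fmeasurable big_cell_lmeasurable) (auto simp: fmeasurableD)
      then show ?thesis using X(1) measure_big_cell[OF N, where 'a='a] by (intro mult_left_mono) auto
    qed
    ultimately have \<mu>T: "\<mu> * T \<le> X * real N ^ DIM('a)" by linarith
    have "\<mu> * (\<integral>x. U x \<partial>lebesgue)\<^sup>2 \<le> \<mu> * (T * D)"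
      unfolding T_def D_def using torsion_integral_ge[OF l\<Omega> is_torsion_torsion[OF l\<Omega>] tU] \<mu>(1) by (rule mult_left_mono)
    also have "\<dots> = (\<mu> * T) * D" by simp
    also have "\<dots> \<le> X * real N ^ DIM('a) * D" using \<mu>T D0 by (rule mult_right_mono)
    finally show ?thesis by (simp add: D_def)
  qed
qed

text \<open>The box estimate per cell, first as the box grows and then as \<kappa> tends to 0. The
  cutoff costs at most \<open>M * \<kappa>\<close> of the mean of \<open>u\<close>, a factor 1 +
  \<kappa> in the energy, and a gradient term that fades like the inverse square of the box
  size.\<close>

lemma perforated_mean_energy:
  fixes u :: "'a::euclidean_space \<Rightarrow> real"
  assumes p: "p \<ge> 1" and X: "X \<ge> 0" "\<And>\<Omega>::'a set. open \<Omega> \<Longrightarrow> \<Omega> \<noteq> {} \<Longrightarrow> bounded \<Omega> \<Longrightarrow> Fp p \<Omega> \<le> X"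
    and \<mu>: "\<mu> \<ge> 0" "\<And>u::'a \<Rightarrow> real. perforated r u \<Longrightarrow> \<mu> * cell_mass u \<le> cell_energy u"
    and u: "perforated r u"
  defines "A \<equiv> \<integral>x. indicator cell x * u x \<partial>lebesgue"
  assumes A: "A > 0"
  shows "\<mu> * A\<^sup>2 \<le> X * cell_energy u"
proof -
  have u': "smooth_fun u" "periodic u" "\<And>x. 0 \<le> u x" using u by (auto simp: perforated_def)
  have cu: "continuous_on UNIV u" by (rule smooth_fun_continuous[OF u'(1)])
  have pg: "periodic (\<lambda>x. (norm (grad u x))\<^sup>2)" "continuous_on UNIV (\<lambda>x. (norm (grad u x))\<^sup>2)"
    using periodic_grad[OF u'(2,1)] by (auto simp: periodic_def intro!: continuous_intros continuous_grad u')
  obtain M where M: "M > 0" "\<And>x. norm (u x) \<le> M" using periodic_bounded[OF u'(2) cu] by blast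
  have Mu: "u x \<le> M" for x using M(2)[of x] by simp
  let ?E = "cell_energy u"
  \<comment> \<open>The condition \<open>M * \<kappa> \<le> A\<close> keeps the lower bound for the
    integral of \<open>U\<close> nonnegative, so that it may be squared.\<close>
  have step: "\<mu> * (A - M * \<kappa>)\<^sup>2 \<le> X * ((1 + \<kappa>) * ?E)" if \<kappa>: "0 < \<kappa>" "M * \<kappa> \<le> A" for \<kappa>
  proof -
    obtain \<zeta> :: "'a \<Rightarrow> real" where \<zeta>: "test_fun (box 0 One) \<zeta>" "\<And>x. 0 \<le> \<zeta> x" "\<And>x. \<zeta> x \<le> 1"
      "(\<integral>x. indicator cell x * (1 - \<zeta> x) \<partial>lebesgue) \<le> \<kappa>"
      using box_cutoff_exists[OF \<kappa>(1)] by blast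
    obtain C where C: "\<And>x. norm (grad \<zeta> x) \<le> C" using test_fun_grad_bounded[OF \<zeta>(1)] by blast
    have C0: "C \<ge> 0" using C[of 0] norm_ge_zero order_trans by blast
    have s\<zeta>: "smooth_fun \<zeta>" by (rule test_fun_smooth[OF \<zeta>(1)])
    have [measurable]: "\<zeta> \<in> borel_measurable borel" by (rule test_fun_borel[OF \<zeta>(1)])
    \<comment> \<open>The weighted Young factor times the squared bound on \<open>u\<close> times
      the unscaled gradient of \<zeta>; it depends on \<kappa> but not on the box size, which is why
      the box grows first.\<close>
    define c where "c = (1 + 1 / \<kappa>) * (M * C)\<^sup>2"
    have N: "\<mu> * (A - M * \<kappa>)\<^sup>2 \<le> X * ((1 + \<kappa>) * ?E + c * (inverse (real (Suc n)))\<^sup>2)" for n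
    proof -
      let ?N = "Suc n"
      let ?V = "real ?N ^ DIM('a)"
      let ?z = "\<lambda>x. \<zeta> ((1 / real ?N) *\<^sub>R x)"
      define U where "U x = u x * ?z x" for x
      have V: "?V > 0" by simp
      have z0: "?z x = 0" "grad \<zeta> ((1 / real ?N) *\<^sub>R x) = 0" if "x \<notin> big_cell ?N" for x
      proof -
        have "(1 / real ?N) *\<^sub>R x \<notin> cell"
          using that indicator_big_cell[of ?N x] by (auto simp: indicator_def split: if_splits)
        then have "(1 / real ?N) *\<^sub>R x \<notin> box 0 One" using box_cell by blast
        then show "?z x = 0" "grad \<zeta> ((1 / real ?N) *\<^sub>R x) = 0"
          using test_fun_zero[OF \<zeta>(1)] test_fun_grad_zero[OF \<zeta>(1)] by auto
      qed
      have tz: "smooth_fun ?z" by (rule smooth_scale[OF s\<zeta>])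
      have sU: "smooth_fun U" unfolding U_def by (intro smooth_mult u' tz)
      have pe: "\<mu> * (\<integral>x. U x \<partial>lebesgue)\<^sup>2 \<le> X * ?V * (\<integral>x. (norm (grad U x))\<^sup>2 \<partial>lebesgue)"
        unfolding U_def[abs_def] by (rule perforated_box_estimate[OF p X \<mu> u _ \<zeta>(1)]) simp_all
      have tU: "test_fun UNIV U"
      proof (rule test_funI[OF sU])
        let ?K = "(\<lambda>x. real ?N *\<^sub>R x) ` tsupport \<zeta>"
        show "compact ?K" by (intro compact_scaling test_fun_compact[OF \<zeta>(1)])
        fix x assume x: "x \<notin> ?K"
        have "x = real ?N *\<^sub>R ((1 / real ?N) *\<^sub>R x)" by simp
        then have "(1 / real ?N) *\<^sub>R x \<notin> tsupport \<zeta>" using x by blast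
        then show "U x = 0" by (simp add: U_def not_tsupport)
      qed simp
      have iz: "integrable lebesgue (\<lambda>x. indicator (big_cell ?N) x * (1 - ?z x))"
      proof (rule integrable_bounded_on_lmeasurable[OF _ big_cell_lmeasurable[of ?N], of _ 1])
        have "?z \<in> borel_measurable lebesgue"
          by (rule continuous_imp_lebesgue_measurable[OF smooth_fun_continuous[OF tz]])
        moreover have "(big_cell ?N :: 'a set) \<in> sets lebesgue" using big_cell_lmeasurable[of ?N] by (rule fmeasurableD)
        ultimately show "(\<lambda>x. indicator (big_cell ?N) x * (1 - ?z x)) \<in> borel_measurable lebesgue"
          by (intro borel_measurable_times borel_measurable_indicator borel_measurable_diff) auto
      qed (use \<zeta>(2,3) in \<open>auto simp: indicator_def\<close>)
      have iu: "(\<integral>x. indicator (big_cell ?N) x * u x \<partial>lebesgue) = ?V * A" "integrable lebesgue (\<lambda>x. indicator (big_cell ?N) x * u x)"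
        unfolding A_def using integral_big_cell_periodic[OF u'(2) cu, of ?N] by auto
      have "?V * (A - M * \<kappa>) \<le> ?V * A - M * (?V * (\<integral>x. indicator cell x * (1 - \<zeta> x) \<partial>lebesgue))"
        using \<zeta>(4) M(1) V mult_left_mono[OF \<zeta>(4), of "?V * M"] by (simp add: algebra_simps)
      also have "\<dots> = (\<integral>x. indicator (big_cell ?N) x * u x \<partial>lebesgue) - M * (\<integral>x. indicator (big_cell ?N) x * (1 - ?z x) \<partial>lebesgue)"
        using integral_big_cell_scale[of "\<lambda>x. 1 - \<zeta> x" ?N] iu by simp
      also have "\<dots> = (\<integral>x. indicator (big_cell ?N) x * u x - M * (indicator (big_cell ?N) x * (1 - ?z x)) \<partial>lebesgue)"
        using iu(2) iz by simp
      also have "\<dots> \<le> (\<integral>x. U x \<partial>lebesgue)"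
      proof (rule integral_mono)
        show "integrable lebesgue (\<lambda>x. indicator (big_cell ?N) x * u x - M * (indicator (big_cell ?N) x * (1 - ?z x)))"
          using iu(2) iz by simp
        show "integrable lebesgue U" by (rule test_fun_integrable[OF tU])
        fix x :: 'a
        show "indicator (big_cell ?N) x * u x - M * (indicator (big_cell ?N) x * (1 - ?z x)) \<le> U x"
        proof (cases "x \<in> big_cell ?N")
          case True
          have "u x * (1 - ?z x) \<le> M * (1 - ?z x)" using Mu[of x] \<zeta>(3) by (intro mult_right_mono) auto
          then show ?thesis using True by (simp add: U_def algebra_simps)
        next
          case False
          then show ?thesis using z0(1)[OF False] by (simp add: U_def)
        qed
      qed
      finally have AU: "?V * (A - M * \<kappa>) \<le> (\<integral>x. U x \<partial>lebesgue)" .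
      have "(\<integral>x. (norm (grad U x))\<^sup>2 \<partial>lebesgue) \<le>
        (\<integral>x. (1 + \<kappa>) * (indicator (big_cell ?N) x * (norm (grad u x))\<^sup>2) + (c * (inverse (real ?N))\<^sup>2) * (indicator (big_cell ?N) x * 1) \<partial>lebesgue)"
      proof (rule integral_mono)
        show "integrable lebesgue (\<lambda>x. (norm (grad U x))\<^sup>2)" by (rule L2_integrable[OF test_fun_grad_L2[OF tU]])
        show "integrable lebesgue (\<lambda>x. (1 + \<kappa>) * (indicator (big_cell ?N) x * (norm (grad u x))\<^sup>2) + (c * (inverse (real ?N))\<^sup>2) * (indicator (big_cell ?N) x * 1))"
          using integral_big_cell_periodic(2)[OF pg, of ?N] integral_big_cell_periodic(2)[of "\<lambda>_::'a. 1" ?N]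
          by (intro Bochner_Integration.integrable_add integrable_mult_right) (auto simp: periodic_def)
        fix x :: 'a
        have gU: "grad U x = (u x / real ?N) *\<^sub>R grad \<zeta> ((1 / real ?N) *\<^sub>R x) + ?z x *\<^sub>R grad u x"
          unfolding U_def[abs_def] using smooth_fun_differentiable[OF tz] smooth_fun_differentiable[OF u'(1)]
          by (subst grad_mult) (auto simp: grad_scale[OF s\<zeta>])
        show "(norm (grad U x))\<^sup>2 \<le> (1 + \<kappa>) * (indicator (big_cell ?N) x * (norm (grad u x))\<^sup>2) + (c * (inverse (real ?N))\<^sup>2) * (indicator (big_cell ?N) x * 1)"
        proof (cases "x \<in> big_cell ?N")
          case True
          have "norm ((u x / real ?N) *\<^sub>R grad \<zeta> ((1 / real ?N) *\<^sub>R x)) = (inverse (real ?N)) * (norm (u x) * norm (grad \<zeta> ((1 / real ?N) *\<^sub>R x)))"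
            by (simp add: divide_inverse abs_mult)
          also have "\<dots> \<le> inverse (real ?N) * (M * C)"
            using M C C0 by (intro mult_left_mono mult_mono) auto
          finally have "(norm ((u x / real ?N) *\<^sub>R grad \<zeta> ((1 / real ?N) *\<^sub>R x)))\<^sup>2 \<le> (inverse (real ?N) * (M * C))\<^sup>2"
            by (intro power_mono) auto
          then have "(1 + 1 / \<kappa>) * (norm ((u x / real ?N) *\<^sub>R grad \<zeta> ((1 / real ?N) *\<^sub>R x)))\<^sup>2 \<le> (1 + 1 / \<kappa>) * (inverse (real ?N) * (M * C))\<^sup>2"
            using \<kappa>(1) by (intro mult_left_mono) auto
          also have "(1 + 1 / \<kappa>) * (inverse (real ?N) * (M * C))\<^sup>2 = c * (inverse (real ?N))\<^sup>2"
            unfolding c_def power_mult_distrib by (simp only: mult_ac)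
          finally have a: "(1 + 1 / \<kappa>) * (norm ((u x / real ?N) *\<^sub>R grad \<zeta> ((1 / real ?N) *\<^sub>R x)))\<^sup>2 \<le> c * (inverse (real ?N))\<^sup>2" .
          have "norm (?z x *\<^sub>R grad u x) \<le> 1 * norm (grad u x)"
            unfolding norm_scaleR using \<zeta>(2,3) by (intro mult_right_mono) auto
          then have "(norm (?z x *\<^sub>R grad u x))\<^sup>2 \<le> (norm (grad u x))\<^sup>2" by (intro power_mono) auto
          then have "(1 + \<kappa>) * (norm (?z x *\<^sub>R grad u x))\<^sup>2 \<le> (1 + \<kappa>) * (norm (grad u x))\<^sup>2"
            using \<kappa>(1) by (intro mult_left_mono) auto
          with a norm_add_square_weighted[OF \<kappa>(1), of "(u x / real ?N) *\<^sub>R grad \<zeta> ((1 / real ?N) *\<^sub>R x)" "?z x *\<^sub>R grad u x"]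
          have "(norm (grad U x))\<^sup>2 \<le> (1 + \<kappa>) * (norm (grad u x))\<^sup>2 + c * (inverse (real ?N))\<^sup>2"
            unfolding gU by linarith
          then show ?thesis using True by simp
        next
          case False
          then show ?thesis unfolding gU using z0[OF False] by simp
        qed
      qed
      also have "\<dots> = (1 + \<kappa>) * (?V * ?E) + (c * (inverse (real ?N))\<^sup>2) * ?V"
      proof -
        have one: "(\<integral>x. indicator (big_cell ?N :: 'a set) x * 1 \<partial>lebesgue) = ?V * (\<integral>x. indicator (cell::'a set) x * 1 \<partial>lebesgue)"
          "integrable lebesgue (\<lambda>x::'a. indicator (big_cell ?N) x * 1 :: real)"
          using integral_big_cell_periodic[of "\<lambda>_::'a. 1" ?N] by (auto simp: periodic_def)
        have "(\<integral>x. indicator (cell::'a set) x * 1 \<partial>lebesgue) = (1::real)"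
          using cell_lmeasurable[where 'a='a] by (simp add: fmeasurableD)
        then have one': "(\<integral>x. indicator (big_cell ?N :: 'a set) x * 1 \<partial>lebesgue) = ?V" using one(1) by simp
        note pp = integral_big_cell_periodic[OF pg, of ?N, OF zero_less_Suc]
        show ?thesis
          using Bochner_Integration.integral_add[OF integrable_mult_right[OF pp(2), of "1 + \<kappa>"] integrable_mult_right[OF one(2), of "c * (inverse (real ?N))\<^sup>2"]]
          unfolding integral_mult_right_zero pp(1) one' by simp
      qed
      finally have DU: "(\<integral>x. (norm (grad U x))\<^sup>2 \<partial>lebesgue) \<le> ?V * ((1 + \<kappa>) * ?E + c * (inverse (real ?N))\<^sup>2)"
        by (simp add: algebra_simps)
      have "?V\<^sup>2 * (\<mu> * (A - M * \<kappa>)\<^sup>2) = \<mu> * (?V * (A - M * \<kappa>))\<^sup>2" by (simp add: power_mult_distrib)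
      also have "\<dots> \<le> \<mu> * (\<integral>x. U x \<partial>lebesgue)\<^sup>2"
        using AU \<kappa>(2) V \<mu>(1) by (intro mult_left_mono power_mono) auto
      also have "\<dots> \<le> X * ?V * (\<integral>x. (norm (grad U x))\<^sup>2 \<partial>lebesgue)" by (rule pe)
      also have "\<dots> \<le> X * ?V * (?V * ((1 + \<kappa>) * ?E + c * (inverse (real ?N))\<^sup>2))"
        using DU X(1) V by (intro mult_left_mono) auto
      also have "\<dots> = ?V\<^sup>2 * (X * ((1 + \<kappa>) * ?E + c * (inverse (real ?N))\<^sup>2))" by (simp only: power2_eq_square mult_ac)
      finally show ?thesis using V by (simp only: mult_le_cancel_left_pos zero_less_power)
    qed
    have "(\<lambda>n. X * ((1 + \<kappa>) * ?E + c * (inverse (real (Suc n)))\<^sup>2)) \<longlonglongrightarrow> X * ((1 + \<kappa>) * ?E + c * 0\<^sup>2)"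
      by (intro tendsto_intros LIMSEQ_inverse_real_of_nat)
    from LIMSEQ_le_const[OF this exI[of _ 0]] N show ?thesis by simp
  qed
  have ev: "\<forall>\<^sub>F \<kappa> in at_right 0. \<mu> * (A - M * \<kappa>)\<^sup>2 \<le> X * ((1 + \<kappa>) * ?E)"
    unfolding eventually_at_right_field
    by (intro exI[of _ "A / M"]) (use A M(1) step in \<open>auto simp: field_simps\<close>)
  have l1: "((\<lambda>\<kappa>. \<mu> * (A - M * \<kappa>)\<^sup>2) \<longlongrightarrow> \<mu> * (A - M * 0)\<^sup>2) (at_right 0)" by (intro tendsto_intros)
  have l2: "((\<lambda>\<kappa>. X * ((1 + \<kappa>) * ?E)) \<longlongrightarrow> X * ((1 + 0) * ?E)) (at_right 0)" by (intro tendsto_intros)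
  from tendsto_le[OF _ l2 l1 ev] show ?thesis by simp
qed

text \<open>For a near minimizer the energy is at most \<mu> (1 + \<epsilon>) times its mass, and by
  Poincare and \<mu> \<le> \<epsilon> its squared mean is at least 1 - 2C\<epsilon> times its mass.
  In \<open>perforated_mean_energy\<close> the positive product of \<mu> and the mass cancels, and
  \<epsilon> tends to 0.\<close>

lemma sup_Fp_ge_1:
  assumes m2: "DIM('a::euclidean_space) \<ge> 2" and p: "p \<ge> 1"
    and X: "X \<ge> 0" "\<And>\<Omega>::'a set. open \<Omega> \<Longrightarrow> \<Omega> \<noteq> {} \<Longrightarrow> bounded \<Omega> \<Longrightarrow> Fp p \<Omega> \<le> X"
  shows "X \<ge> 1"
proof -
  let ?m = "real DIM('a)"
  define C where "C = ?m\<^sup>2 / 2"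
  have C: "C > 0" by (simp add: C_def)
  have key: "1 - 2 * C * \<epsilon> \<le> X * (1 + \<epsilon>)" if \<epsilon>: "0 < \<epsilon>" "\<epsilon> < 1" "2 * C * \<epsilon> < 1" for \<epsilon>
  proof -
    obtain r and u0 :: "'a \<Rightarrow> real" where u0: "r > 0" "perforated r u0" "cell_mass u0 > 0" "cell_energy u0 \<le> \<epsilon> * cell_mass u0"
      using perforated_small_energy[OF m2 \<epsilon>(1)] by blast
    obtain c where c: "c > 0" "\<And>u::'a \<Rightarrow> real. perforated r u \<Longrightarrow> c * cell_mass u \<le> cell_energy u"
      using perforated_poincare[OF u0(1)] by blast
    define Q where "Q = {cell_energy u / cell_mass u | u::'a \<Rightarrow> real. perforated r u \<and> cell_mass u > 0}"
    define \<mu> where "\<mu> = Inf Q"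
    have Q0: "cell_energy u0 / cell_mass u0 \<in> Q" using u0 by (auto simp: Q_def)
    have Qc: "c \<le> q" if "q \<in> Q" for q
      using that c(2) by (auto simp: Q_def le_divide_eq)
    have bdd: "bdd_below Q" using Qc by (rule bdd_belowI)
    have \<mu>c: "c \<le> \<mu>" unfolding \<mu>_def using Q0 Qc by (intro cInf_greatest) auto
    have \<mu>0: "\<mu> > 0" using \<mu>c c(1) by simp
    have "\<mu> \<le> cell_energy u0 / cell_mass u0" unfolding \<mu>_def by (rule cInf_lower[OF Q0 bdd])
    also have "\<dots> \<le> \<epsilon>" using u0 by (simp add: divide_le_eq)
    finally have \<mu>\<epsilon>: "\<mu> \<le> \<epsilon>" .
    have \<mu>u: "\<mu> * cell_mass u \<le> cell_energy u" if u: "perforated r u" for u :: "'a \<Rightarrow> real"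
    proof (cases "cell_mass u > 0")
      case True
      then have "\<mu> \<le> cell_energy u / cell_mass u" unfolding \<mu>_def using u by (intro cInf_lower[OF _ bdd]) (auto simp: Q_def)
      then show ?thesis using True by (simp add: le_divide_eq)
    next
      case False
      have "cell_mass u \<ge> 0" "cell_energy u \<ge> 0" by (intro integral_nonneg_AE; simp)+
      moreover from this False have "cell_mass u = 0" by linarith
      ultimately show ?thesis by (simp only: mult_zero_right)
    qed
    have "Inf Q < \<mu> * (1 + \<epsilon>)" using \<mu>0 \<epsilon>(1) by (simp add: \<mu>_def[symmetric])
    then obtain q where q: "q \<in> Q" "q < \<mu> * (1 + \<epsilon>)" using cInf_lessD[of Q] Q0 by blast
    then obtain u :: "'a \<Rightarrow> real" where u: "perforated r u" "cell_mass u > 0" "cell_energy u / cell_mass u < \<mu> * (1 + \<epsilon>)"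
      by (auto simp: Q_def)
    define m where "m = cell_mass u"
    define e where "e = cell_energy u"
    define A where "A = (\<integral>x. indicator cell x * u x \<partial>lebesgue)"
    have mp: "m > 0" using u(2) by (simp add: m_def)
    have e: "e \<le> \<mu> * (1 + \<epsilon>) * m" using u(2,3) by (simp add: m_def e_def divide_less_eq)
    have u': "smooth_fun u" "periodic u" "\<And>x. 0 \<le> u x" using u(1) by (auto simp: perforated_def)
    have "m - A\<^sup>2 \<le> C * e" using periodic_poincare[OF u'] by (simp add: m_def A_def C_def e_def)
    also have "\<dots> \<le> C * (\<mu> * (1 + \<epsilon>) * m)" using e C by (intro mult_left_mono) auto
    \<comment> \<open>Uses \<mu> \<le> \<epsilon> together with 1 + \<epsilon> \<le> 2.\<close>
    also have "\<dots> \<le> C * (\<epsilon> * 2 * m)"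
      using C mp \<mu>\<epsilon> \<mu>0 \<epsilon> by (intro mult_left_mono mult_right_mono mult_mono) auto
    finally have A2: "(1 - 2 * C * \<epsilon>) * m \<le> A\<^sup>2" by (simp add: algebra_simps)
    have "A \<ge> 0" unfolding A_def using u'(3) by (intro integral_nonneg_AE) auto
    moreover have "A \<noteq> 0"
    proof
      assume "A = 0"
      moreover have "0 < (1 - 2 * C * \<epsilon>) * m" using mp \<epsilon>(3) by simp
      ultimately show False using A2 by simp
    qed
    ultimately have A0: "A > 0" by simp
    have "\<mu> * A\<^sup>2 \<le> X * e"
      unfolding A_def e_def
      by (rule perforated_mean_energy[OF p X _ \<mu>u u(1)]) (use \<mu>0 A0 in \<open>auto simp: A_def\<close>)
    also have "\<dots> \<le> X * (\<mu> * (1 + \<epsilon>) * m)" using e X(1) by (rule mult_left_mono)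
    finally have "\<mu> * ((1 - 2 * C * \<epsilon>) * m) \<le> X * (\<mu> * (1 + \<epsilon>) * m)"
      using mult_left_mono[OF A2, of \<mu>] \<mu>0 by simp
    then have "(\<mu> * m) * (1 - 2 * C * \<epsilon>) \<le> (\<mu> * m) * (X * (1 + \<epsilon>))" by (simp only: mult_ac)
    then show ?thesis using \<mu>0 mp by (simp only: mult_le_cancel_left_pos mult_pos_pos)
  qed
  have ev: "\<forall>\<^sub>F \<epsilon> in at_right 0. 1 - 2 * C * \<epsilon> \<le> X * (1 + \<epsilon>)"
    unfolding eventually_at_right_field
    by (intro exI[of _ "min 1 (1 / (2 * C))"]) (use C key in \<open>auto simp: field_simps\<close>)
  have l1: "((\<lambda>\<epsilon>. 1 - 2 * C * \<epsilon>) \<longlongrightarrow> 1 - 2 * C * 0) (at_right 0)" by (intro tendsto_intros)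
  have l2: "((\<lambda>\<epsilon>. X * (1 + \<epsilon>)) \<longlongrightarrow> X * (1 + 0)) (at_right 0)" by (intro tendsto_intros)
  from tendsto_le[OF _ l2 l1 ev] show ?thesis by simp
qed

section \<open>The critical exponents\<close>

lemma admissible_lmeasurable:
  assumes "open \<Omega>" "0 < emeasure lebesgue \<Omega>" "emeasure lebesgue \<Omega> < \<infinity>"
  shows "\<Omega> \<in> lmeasurable" "measure lebesgue \<Omega> > 0"
proof -
  show l: "\<Omega> \<in> lmeasurable" using assms by (auto simp: fmeasurable_def)
  show "measure lebesgue \<Omega> > 0"
    using assms emeasure_eq_ennreal_measure[OF fmeasurableD2[OF l]] by (metis ennreal_0 measure_nonneg less_le)
qed

lemma frakF_ge_1:
  assumes "DIM('a::euclidean_space) \<ge> 2" "1 \<le> p"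
  shows "frakF TYPE('a) p \<ge> 1"
proof (rule ccontr)
  assume "\<not> ?thesis"
  then have "frakF TYPE('a) p < ereal 1" unfolding one_ereal_def[symmetric] by (simp add: not_le)
  \<comment> \<open>A real number in between turns the \<open>ereal\<close> supremum into a real
    bound; its maximum with 0 meets the nonnegativity demanded of \<open>X\<close>.\<close>
  then obtain z where z: "frakF TYPE('a) p < ereal z" "ereal z < ereal 1" using ereal_dense2 by blast
  have "1 \<le> max z 0"
  proof (rule sup_Fp_ge_1[OF assms])
    fix \<Omega> :: "'a set" assume \<Omega>: "open \<Omega>" "\<Omega> \<noteq> {}" "bounded \<Omega>"
    have "\<not> negligible \<Omega>" by (rule open_not_negligible[OF \<Omega>(1,2)])
    moreover have s: "\<Omega> \<in> sets lebesgue" using \<Omega>(1) by auto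
    ultimately have "emeasure lebesgue \<Omega> \<noteq> 0" by (auto simp: negligible_iff_null_sets null_sets_def)
    moreover have "emeasure lebesgue \<Omega> < \<infinity>"
      using bounded_set_imp_lmeasurable[OF \<Omega>(3) s] by (auto simp: fmeasurable_def)
    ultimately have "ereal (Fp p \<Omega>) \<le> frakF TYPE('a) p"
      unfolding frakF_def using \<Omega>(1) by (intro SUP_upper) (auto simp: zero_less_iff_neq_zero)
    then have "ereal (Fp p \<Omega>) < ereal z" using z(1) by (rule le_less_trans)
    then show "Fp p \<Omega> \<le> max z 0" by simp
  qed simp
  then show False using z(2) by simp
qed

theorem theorem3:
  assumes "DIM('a::euclidean_space) \<ge> 2"
  shows "2 \<le> p_crit TYPE('a) \<and> p_crit TYPE('a) \<le> p_crit_convex TYPE('a) \<and>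
         p_crit_convex TYPE('a) \<le> ereal (8 * real DIM('a)) \<and>
         (\<forall>p::real. 1 \<le> p \<and> ereal p \<le> p_crit TYPE('a) \<longrightarrow> frakF TYPE('a) p = 1)"
proof (intro conjI allI impI)
  have le2: "frakF TYPE('a) p \<le> 1" if "1 \<le> p" "p \<le> 2" for p
    unfolding frakF_def
  proof (rule SUP_least)
    fix \<Omega> :: "'a set" assume "\<Omega> \<in> {\<Omega>. open \<Omega> \<and> 0 < emeasure lebesgue \<Omega> \<and> emeasure lebesgue \<Omega> < \<infinity>}"
    then show "ereal (Fp p \<Omega>) \<le> 1" using Fp_le_1[of \<Omega> p] admissible_lmeasurable[of \<Omega>] that by auto
  qed
  show p2: "2 \<le> p_crit TYPE('a)"
    unfolding p_crit_def
  proof (rule Inf_greatest)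
    fix q assume "q \<in> {ereal p | p. 1 \<le> p \<and> frakF TYPE('a) p > 1}"
    then obtain p where p: "q = ereal p" "1 \<le> p" "frakF TYPE('a) p > 1" by blast
    then have "\<not> p \<le> 2" using le2[of p] by auto
    then have "ereal 2 \<le> ereal p" by simp
    then show "2 \<le> q" using p(1) by simp
  qed
  have mono: "frakF_convex TYPE('a) p \<le> frakF TYPE('a) p" for p
    unfolding frakF_def frakF_convex_def by (rule SUP_subset_mono) auto
  show "p_crit TYPE('a) \<le> p_crit_convex TYPE('a)"
    unfolding p_crit_def p_crit_convex_def
    by (rule Inf_superset_mono) (use mono less_le_trans in blast)
  show "p_crit_convex TYPE('a) \<le> ereal (8 * real DIM('a))"
    unfolding p_crit_convex_def
  proof (rule Inf_lower)
    let ?p = "8 * real DIM('a)"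
    have b: "0 < emeasure lebesgue (ball (0::'a) 1)" "emeasure lebesgue (ball (0::'a) 1) < \<infinity>"
      using open_not_negligible[of "ball (0::'a) 1"] lmeasurable_ball[of "0::'a" 1]
      by (auto simp: negligible_iff_null_sets null_sets_def fmeasurable_def zero_less_iff_neq_zero)
    have "1 < ereal (Fp ?p (ball (0::'a) 1))" using Fp_ball_gt_1[OF assms] by simp
    also have "\<dots> \<le> frakF_convex TYPE('a) ?p"
      unfolding frakF_convex_def by (rule SUP_upper) (use b in auto)
    finally have "frakF_convex TYPE('a) ?p > 1" .
    moreover have "1 \<le> ?p" using assms by linarith
    ultimately show "ereal ?p \<in> {ereal p | p. 1 \<le> p \<and> frakF_convex TYPE('a) p > 1}" by blast
  qed
  fix p :: real assume p: "1 \<le> p \<and> ereal p \<le> p_crit TYPE('a)"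
  \<comment> \<open>A smaller exponent with supremum above 1 would belong to the set whose infimum
    is \<open>p_crit\<close>.\<close>
  have below: "frakF TYPE('a) q \<le> 1" if q: "1 \<le> q" "q < p" for q
  proof (rule ccontr)
    assume "\<not> ?thesis"
    then have "p_crit TYPE('a) \<le> ereal q"
      unfolding p_crit_def using q(1) by (intro Inf_lower) auto
    then have "ereal p \<le> ereal q" using p order_trans by blast
    then show False using q(2) by simp
  qed
  have "frakF TYPE('a) p \<le> 1"
  proof (cases "p \<le> 2")
    case True
    then show ?thesis using le2 p by blast
  next
    case False
    show ?thesis unfolding frakF_def
    proof (rule SUP_least)
      fix \<Omega> :: "'a set" assume \<Omega>: "\<Omega> \<in> {\<Omega>. open \<Omega> \<and> 0 < emeasure lebesgue \<Omega> \<and> emeasure lebesgue \<Omega> < \<infinity>}"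
      \<comment> \<open>The exponent may equal \<open>p_crit\<close>, where \<open>below\<close> is
        silent about \<open>p\<close> itself; left continuity is applied domain by domain, since a
        supremum need not inherit it.\<close>
      have "Fp p \<Omega> \<le> 1"
      proof (rule Fp_le_1_left_closed)
        show "\<Omega> \<in> lmeasurable" "measure lebesgue \<Omega> > 0" using admissible_lmeasurable[of \<Omega>] \<Omega> by auto
        show "1 < p" using False by simp
        fix q assume q: "1 \<le> q" "q < p"
        have "ereal (Fp q \<Omega>) \<le> frakF TYPE('a) q" unfolding frakF_def using \<Omega> by (rule SUP_upper)
        also have "\<dots> \<le> 1" by (rule below[OF q])
        finally show "Fp q \<Omega> \<le> 1" by simp
      qed
      then show "ereal (Fp p \<Omega>) \<le> 1" by simp
    qed
  qed
  then show "frakF TYPE('a) p = 1" using frakF_ge_1[OF assms] p by (simp add: antisym)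
qed

end
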